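(* Let $\mathfrak{g}$ be a complex simple Lie algebra of type $A_{N-1}$ ($\mathfrak{g}=sl(N)$), $D_N$ ($\mathfrak{g}=so(2N)$) or $B_N$ ($\mathfrak{g}=so(2N+1)$), and let $p\ge 0$ be an integer with $N-2p\ge 2$. With $\lambda_0^k$, $\pi_k'$, $H_{\lambda_0^k}$, $L_\lambda$ as described in the context, put $\sigma_0^k=\ln(1+\xi L_{\lambda_0^k})$ and, for $k=0,1,\dots,p$, $$\mathcal{F}_{\mathcal{B}_k}=\Big(\prod_{\lambda'\in\pi_k'}\exp\big\{\xi\, L_{\lambda'}\otimes L_{\lambda_0^k-\lambda'}\,e^{-\frac12\sigma_0^k}\big\}\Big)\cdot\exp\big\{H_{\lambda_0^k}\otimes\sigma_0^k\big\}$$ (the factors in the product over $\pi_k'$ commute with each other). Then for every $k=0,1,\dots,p$ the element $$\mathcal{F}_{\mathcal{B}_{k\prec0}}=\mathcal{F}_{\mathcal{B}_k}\mathcal{F}_{\mathcal{B}_{k-1}}\cdots\mathcal{F}_{\mathcal{B}_0}\in (U(\mathfrak{g})\otimes U(\mathfrak{g}))[[\xi]]$$ is a twisting element for $U(\mathfrak{g})$ with its standard Hopf structure (generators of $\mathfrak{g}$ primitive).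
   Context: Twisting element: an invertible $\mathcal{F}\in(U(\mathfrak{g})\otimes U(\mathfrak{g}))[[\xi]]$ ($\xi$ a formal parameter) with $(\epsilon\otimes \mathrm{id})(\mathcal{F})=(\mathrm{id}\otimes\epsilon)(\mathcal{F})=1$ and $\mathcal{F}_{12}(\Delta\otimes \mathrm{id})(\mathcal{F})=\mathcal{F}_{23}(\mathrm{id}\otimes\Delta)(\mathcal{F})$, where $\Delta,\epsilon$ are the coproduct and counit of $U(\mathfrak{g})$ extended $\xi$-linearly. Roots in the standard orthonormal $e$-basis $e_1,\dots,e_N$, relative to a fixed Cartan subalgebra: for $sl(N)$, $e_i-e_j$ ($i\ne j$); for $so(2N)$, $\pm e_i\pm e_j$ ($i<j$); for $so(2N+1)$, $\pm e_i\pm e_j$ ($i<j$) and $\pm e_i$. Sequence of subalgebras: $\mathcal{A}_k=U(\mathfrak{g}_k)$, where $\mathfrak{g}_0=\mathfrak{g}$ and $\mathfrak{g}_k$ is $sl(N-2k)$, $so(2(N-2k))$, $so(2(N-2k)+1)$ respectively, embedded regularly in $\mathfrak{g}$ as the subalgebra whose roots are the roots of $\mathfrak{g}$ involving only $e_i$ with $i>2k$. Initial roots: $\lambda_0^k=e_{2k+1}-e_{2k+2}$ for $sl$, and $\lambda_0^k=e_{2k+1}+e_{2k+2}$ for $so(2N)$ and $so(2N+1)$. Constituent roots: $\pi_k=\pi_k'\cup\pi_k''$ is the set of roots $\lambda',\lambda''$ of $\mathfrak{g}_k$ with $\lambda'+\lambda''=\lambda_0^k$ and $\lambda'+\lambda_0^k$,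 $\lambda''+\lambda_0^k$ not roots, where $\pi_k''=\{\lambda_0^k-\lambda'\mid\lambda'\in\pi_k'\}$ and - $sl$: $\pi_k'=\{e_{2k+1}-e_l\mid 2k+3\le l\le N\}$; - $so(2N)$: $\pi_k'=\{e_{2k+1}\pm e_l\mid 2k+3\le l\le N\}$; - $so(2N+1)$: $\pi_k'=\{e_{2k+1}\}\cup\{e_{2k+1}\pm e_l\mid 2k+3\le l\le N\}$. Generators: $H_{\lambda_0^k}$ is the element of the Cartan subalgebra dual to $\lambda_0^k$ (a multiple of the coroot of $\lambda_0^k$), and $L_\lambda$ ($\lambda\in\pi_k\cup\{\lambda_0^k\}$) are nonzero root vectors, normalized (as is always possible) so that for all $\lambda'\in\pi_k'$ $$[H_{\lambda_0^k},L_{\lambda'}]=\tfrac12L_{\lambda'},\quad [H_{\lambda_0^k},L_{\lambda_0^k-\lambda'}]=\tfrac12L_{\lambda_0^k-\lambda'},\quad [H_{\lambda_0^k},L_{\lambda_0^k}]=L_{\lambda_0^k},$$ $$[L_{\lambda'},L_{\lambda_0^k-\lambda'}]=L_{\lambda_0^k},\qquad [L_{\lambda_0^k},L_{\lambda'}]=[L_{\lambda_0^k},L_{\lambda_0^k-\lambda'}]=0.$$ *)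

theory Defs
  imports
    Complex_Main
    "HOL-Library.Multiset"
    "HOL-Library.Function_Algebras"
    "HOL-Computational_Algebra.Formal_Power_Series"
    "Jordan_Normal_Form.Matrix"
begin

section \<open>Complex vector spaces, associative algebras and Lie algebras\<close>

class cvector = ab_group_add +
  fixes scaleC :: "complex \<Rightarrow> 'a \<Rightarrow> 'a"  (infixr \<open>*\<^sub>C\<close> 75)
  assumes scaleC_add_right: "c *\<^sub>C (x + y) = c *\<^sub>C x + c *\<^sub>C y"
    and scaleC_add_left: "(c + d) *\<^sub>C x = c *\<^sub>C x + d *\<^sub>C x"
    and scaleC_scaleC: "c *\<^sub>C d *\<^sub>C x = (c * d) *\<^sub>C x"
    and scaleC_one: "1 *\<^sub>C x = x"

class calgebra_1 = cvector + ring_1 +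
  assumes mult_scaleC_left: "(c *\<^sub>C x) * y = c *\<^sub>C (x * y)"
    and mult_scaleC_right: "x * (c *\<^sub>C y) = c *\<^sub>C (x * y)"

class lie_algebra = cvector +
  fixes bracket :: "'a \<Rightarrow> 'a \<Rightarrow> 'a"
  assumes bracket_add_left: "bracket (x + y) z = bracket x z + bracket y z"
    and bracket_add_right: "bracket x (y + z) = bracket x y + bracket x z"
    and bracket_scaleC_left: "bracket (c *\<^sub>C x) y = c *\<^sub>C bracket x y"
    and bracket_scaleC_right: "bracket x (c *\<^sub>C y) = c *\<^sub>C bracket x y"
    and bracket_self: "bracket x x = 0"
    and jacobi: "bracket x (bracket y z) + bracket y (bracket z x) + bracket z (bracket x y) = 0"

definition lie_ideal :: "'g::lie_algebra set \<Rightarrow> bool" where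
  "lie_ideal I \<longleftrightarrow> 0 \<in> I \<and> (\<forall>x\<in>I. \<forall>y\<in>I. x + y \<in> I) \<and> (\<forall>c. \<forall>x\<in>I. c *\<^sub>C x \<in> I)
     \<and> (\<forall>x. \<forall>y\<in>I. bracket x y \<in> I)"

definition simple_lie_algebra :: "'g::lie_algebra itself \<Rightarrow> bool" where
  "simple_lie_algebra _ \<longleftrightarrow> (\<exists>x y :: 'g. bracket x y \<noteq> 0)
     \<and> (\<forall>I :: 'g set. lie_ideal I \<longrightarrow> I = {0} \<or> I = UNIV)"

definition clinear :: "('a::cvector \<Rightarrow> 'b::cvector) \<Rightarrow> bool" where
  "clinear f \<longleftrightarrow> (\<forall>x y. f (x + y) = f x + f y) \<and> (\<forall>c x. f (c *\<^sub>C x) = c *\<^sub>C f x)"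

definition cbilinear :: "('a::cvector \<Rightarrow> 'b::cvector \<Rightarrow> 'c::cvector) \<Rightarrow> bool" where
  "cbilinear f \<longleftrightarrow> (\<forall>b. clinear (\<lambda>a. f a b)) \<and> (\<forall>a. clinear (f a))"

lemma scaleC_zero_left [simp]: "0 *\<^sub>C (x::'a::cvector) = 0"
  using scaleC_add_left[of 0 0 x] by simp

lemma scaleC_zero_right [simp]: "c *\<^sub>C (0::'a::cvector) = 0"
  using scaleC_add_right[of c 0 "0::'a"] by simp

lemma scaleC_minus_one: "(-1) *\<^sub>C (x::'a::cvector) = - x"
proof -
  have "x + (-1) *\<^sub>C x = (1 + (-1)) *\<^sub>C x"
    unfolding scaleC_add_left scaleC_one ..
  then show ?thesis by (simp add: eq_neg_iff_add_eq_0 add.commute)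
qed

lemma clinear_0: "clinear f \<Longrightarrow> f 0 = 0"
  unfolding clinear_def by (metis scaleC_zero_left)

lemma clinear_sum_mset: "clinear f \<Longrightarrow> f (\<Sum>x\<in>#M. g x) = (\<Sum>x\<in>#M. f (g x))"
  by (induction M) (simp_all add: clinear_0, simp add: clinear_def)

instantiation complex :: calgebra_1
begin
definition scaleC_complex :: "complex \<Rightarrow> complex \<Rightarrow> complex" where "scaleC_complex = (*)"
instance by standard (simp_all add: scaleC_complex_def algebra_simps)
end

section \<open>Tensor products\<close>

text \<open>A multiset of pairs stands for the formal sum of the pure tensors it contains.\<close>

inductive tensor_eq :: "('a::cvector \<times> 'b::cvector) multiset \<Rightarrow> ('a \<times> 'b) multiset \<Rightarrow> bool" where
  refl: "tensor_eq M M"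
| sym: "tensor_eq M N \<Longrightarrow> tensor_eq N M"
| trans: "tensor_eq M N \<Longrightarrow> tensor_eq N P \<Longrightarrow> tensor_eq M P"
| plus: "tensor_eq M N \<Longrightarrow> tensor_eq (M + P) (N + P)"
| add_left: "tensor_eq {#(a + a', b)#} {#(a, b), (a', b)#}"
| add_right: "tensor_eq {#(a, b + b')#} {#(a, b), (a, b')#}"
| scale: "tensor_eq {#(c *\<^sub>C a, b)#} {#(a, c *\<^sub>C b)#}"
| zero: "tensor_eq {#(0, b)#} {#}"

quotient_type (overloaded) ('a, 'b) tensor = "('a::cvector \<times> 'b::cvector) multiset" / tensor_eq
  by (rule equivpI) (auto intro: reflpI sympI transpI tensor_eq.refl tensor_eq.sym tensor_eq.trans)

lift_definition tens :: "'a::cvector \<Rightarrow> 'b::cvector \<Rightarrow> ('a, 'b) tensor"  (infixr \<open>\<otimes>\<^sub>C\<close> 76)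
  is "\<lambda>a b. {#(a, b)#}" .

lemma tensor_eq_plus: "tensor_eq M M' \<Longrightarrow> tensor_eq N N' \<Longrightarrow> tensor_eq (M + N) (M' + N')"
  by (metis tensor_eq.plus tensor_eq.trans union_commute)

lemma tensor_eq_scale: "tensor_eq M N \<Longrightarrow>
  tensor_eq (image_mset (\<lambda>(a, b). (c *\<^sub>C a, b)) M) (image_mset (\<lambda>(a, b). (c *\<^sub>C a, b)) N)"
proof (induction rule: tensor_eq.induct)
  case (scale d a b)
  have "tensor_eq {#(d *\<^sub>C (c *\<^sub>C a), b)#} {#(c *\<^sub>C a, d *\<^sub>C b)#}" by (rule tensor_eq.scale)
  then show ?case by (simp add: scaleC_scaleC mult.commute)
qed (auto intro: tensor_eq.intros simp: scaleC_add_right)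

lemma tensor_eq_neg: "tensor_eq (image_mset (\<lambda>(a, b). ((-1) *\<^sub>C a, b)) M + M) {#}"
proof (induction M)
  case (add x M)
  obtain a b where x: "x = (a, b)" by force
  have "tensor_eq {#((-1) *\<^sub>C a, b), (a, b)#} {#(0, b)#}"
    using tensor_eq.sym[OF tensor_eq.add_left[of "(-1) *\<^sub>C a" a b]] by (simp add: scaleC_minus_one)
  then have "tensor_eq {#((-1) *\<^sub>C a, b), (a, b)#} {#}"
    using tensor_eq.zero tensor_eq.trans by blast
  from tensor_eq_plus[OF this add.IH] show ?case
    by (simp add: x add.commute add_mset_commute)
qed (auto intro: tensor_eq.refl)

instantiation tensor :: (cvector, cvector) cvector
begin
lift_definition zero_tensor :: "('a, 'b) tensor" is "{#}" .
lift_definition plus_tensor :: "('a, 'b) tensor \<Rightarrow> ('a, 'b) tensor \<Rightarrow> ('a, 'b) tensor" is "(+)"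
  by (rule tensor_eq_plus)
lift_definition scaleC_tensor :: "complex \<Rightarrow> ('a, 'b) tensor \<Rightarrow> ('a, 'b) tensor"
  is "\<lambda>c. image_mset (\<lambda>(a, b). (c *\<^sub>C a, b))"
  by (rule tensor_eq_scale)
definition uminus_tensor :: "('a, 'b) tensor \<Rightarrow> ('a, 'b) tensor" where "- t = (-1) *\<^sub>C (t::('a, 'b) tensor)"
definition minus_tensor :: "('a, 'b) tensor \<Rightarrow> ('a, 'b) tensor \<Rightarrow> ('a, 'b) tensor"
  where "s - t = s + - (t::('a, 'b) tensor)"
instance
proof
  fix s t u :: "('a, 'b) tensor" and c d :: complex
  show "s + t + u = s + (t + u)" by transfer (simp add: add.assoc tensor_eq.refl)
  show "s + t = t + s" by transfer (simp add: add.commute tensor_eq.refl)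
  show "0 + t = t" by transfer (simp add: tensor_eq.refl)
  show "- t + t = 0" unfolding uminus_tensor_def by transfer (rule tensor_eq_neg)
  show "s - t = s + - t" by (rule minus_tensor_def)
  show "c *\<^sub>C (s + t) = c *\<^sub>C s + c *\<^sub>C t" by transfer (simp add: tensor_eq.refl)
  show "c *\<^sub>C d *\<^sub>C t = (c * d) *\<^sub>C t"
    by transfer (simp add: multiset.map_comp comp_def case_prod_unfold scaleC_scaleC tensor_eq.refl)
  show "1 *\<^sub>C t = t" by transfer (simp add: scaleC_one case_prod_unfold tensor_eq.refl)
  show "(c + d) *\<^sub>C t = c *\<^sub>C t + d *\<^sub>C t"
  proof transfer
    fix c d and M :: "('a \<times> 'b) multiset"
    show "tensor_eq (image_mset (\<lambda>(a, b). ((c + d) *\<^sub>C a, b)) M)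
       (image_mset (\<lambda>(a, b). (c *\<^sub>C a, b)) M + image_mset (\<lambda>(a, b). (d *\<^sub>C a, b)) M)"
    proof (induction M)
      case (add x M)
      obtain a b where x: "x = (a, b)" by force
      from tensor_eq_plus[OF tensor_eq.add_left[of "c *\<^sub>C a" "d *\<^sub>C a" b] add.IH] show ?case
        by (simp add: x scaleC_add_left add.commute add_mset_commute)
    qed (simp add: tensor_eq.refl)
  qed
qed
end

text \<open>The linear map out of the tensor product induced by a bilinear map \<open>f\<close>; only meaningful
  for bilinear \<open>f\<close>, where the value does not depend on the chosen representative.\<close>

definition tensor_lift :: "('a::cvector \<Rightarrow> 'b::cvector \<Rightarrow> 'c::cvector) \<Rightarrow> ('a, 'b) tensor \<Rightarrow> 'c" where
  "tensor_lift f t = (\<Sum>(a, b)\<in>#rep_tensor t. f a b)"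

lemma tensor_eq_lift:
  assumes "cbilinear f"
  shows "tensor_eq M N \<Longrightarrow> (\<Sum>(a, b)\<in>#M. f a b) = (\<Sum>(a, b)\<in>#N. f a b)"
proof -
  have z: "f 0 b = 0" for b using assms clinear_0 unfolding cbilinear_def by blast
  show "tensor_eq M N \<Longrightarrow> ?thesis"
    by (induction rule: tensor_eq.induct) (use assms z in \<open>auto simp: cbilinear_def clinear_def\<close>)
qed

lemma tensor_lift_abs:
  assumes "cbilinear f"
  shows "tensor_lift f (abs_tensor M) = (\<Sum>(a, b)\<in>#M. f a b)"
  unfolding tensor_lift_def
  by (rule tensor_eq_lift[OF assms]) (rule rep_abs_rsp_left[OF Quotient3_tensor tensor_eq.refl])

lemma tensor_lift_tens: "cbilinear f \<Longrightarrow> tensor_lift f (a \<otimes>\<^sub>C b) = f a b"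
  unfolding tens.abs_eq by (simp add: tensor_lift_abs)

lemma tensor_lift_linear: "cbilinear f \<Longrightarrow> clinear (tensor_lift f)"
  unfolding clinear_def
proof (intro conjI allI)
  fix s t assume f: "cbilinear f"
  show "tensor_lift f (s + t) = tensor_lift f s + tensor_lift f t"
    by (induction s, induction t) (simp add: plus_tensor.abs_eq tensor_lift_abs[OF f])
next
  fix c t assume f: "cbilinear f"
  then have c: "clinear (\<lambda>a. f a b)" for b by (simp add: cbilinear_def)
  have "(\<Sum>x\<in>#M. f (c *\<^sub>C fst x) (snd x)) = c *\<^sub>C (\<Sum>x\<in>#M. f (fst x) (snd x))" for M
    using c by (induction M) (simp_all add: clinear_def scaleC_add_right)
  then show "tensor_lift f (c *\<^sub>C t) = c *\<^sub>C tensor_lift f t"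
    by (induction t) (simp add: scaleC_tensor.abs_eq tensor_lift_abs[OF f] multiset.map_comp
      comp_def case_prod_unfold)
qed

lemma cbilinear_tens: "cbilinear (\<otimes>\<^sub>C)"
proof -
  have 1: "(a + a') \<otimes>\<^sub>C b = a \<otimes>\<^sub>C b + a' \<otimes>\<^sub>C b" for a a' :: 'a and b :: 'b
    by transfer (metis add_mset_add_single add_mset_commute tensor_eq.add_left)
  have 2: "a \<otimes>\<^sub>C (b + b') = a \<otimes>\<^sub>C b + a \<otimes>\<^sub>C b'" for a :: 'a and b b' :: 'b
    by transfer (metis add_mset_add_single add_mset_commute tensor_eq.add_right)
  have 3: "(c *\<^sub>C a) \<otimes>\<^sub>C b = c *\<^sub>C (a \<otimes>\<^sub>C b)" for c and a :: 'a and b :: 'b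
    by transfer (simp add: tensor_eq.refl)
  have 4: "(c *\<^sub>C a) \<otimes>\<^sub>C b = a \<otimes>\<^sub>C (c *\<^sub>C b)" for c and a :: 'a and b :: 'b
    by transfer (rule tensor_eq.scale)
  show ?thesis unfolding cbilinear_def clinear_def using 1 2 3 4 by metis
qed

lemma tensor_sum: "t = (\<Sum>(a, b)\<in>#rep_tensor t. a \<otimes>\<^sub>C b)"
proof -
  have "abs_tensor M = (\<Sum>(a, b)\<in>#M. a \<otimes>\<^sub>C b)" for M :: "('a \<times> 'b) multiset"
  proof (induction M)
    case (add x M)
    have "abs_tensor (add_mset x M) = abs_tensor {#x#} + abs_tensor M"
      by (simp add: plus_tensor.abs_eq)
    then show ?case by (cases x) (simp add: add.IH tens.abs_eq)
  qed (simp add: zero_tensor.abs_eq)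
  from this[of "rep_tensor t"] show ?thesis
    using Quotient3_abs_rep[OF Quotient3_tensor] by metis
qed

lemma tensor_induct [case_names zero add]:
  assumes "P 0" and "\<And>a b t. P t \<Longrightarrow> P (a \<otimes>\<^sub>C b + t)"
  shows "P t"
proof -
  have "P (\<Sum>(a, b)\<in>#M. a \<otimes>\<^sub>C b)" for M
    using assms by (induction M) auto
  then show ?thesis using tensor_sum by metis
qed

lemma cbilinearI:
  assumes "\<And>a a' b. f (a + a') b = f a b + f a' b" "\<And>c a b. f (c *\<^sub>C a) b = c *\<^sub>C f a b"
    and "\<And>a b b'. f a (b + b') = f a b + f a b'" "\<And>c a b. f a (c *\<^sub>C b) = c *\<^sub>C f a b"
  shows "cbilinear f"
  using assms by (simp add: cbilinear_def clinear_def)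
lemma tens_simps:
  fixes a a' :: "'a::cvector" and b b' :: "'b::cvector"
  shows
  "(a + a') \<otimes>\<^sub>C b = a \<otimes>\<^sub>C b + a' \<otimes>\<^sub>C b" "a \<otimes>\<^sub>C (b + b') = a \<otimes>\<^sub>C b + a \<otimes>\<^sub>C b'"
  "(c *\<^sub>C a) \<otimes>\<^sub>C b = c *\<^sub>C (a \<otimes>\<^sub>C b)" "a \<otimes>\<^sub>C (c *\<^sub>C b) = c *\<^sub>C (a \<otimes>\<^sub>C b)"
  using cbilinear_tens[where 'a = 'a and 'b = 'b] by (simp_all add: cbilinear_def clinear_def)

lemma ex_linear_functional:
  assumes "(x::'a::cvector) \<noteq> 0"
  shows "\<exists>f :: 'a \<Rightarrow> complex. clinear f \<and> f x = 1"
proof -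
  interpret vector_space_pair "scaleC :: complex \<Rightarrow> 'a \<Rightarrow> 'a" "(*) :: complex \<Rightarrow> complex \<Rightarrow> complex"
    by unfold_locales (simp_all add: scaleC_add_right scaleC_add_left scaleC_scaleC scaleC_one algebra_simps)
  have i: "vs1.independent {x}" using assms by simp
  define f where "f = construct {x} (\<lambda>_. 1)"
  have "f x = 1" unfolding f_def by (rule construct_basis[OF i]) simp
  moreover have "clinear f"
  proof -
    interpret f: Vector_Spaces.linear "scaleC :: complex \<Rightarrow> 'a \<Rightarrow> 'a" "(*) :: complex \<Rightarrow> complex \<Rightarrow> complex" f
      unfolding f_def by (rule linear_construct[OF i])
    show ?thesis by (simp add: clinear_def scaleC_complex_def f.add f.scale)
  qed
  ultimately show ?thesis by blast
qed

instantiation tensor :: (calgebra_1, calgebra_1) calgebra_1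
begin
definition one_tensor :: "('a, 'b) tensor" where "1 = 1 \<otimes>\<^sub>C 1"
definition times_tensor :: "('a, 'b) tensor \<Rightarrow> ('a, 'b) tensor \<Rightarrow> ('a, 'b) tensor" where
  "s * t = tensor_lift (\<lambda>a b. tensor_lift (\<lambda>a' b'. (a * a') \<otimes>\<^sub>C (b * b')) t) s"
instance
proof
  let ?m = "\<lambda>a b. \<lambda>a' b'. (a * a') \<otimes>\<^sub>C (b * b')"
  define P :: "'a \<Rightarrow> 'b \<Rightarrow> ('a, 'b) tensor \<Rightarrow> ('a, 'b) tensor" where "P = (\<lambda>a b. tensor_lift (?m a b))"
  have times: "s * t = tensor_lift (\<lambda>a b. P a b t) s" for s t :: "('a, 'b) tensor"
    unfolding times_tensor_def P_def ..
  have inner: "cbilinear (?m a b)" for a :: 'a and b :: 'b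
    by (rule cbilinearI) (simp_all add: tens_simps distrib_left mult_scaleC_right)
  have lin: "clinear (P a b)" for a b
    unfolding P_def by (rule tensor_lift_linear[OF inner])
  have i0: "P a b 0 = 0" and i1: "P a b (s + t) = P a b s + P a b t"
    and i2: "P a b (c *\<^sub>C s) = c *\<^sub>C P a b s" for a b s t c
    using lin[of a b] by (simp_all add: clinear_0) (simp_all add: clinear_def)
  have i3: "P a b (a' \<otimes>\<^sub>C b') = (a * a') \<otimes>\<^sub>C (b * b')" for a b a' b'
    unfolding P_def by (rule tensor_lift_tens[OF inner])
  have outer: "cbilinear (\<lambda>a b. P a b t)" for t
  proof (induction t rule: tensor_induct)
    case zero
    show ?case by (rule cbilinearI) (simp_all add: i0)
  next
    case (add a b t)
    then show ?case
      by (simp add: cbilinear_def clinear_def i1 i3 distrib_right mult_scaleC_left tens_simps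
        scaleC_add_right)
  qed
  have addl: "(s + t) * u = s * u + t * u" and scl: "(c *\<^sub>C s) * u = c *\<^sub>C (s * u)"
    for s t u :: "('a, 'b) tensor" and c
    unfolding times using tensor_lift_linear[OF outer] by (simp_all add: clinear_def)
  have zl: "0 * u = 0" for u :: "('a, 'b) tensor"
    unfolding times using clinear_0[OF tensor_lift_linear[OF outer]] .
  have pl: "(a \<otimes>\<^sub>C b) * t = P a b t" for a b and t :: "('a, 'b) tensor"
    unfolding times by (rule tensor_lift_tens[OF outer])
  have pp: "(a \<otimes>\<^sub>C b) * (a' \<otimes>\<^sub>C b') = (a * a') \<otimes>\<^sub>C (b * b')" for a a' :: 'a and b b' :: 'b
    unfolding pl by (rule i3)
  have addr: "u * (s + t) = u * s + u * t" for s t u :: "('a, 'b) tensor"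
    by (induction u rule: tensor_induct) (simp_all add: zl addl pl i1)
  have scr: "u * (c *\<^sub>C s) = c *\<^sub>C (u * s)" for s u :: "('a, 'b) tensor" and c
    by (induction u rule: tensor_induct) (simp_all add: zl addl pl i2 scaleC_add_right)
  have zr: "u * 0 = 0" for u :: "('a, 'b) tensor"
    by (induction u rule: tensor_induct) (simp_all add: zl addl pl i0)
  have a2: "((a \<otimes>\<^sub>C b) * (a' \<otimes>\<^sub>C b')) * u = (a \<otimes>\<^sub>C b) * ((a' \<otimes>\<^sub>C b') * u)" for a a' b b'
    and u :: "('a, 'b) tensor"
    by (induction u rule: tensor_induct) (simp_all add: zr addr pp mult.assoc)
  have a1: "((a \<otimes>\<^sub>C b) * t) * u = (a \<otimes>\<^sub>C b) * (t * u)" for a b and t u :: "('a, 'b) tensor"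
    by (induction t rule: tensor_induct) (simp_all add: zl zr addr addl a2)
  fix s t u :: "('a, 'b) tensor" and c :: complex
  show "(s * t) * u = s * (t * u)"
    by (induction s rule: tensor_induct) (simp_all add: zl addl a1)
  show "(s + t) * u = s * u + t * u" by (rule addl)
  show "u * (s + t) = u * s + u * t" by (rule addr)
  show "(c *\<^sub>C s) * t = c *\<^sub>C (s * t)" by (rule scl)
  show "s * (c *\<^sub>C t) = c *\<^sub>C (s * t)" by (rule scr)
  show "1 * t = t" unfolding one_tensor_def
    by (induction t rule: tensor_induct) (simp_all add: zr addr pp)
  show "t * 1 = t" unfolding one_tensor_def
    by (induction t rule: tensor_induct) (simp_all add: zl addl pp)
  show "(0::('a, 'b) tensor) \<noteq> 1"
  proof
    assume z: "(0::('a, 'b) tensor) = 1"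
    obtain f :: "'a \<Rightarrow> complex" where f: "clinear f" "f 1 = 1"
      using ex_linear_functional[of "1::'a"] by auto
    obtain g :: "'b \<Rightarrow> complex" where g: "clinear g" "g 1 = 1"
      using ex_linear_functional[of "1::'b"] by auto
    have fg: "cbilinear (\<lambda>a b. f a * g b)"
      using f g by (intro cbilinearI) (simp_all add: clinear_def scaleC_complex_def algebra_simps)
    have "tensor_lift (\<lambda>a b. f a * g b) (1::('a, 'b) tensor) = 1"
      unfolding one_tensor_def using f g by (simp add: tensor_lift_tens[OF fg])
    moreover have "tensor_lift (\<lambda>a b. f a * g b) (0::('a, 'b) tensor) = 0"
      by (rule clinear_0[OF tensor_lift_linear[OF fg]])
    ultimately show False using z by simp
  qed
qed
end

lemma tens_mult_tens:
  fixes a a' :: "'a::calgebra_1" and b b' :: "'b::calgebra_1"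
  shows "(a \<otimes>\<^sub>C b) * (a' \<otimes>\<^sub>C b') = (a * a') \<otimes>\<^sub>C (b * b')"
proof -
  have inner: "cbilinear (\<lambda>a' b'. (a * a') \<otimes>\<^sub>C (b * b'))" for a :: 'a and b :: 'b
    by (rule cbilinearI) (simp_all add: tens_simps distrib_left mult_scaleC_right)
  define h where "h = (\<lambda>c d a b. tensor_lift (\<lambda>a' b'. (a * a') \<otimes>\<^sub>C (b * b')) ((c::'a) \<otimes>\<^sub>C (d::'b)))"
  have h: "h c d a b = (a * c) \<otimes>\<^sub>C (b * d)" for a b c d
    unfolding h_def by (rule tensor_lift_tens[OF inner])
  have "cbilinear (h c d)" for c d
    by (rule cbilinearI) (simp_all add: h distrib_right mult_scaleC_left tens_simps)
  then have "tensor_lift (h a' b') (a \<otimes>\<^sub>C b) = (a * a') \<otimes>\<^sub>C (b * b')"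
    by (simp add: tensor_lift_tens h)
  then show ?thesis unfolding times_tensor_def h_def .
qed

definition tensor_map ::
  "('a::cvector \<Rightarrow> 'c::cvector) \<Rightarrow> ('b::cvector \<Rightarrow> 'd::cvector) \<Rightarrow> ('a, 'b) tensor \<Rightarrow> ('c, 'd) tensor" where
  "tensor_map f g = tensor_lift (\<lambda>a b. f a \<otimes>\<^sub>C g b)"

definition tensor_assoc ::
  "('a::cvector, ('b::cvector, 'c::cvector) tensor) tensor \<Rightarrow> (('a, 'b) tensor, 'c) tensor" where
  "tensor_assoc = tensor_lift (\<lambda>a. tensor_lift (\<lambda>b c. (a \<otimes>\<^sub>C b) \<otimes>\<^sub>C c))"

section \<open>Universal enveloping algebras\<close>

text \<open>\<open>U(g)\<close> is the unital associative complex algebra presented by the generators \<open>x \<in> g\<close>, subject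
  to the linear relations of \<open>g\<close> and \<open>x y = y x + [x, y]\<close>.\<close>

datatype 'g uterm = Gen 'g | Const complex | Plus "'g uterm" "'g uterm" | Times "'g uterm" "'g uterm"

inductive u_eq :: "'g::lie_algebra uterm \<Rightarrow> 'g uterm \<Rightarrow> bool" where
  refl: "u_eq s s"
| sym: "u_eq s t \<Longrightarrow> u_eq t s"
| trans: "u_eq s t \<Longrightarrow> u_eq t r \<Longrightarrow> u_eq s r"
| Plus_cong: "u_eq s s' \<Longrightarrow> u_eq t t' \<Longrightarrow> u_eq (Plus s t) (Plus s' t')"
| Times_cong: "u_eq s s' \<Longrightarrow> u_eq t t' \<Longrightarrow> u_eq (Times s t) (Times s' t')"
| Plus_assoc: "u_eq (Plus (Plus s t) r) (Plus s (Plus t r))"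
| Plus_comm: "u_eq (Plus s t) (Plus t s)"
| Plus_zero: "u_eq (Plus (Const 0) s) s"
| Times_assoc: "u_eq (Times (Times s t) r) (Times s (Times t r))"
| Times_one_left: "u_eq (Times (Const 1) s) s"
| Times_zero_left: "u_eq (Times (Const 0) s) (Const 0)"
| distrib_left: "u_eq (Times s (Plus t r)) (Plus (Times s t) (Times s r))"
| distrib_right: "u_eq (Times (Plus s t) r) (Plus (Times s r) (Times t r))"
| Const_add: "u_eq (Const (c + d)) (Plus (Const c) (Const d))"
| Const_mult: "u_eq (Const (c * d)) (Times (Const c) (Const d))"
| Const_central: "u_eq (Times (Const c) s) (Times s (Const c))"
| Gen_add: "u_eq (Gen (x + y)) (Plus (Gen x) (Gen y))"
| Gen_scale: "u_eq (Gen (c *\<^sub>C x)) (Times (Const c) (Gen x))"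
| Gen_bracket: "u_eq (Times (Gen x) (Gen y)) (Plus (Times (Gen y) (Gen x)) (Gen (bracket x y)))"

quotient_type (overloaded) 'g U = "'g::lie_algebra uterm" / u_eq
  by (rule equivpI) (auto intro: reflpI sympI transpI u_eq.refl u_eq.sym u_eq.trans)

lift_definition incl :: "'g::lie_algebra \<Rightarrow> 'g U" is Gen .

primrec u_eval :: "('g \<Rightarrow> 'a::calgebra_1) \<Rightarrow> 'g uterm \<Rightarrow> 'a" where
  "u_eval f (Gen x) = f x"
| "u_eval f (Const c) = c *\<^sub>C 1"
| "u_eval f (Plus s t) = u_eval f s + u_eval f t"
| "u_eval f (Times s t) = u_eval f s * u_eval f t"

definition lie_hom :: "('g::lie_algebra \<Rightarrow> 'a::calgebra_1) \<Rightarrow> bool" where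
  "lie_hom f \<longleftrightarrow> clinear f \<and> (\<forall>x y. f (bracket x y) = f x * f y - f y * f x)"

lemma u_eq_eval:
  assumes "lie_hom f"
  shows "u_eq s t \<Longrightarrow> u_eval f s = u_eval f t"
  by (induction rule: u_eq.induct)
    (use assms in \<open>auto simp: lie_hom_def clinear_def algebra_simps scaleC_add_left scaleC_one
      scaleC_scaleC mult_scaleC_left mult_scaleC_right\<close>)

instantiation U :: (lie_algebra) calgebra_1
begin
lift_definition zero_U :: "'a U" is "Const 0" .
lift_definition one_U :: "'a U" is "Const 1" .
lift_definition plus_U :: "'a U \<Rightarrow> 'a U \<Rightarrow> 'a U" is Plus by (rule u_eq.Plus_cong)
lift_definition times_U :: "'a U \<Rightarrow> 'a U \<Rightarrow> 'a U" is Times by (rule u_eq.Times_cong)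
lift_definition scaleC_U :: "complex \<Rightarrow> 'a U \<Rightarrow> 'a U" is "\<lambda>c. Times (Const c)"
  by (rule u_eq.Times_cong[OF u_eq.refl])
definition uminus_U :: "'a U \<Rightarrow> 'a U" where "- u = (-1) *\<^sub>C (u::'a U)"
definition minus_U :: "'a U \<Rightarrow> 'a U \<Rightarrow> 'a U" where "u - v = u + - (v::'a U)"
instance
proof
  fix u v w :: "'a U" and c d :: complex
  show "u + v + w = u + (v + w)" by transfer (rule u_eq.Plus_assoc)
  show "u + v = v + u" by transfer (rule u_eq.Plus_comm)
  show "0 + u = u" by transfer (rule u_eq.Plus_zero)
  show sl: "(c + d) *\<^sub>C u = c *\<^sub>C u + d *\<^sub>C u" for c d and u :: "'a U"
    by transfer (meson u_eq.intros)
  show one: "1 *\<^sub>C u = u" for u :: "'a U" by transfer (rule u_eq.Times_one_left)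
  have z: "0 *\<^sub>C u = 0" for u :: "'a U" by transfer (rule u_eq.Times_zero_left)
  show "- u + u = 0"
    using sl[of "-1" 1 u] by (simp add: uminus_U_def one z)
  show "u - v = u + - v" by (rule minus_U_def)
  show "c *\<^sub>C (u + v) = c *\<^sub>C u + c *\<^sub>C v" by transfer (rule u_eq.distrib_left)
  show "c *\<^sub>C d *\<^sub>C u = (c * d) *\<^sub>C u"
    by transfer (meson u_eq.intros)
  show "u * v * w = u * (v * w)" by transfer (rule u_eq.Times_assoc)
  show "(u + v) * w = u * w + v * w" by transfer (rule u_eq.distrib_right)
  show "u * (v + w) = u * v + u * w" by transfer (rule u_eq.distrib_left)
  show "1 * u = u" by transfer (rule u_eq.Times_one_left)
  show "u * 1 = u" by transfer (meson u_eq.intros)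
  show "(c *\<^sub>C u) * v = c *\<^sub>C (u * v)" by transfer (rule u_eq.Times_assoc)
  show "u * (c *\<^sub>C v) = c *\<^sub>C (u * v)"
    by transfer (meson u_eq.Times_assoc u_eq.Const_central u_eq.sym u_eq.trans u_eq.Times_cong u_eq.refl)
  show "(0::'a U) \<noteq> 1"
  proof transfer
    have "lie_hom (\<lambda>_::'a. 0::complex)"
      by (simp add: lie_hom_def clinear_def)
    then show "\<not> u_eq (Const 0) (Const 1 :: 'a uterm)"
      using u_eq_eval[of "\<lambda>_::'a. 0::complex" "Const 0" "Const 1"] by (auto simp: scaleC_complex_def)
  qed
qed
end

text \<open>The algebra homomorphism extending a Lie homomorphism \<open>f\<close>; only meaningful if
  \<^term>\<open>lie_hom f\<close>, where the value does not depend on the chosen representative.\<close>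

definition u_lift :: "('g::lie_algebra \<Rightarrow> 'a::calgebra_1) \<Rightarrow> 'g U \<Rightarrow> 'a" where
  "u_lift f u = u_eval f (rep_U u)"

lemma u_lift_abs: "lie_hom f \<Longrightarrow> u_lift f (abs_U s) = u_eval f s"
  unfolding u_lift_def
  by (erule u_eq_eval) (rule rep_abs_rsp_left[OF Quotient3_U u_eq.refl])

lemma u_lift_hom:
  assumes "lie_hom f"
  shows "u_lift f (incl x) = f x" "u_lift f 1 = 1" "u_lift f (u + v) = u_lift f u + u_lift f v"
    "u_lift f (u * v) = u_lift f u * u_lift f v" "u_lift f (c *\<^sub>C u) = c *\<^sub>C u_lift f u"
proof -
  show "u_lift f (incl x) = f x" by (simp add: incl.abs_eq u_lift_abs[OF assms])
  show "u_lift f 1 = 1" by (simp add: one_U.abs_eq u_lift_abs[OF assms] scaleC_one)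
  show "u_lift f (u + v) = u_lift f u + u_lift f v"
    by (induction u, induction v) (simp add: plus_U.abs_eq u_lift_abs[OF assms])
  show "u_lift f (u * v) = u_lift f u * u_lift f v"
    by (induction u, induction v) (simp add: times_U.abs_eq u_lift_abs[OF assms])
  show "u_lift f (c *\<^sub>C u) = c *\<^sub>C u_lift f u"
    by (induction u) (simp add: scaleC_U.abs_eq u_lift_abs[OF assms] mult_scaleC_left)
qed

definition coproduct :: "'g::lie_algebra U \<Rightarrow> ('g U, 'g U) tensor" where
  "coproduct = u_lift (\<lambda>x. incl x \<otimes>\<^sub>C 1 + 1 \<otimes>\<^sub>C incl x)"

definition counit :: "'g::lie_algebra U \<Rightarrow> complex" where
  "counit = u_lift (\<lambda>_. 0)"

lemma incl_linear: "clinear (incl :: 'g::lie_algebra \<Rightarrow> 'g U)"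
  unfolding clinear_def
proof (intro conjI allI)
  show "incl (x + y) = incl x + incl y" for x y :: 'g by transfer (rule u_eq.Gen_add)
  show "incl (c *\<^sub>C x) = c *\<^sub>C incl x" for c and x :: 'g by transfer (rule u_eq.Gen_scale)
qed

lemma incl_bracket: "incl (bracket x y) = incl x * incl y - incl y * incl x"
proof -
  have "incl x * incl y = incl y * incl x + incl (bracket x y)"
    by transfer (rule u_eq.Gen_bracket)
  then show ?thesis by simp
qed

lemma lie_hom_counit: "lie_hom (\<lambda>_::'g::lie_algebra. 0 :: complex)"
  by (simp add: lie_hom_def clinear_def)

lemma lie_hom_coproduct: "lie_hom (\<lambda>x::'g::lie_algebra. incl x \<otimes>\<^sub>C 1 + 1 \<otimes>\<^sub>C incl x)"
proof -
  have d: "(u - v) \<otimes>\<^sub>C w = u \<otimes>\<^sub>C w - v \<otimes>\<^sub>C w" "w \<otimes>\<^sub>C (u - v) = w \<otimes>\<^sub>C u - w \<otimes>\<^sub>C v" for u v w :: "'g U"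
    using tens_simps(1)[of "u - v" v w] tens_simps(2)[of w "u - v" v] by simp_all
  show ?thesis
    using incl_linear[where 'g = 'g]
    by (simp add: lie_hom_def clinear_def incl_bracket tens_simps d tens_mult_tens scaleC_add_right
      algebra_simps)
qed

section \<open>Formal power series over noncommutative complex algebras\<close>

instantiation fps :: (calgebra_1) calgebra_1
begin
definition scaleC_fps :: "complex \<Rightarrow> 'a fps \<Rightarrow> 'a fps" where
  "c *\<^sub>C F = Abs_fps (\<lambda>n. c *\<^sub>C fps_nth F n)"
instance
proof
  fix F G :: "'a fps" and c d :: complex
  have s: "c *\<^sub>C sum f A = (\<Sum>i\<in>A. c *\<^sub>C f i)" for c and f :: "nat \<Rightarrow> 'a" and A
    by (induction A rule: infinite_finite_induct) (simp_all add: scaleC_add_right)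
  show "c *\<^sub>C (F + G) = c *\<^sub>C F + c *\<^sub>C G"
    by (simp add: fps_eq_iff scaleC_fps_def scaleC_add_right)
  show "(c + d) *\<^sub>C F = c *\<^sub>C F + d *\<^sub>C F"
    by (simp add: fps_eq_iff scaleC_fps_def scaleC_add_left)
  show "c *\<^sub>C d *\<^sub>C F = (c * d) *\<^sub>C F"
    by (simp add: fps_eq_iff scaleC_fps_def scaleC_scaleC)
  show "1 *\<^sub>C F = F"
    by (simp add: fps_eq_iff scaleC_fps_def scaleC_one)
  show "(c *\<^sub>C F) * G = c *\<^sub>C (F * G)"
    by (simp add: fps_eq_iff scaleC_fps_def fps_mult_nth s mult_scaleC_left)
  show "F * (c *\<^sub>C G) = c *\<^sub>C (F * G)"
    by (simp add: fps_eq_iff scaleC_fps_def fps_mult_nth s mult_scaleC_right)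
qed
end

definition fps_map :: "('a \<Rightarrow> 'b) \<Rightarrow> 'a fps \<Rightarrow> 'b fps" where
  "fps_map f F = Abs_fps (\<lambda>n. f (fps_nth F n))"

text \<open>Substitution of a series \<open>F\<close> with \<open>fps_nth F 0 = 0\<close> into a complex power series, as in
  \<^const>\<open>fps_compose\<close>.\<close>

definition fps_subst :: "complex fps \<Rightarrow> 'a::calgebra_1 fps \<Rightarrow> 'a fps" where
  "fps_subst c F = Abs_fps (\<lambda>n. \<Sum>i=0..n. fps_nth c i *\<^sub>C fps_nth (F ^ i) n)"

definition exp_fps :: "'a::calgebra_1 fps \<Rightarrow> 'a fps" where
  "exp_fps F = fps_subst (fps_exp 1) F"

definition ln1p_fps :: "'a::calgebra_1 fps \<Rightarrow> 'a fps" where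
  "ln1p_fps F = fps_subst (fps_ln 1) F"

section \<open>Twisting elements\<close>

text \<open>The triple tensor power is bracketed to the left: \<open>t \<otimes>\<^sub>C 1\<close> and
  \<^term>\<open>tensor_assoc (1 \<otimes>\<^sub>C t)\<close> are the embeddings into positions 12 and 23, and \<^const>\<open>fps_map\<close>
  extends linear maps \<open>\<xi>\<close>-linearly.\<close>

definition twisting_element :: "('g::lie_algebra U, 'g U) tensor fps \<Rightarrow> bool" where
  "twisting_element F \<longleftrightarrow>
     (\<exists>G. F * G = 1 \<and> G * F = 1)
   \<and> fps_map (tensor_lift (\<lambda>a b. counit a *\<^sub>C b)) F = 1
   \<and> fps_map (tensor_lift (\<lambda>a b. counit b *\<^sub>C a)) F = 1
   \<and> fps_map (\<lambda>t. t \<otimes>\<^sub>C 1) F * fps_map (tensor_map coproduct id) F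
     = fps_map (\<lambda>t. tensor_assoc (1 \<otimes>\<^sub>C t)) F
       * fps_map (\<lambda>t. tensor_assoc (tensor_map id coproduct t)) F"

section \<open>The classical Lie algebras and their roots\<close>

datatype series = SL | SO_even | SO_odd

definition sl_mat :: "nat \<Rightarrow> complex mat set" where
  "sl_mat n = {A \<in> carrier_mat n n. (\<Sum>i<n. A $$ (i, i)) = 0}"

text \<open>The orthogonal Lie algebra is taken with respect to the antidiagonal symmetric form, so that its
  diagonal matrices form a Cartan subalgebra.\<close>

definition antidiag_mat :: "nat \<Rightarrow> complex mat" where
  "antidiag_mat n = mat n n (\<lambda>(i, j). if i + j + 1 = n then 1 else 0)"

definition so_mat :: "nat \<Rightarrow> complex mat set" where
  "so_mat n = {A \<in> carrier_mat n n.
     transpose_mat A * antidiag_mat n + antidiag_mat n * A = 0\<^sub>m n n}"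

fun classical_algebra :: "series \<Rightarrow> nat \<Rightarrow> complex mat set" where
  "classical_algebra SL N = sl_mat N"
| "classical_algebra SO_even N = so_mat (2 * N)"
| "classical_algebra SO_odd N = so_mat (2 * N + 1)"

definition lie_iso :: "('g::lie_algebra \<Rightarrow> complex mat) \<Rightarrow> complex mat set \<Rightarrow> bool" where
  "lie_iso \<phi> M \<longleftrightarrow> bij_betw \<phi> UNIV M
     \<and> (\<forall>x y. \<phi> (x + y) = \<phi> x + \<phi> y) \<and> (\<forall>c x. \<phi> (c *\<^sub>C x) = c \<cdot>\<^sub>m \<phi> x)
     \<and> (\<forall>x y. \<phi> (bracket x y) = \<phi> x * \<phi> y - \<phi> y * \<phi> x)"

text \<open>A weight is given by its coordinates in the basis \<open>e\<^sub>1, \<dots>, e\<^sub>N\<close>, and \<open>e\<^sub>i\<close> takes the \<open>i\<close>-th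
  diagonal entry (for \<open>so\<close>, the diagonal is \<open>h\<^sub>1, \<dots>, h\<^sub>N, (0,) -h\<^sub>N, \<dots>, -h\<^sub>1\<close>). Matrix indices
  start at 0.\<close>

type_synonym weight = "nat \<Rightarrow> int"

definition ebasis :: "nat \<Rightarrow> weight" where
  "ebasis i = (\<lambda>j. if j = i then 1 else 0)"

definition cartan :: "('g::lie_algebra \<Rightarrow> complex mat) \<Rightarrow> 'g set" where
  "cartan \<phi> = {h. diagonal_mat (\<phi> h)}"

definition weight_eval :: "('g::lie_algebra \<Rightarrow> complex mat) \<Rightarrow> nat \<Rightarrow> weight \<Rightarrow> 'g \<Rightarrow> complex" where
  "weight_eval \<phi> N \<alpha> h = (\<Sum>i=1..N. of_int (\<alpha> i) * \<phi> h $$ (i - 1, i - 1))"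

definition root_space :: "('g::lie_algebra \<Rightarrow> complex mat) \<Rightarrow> nat \<Rightarrow> weight \<Rightarrow> 'g set" where
  "root_space \<phi> N \<alpha> = {x. \<forall>h\<in>cartan \<phi>. bracket h x = weight_eval \<phi> N \<alpha> h *\<^sub>C x}"

text \<open>Duality (up to a scalar multiple) between the Cartan subalgebra and its dual, with respect to the
  bilinear form for which the \<open>e\<^sub>i\<close> are orthonormal.\<close>

definition dual_to :: "('g::lie_algebra \<Rightarrow> complex mat) \<Rightarrow> nat \<Rightarrow> weight \<Rightarrow> 'g \<Rightarrow> bool" where
  "dual_to \<phi> N \<alpha> H \<longleftrightarrow> H \<in> cartan \<phi> \<and>
     (\<exists>c. \<forall>h\<in>cartan \<phi>. (\<Sum>i=1..N. \<phi> H $$ (i - 1, i - 1) * \<phi> h $$ (i - 1, i - 1))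
        = c * weight_eval \<phi> N \<alpha> h)"

fun init_root :: "series \<Rightarrow> nat \<Rightarrow> weight" where
  "init_root SL k = ebasis (2*k+1) - ebasis (2*k+2)"
| "init_root SO_even k = ebasis (2*k+1) + ebasis (2*k+2)"
| "init_root SO_odd k = ebasis (2*k+1) + ebasis (2*k+2)"

fun constituent' :: "series \<Rightarrow> nat \<Rightarrow> nat \<Rightarrow> weight set" where
  "constituent' SL N k = (\<lambda>l. ebasis (2*k+1) - ebasis l) ` {2*k+3..N}"
| "constituent' SO_even N k =
     (\<lambda>l. ebasis (2*k+1) + ebasis l) ` {2*k+3..N} \<union> (\<lambda>l. ebasis (2*k+1) - ebasis l) ` {2*k+3..N}"
| "constituent' SO_odd N k = {ebasis (2*k+1)} \<union>
     (\<lambda>l. ebasis (2*k+1) + ebasis l) ` {2*k+3..N} \<union> (\<lambda>l. ebasis (2*k+1) - ebasis l) ` {2*k+3..N}"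

definition constituent :: "series \<Rightarrow> nat \<Rightarrow> nat \<Rightarrow> weight set" where
  "constituent T N k = constituent' T N k \<union> (\<lambda>\<alpha>. init_root T k - \<alpha>) ` constituent' T N k"

definition normalized_generators ::
  "('g::lie_algebra \<Rightarrow> complex mat) \<Rightarrow> series \<Rightarrow> nat \<Rightarrow> (weight \<Rightarrow> 'g) \<Rightarrow> (weight \<Rightarrow> 'g) \<Rightarrow> nat \<Rightarrow> bool" where
  "normalized_generators \<phi> T N H L k \<longleftrightarrow> (let \<alpha>\<^sub>0 = init_root T k in
     dual_to \<phi> N \<alpha>\<^sub>0 (H \<alpha>\<^sub>0)
   \<and> (\<forall>\<alpha>\<in>constituent T N k \<union> {\<alpha>\<^sub>0}. L \<alpha> \<in> root_space \<phi> N \<alpha> \<and> L \<alpha> \<noteq> 0)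
   \<and> bracket (H \<alpha>\<^sub>0) (L \<alpha>\<^sub>0) = L \<alpha>\<^sub>0
   \<and> (\<forall>\<alpha>\<in>constituent' T N k.
        bracket (H \<alpha>\<^sub>0) (L \<alpha>) = (1/2) *\<^sub>C L \<alpha>
      \<and> bracket (H \<alpha>\<^sub>0) (L (\<alpha>\<^sub>0 - \<alpha>)) = (1/2) *\<^sub>C L (\<alpha>\<^sub>0 - \<alpha>)
      \<and> bracket (L \<alpha>) (L (\<alpha>\<^sub>0 - \<alpha>)) = L \<alpha>\<^sub>0
      \<and> bracket (L \<alpha>\<^sub>0) (L \<alpha>) = 0
      \<and> bracket (L \<alpha>\<^sub>0) (L (\<alpha>\<^sub>0 - \<alpha>)) = 0))"

section \<open>Chains of extended Jordanian twists\<close>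

text \<open>The formal parameter \<open>\<xi>\<close> is \<^const>\<open>fps_X\<close>.\<close>

definition sigma :: "(weight \<Rightarrow> 'g::lie_algebra) \<Rightarrow> weight \<Rightarrow> 'g U fps" where
  "sigma L \<alpha>\<^sub>0 = ln1p_fps (fps_X * fps_const (incl (L \<alpha>\<^sub>0)))"

definition extension_factor ::
  "(weight \<Rightarrow> 'g::lie_algebra) \<Rightarrow> weight \<Rightarrow> weight \<Rightarrow> ('g U, 'g U) tensor fps" where
  "extension_factor L \<alpha>\<^sub>0 \<alpha> = exp_fps (fps_X * fps_map (\<lambda>u. incl (L \<alpha>) \<otimes>\<^sub>C u)
     (fps_const (incl (L (\<alpha>\<^sub>0 - \<alpha>))) * exp_fps ((-1/2) *\<^sub>C sigma L \<alpha>\<^sub>0)))"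

definition jordanian_factor ::
  "(weight \<Rightarrow> 'g::lie_algebra) \<Rightarrow> (weight \<Rightarrow> 'g) \<Rightarrow> weight \<Rightarrow> ('g U, 'g U) tensor fps" where
  "jordanian_factor H L \<alpha>\<^sub>0 = exp_fps (fps_map (\<lambda>u. incl (H \<alpha>\<^sub>0) \<otimes>\<^sub>C u) (sigma L \<alpha>\<^sub>0))"

text \<open>The list \<open>ls k\<close> enumerates the set of roots over which the product of the extension factors
  is taken.\<close>

definition twist_link ::
  "series \<Rightarrow> (weight \<Rightarrow> 'g::lie_algebra) \<Rightarrow> (weight \<Rightarrow> 'g) \<Rightarrow> (nat \<Rightarrow> weight list) \<Rightarrow> nat
    \<Rightarrow> ('g U, 'g U) tensor fps" where
  "twist_link T H L ls k =
     prod_list (map (extension_factor L (init_root T k)) (ls k)) * jordanian_factor H L (init_root T k)"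

definition twist_chain ::
  "series \<Rightarrow> (weight \<Rightarrow> 'g::lie_algebra) \<Rightarrow> (weight \<Rightarrow> 'g) \<Rightarrow> (nat \<Rightarrow> weight list) \<Rightarrow> nat
    \<Rightarrow> ('g U, 'g U) tensor fps" where
  "twist_chain T H L ls k = prod_list (map (twist_link T H L ls) (rev [0..<Suc k]))"

end

(* Each link F_B = F_E F_J is a twist: conjugation by the Jordanian factor F_J = exp(H (x) sigma)
   turns the coproducts of the constituent root vectors A_i and of C_i = xi B_i e^(-sigma/2)
   into A_i (x) e^(sigma/2) + 1 (x) A_i and C_i (x) 1 + e^(-sigma/2) (x) C_i. With
   X = sum A_i (x) C_i (x) 1, Y = sum 1 (x) A_i (x) C_i and Z_w = sum A_i (x) e^(w sigma) (x) C_i,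
   the twist equation for F_B becomes e^X e^(Z_(1/2) + Y) = e^Y e^(X + Z_(-1/2)), which holds because
   [X, Y] = Z_(-1/2) - Z_(1/2) commutes with X and Y.

   For the chain, a root vector x of a later link annihilates H and E of an earlier link and leaves
   invariant the canonical element sum A_i (x) B_i, so its coproduct stays primitive under the earlier
   twists; therefore the later twist can be multiplied on from the left. *)

theory Submission
  imports Defs
begin

text \<open>A later root vector x of weight \<gamma> does not fix the constituents of an earlier
  link one by one: it carries L \<alpha> to a multiple of L (\<alpha> + \<gamma>). Only the whole
  exponent is preserved, because the structure constants on the A side and on the B side cancel in
  pairs; so x is never moved past a single extension factor. That x annihilates H and E has a
  simpler cause: the initial root of link j involves only e_(2j+1) and e_(2j+2), the roots of later
  links only later coordinates.

  The normalization relates L \<alpha> to its own partner only. That brackets between different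
  constituents vanish has to be derived. Instead of lists of roots, the matrix model is used: the
  weight of a nonzero root vector is a difference of two weights of the defining representation,
  while the brackets in question would have a weight with a coefficient of size 2 or with three
  nonzero coordinates.

  Conjugations are stated as P F = G P, which passes to power series term by term and asks for no
  inverse.\<close>

lemma scaleC_sum: "c *\<^sub>C sum f A = (\<Sum>i\<in>A. c *\<^sub>C (f i :: 'a::cvector))"
  by (induction A rule: infinite_finite_induct) (simp_all add: scaleC_add_right)

lemma sum_scaleC: "sum c A *\<^sub>C x = (\<Sum>i\<in>A. c i *\<^sub>C (x :: 'a::cvector))"
  by (induction A rule: infinite_finite_induct) (simp_all add: scaleC_add_left)

lemma scaleC_minus_left [simp]: "(- c) *\<^sub>C x = - (c *\<^sub>C (x::'a::cvector))"
  using scaleC_add_left[of c "- c" x] by (simp add: eq_neg_iff_add_eq_0 add.commute)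

section \<open>Homomorphisms of unital complex algebras\<close>

definition calg_hom :: "('a::calgebra_1 \<Rightarrow> 'b::calgebra_1) \<Rightarrow> bool" where
  "calg_hom f \<longleftrightarrow> clinear f \<and> f 1 = 1 \<and> (\<forall>x y. f (x * y) = f x * f y)"

lemma
  assumes "calg_hom f"
  shows calg_hom_add: "f (x + y) = f x + f y"
    and calg_hom_scaleC: "f (c *\<^sub>C x) = c *\<^sub>C f x"
    and calg_hom_1: "f 1 = 1"
    and calg_hom_mult: "f (x * y) = f x * f y"
    and calg_hom_0: "f 0 = 0"
  using assms clinear_0 by (auto simp: calg_hom_def clinear_def)

lemma calg_hom_sum: "calg_hom f \<Longrightarrow> f (sum g A) = (\<Sum>i\<in>A. f (g i))"
  by (induction A rule: infinite_finite_induct) (simp_all add: calg_hom_add calg_hom_0)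

lemma calg_hom_power: "calg_hom f \<Longrightarrow> f (x ^ n) = f x ^ n"
  by (induction n) (simp_all add: calg_hom_mult calg_hom_1)

lemma calg_hom_minus: "calg_hom f \<Longrightarrow> f (- x) = - f x"
  using calg_hom_scaleC[of f "-1" x] by (simp add: scaleC_one)

lemma calg_hom_comp: "calg_hom f \<Longrightarrow> calg_hom g \<Longrightarrow> calg_hom (\<lambda>x. f (g x))"
  by (simp add: calg_hom_def clinear_def)

section \<open>Substitution into complex power series\<close>

lemma fps_nth_scaleC [simp]: "fps_nth (c *\<^sub>C F) n = c *\<^sub>C fps_nth F n"
  by (simp add: scaleC_fps_def)

lemma fps_map_nth [simp]: "fps_nth (fps_map f F) n = f (fps_nth F n)"
  by (simp add: fps_map_def)

lemma calg_hom_fps_map: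
  assumes "calg_hom f" shows "calg_hom (fps_map f)"
  unfolding calg_hom_def clinear_def
  using assms by (auto simp: fps_eq_iff fps_mult_nth calg_hom_sum calg_hom_mult calg_hom_add
    calg_hom_scaleC calg_hom_0 calg_hom_1)

lemma fps_map_X: "calg_hom f \<Longrightarrow> fps_map f fps_X = fps_X"
  by (simp add: fps_eq_iff fps_X_def calg_hom_0 calg_hom_1)

lemma fps_map_const: "calg_hom f \<Longrightarrow> fps_map f (fps_const a) = fps_const (f a)"
  by (simp add: fps_eq_iff calg_hom_0)

lemma fps_map_comp: "fps_map f (fps_map g F) = fps_map (\<lambda>x. f (g x)) F"
  by (simp add: fps_eq_iff)

lemma fps_mult_nth_eq_0:
  assumes "\<And>m. m < i \<Longrightarrow> fps_nth F m = 0" "\<And>m. m < j \<Longrightarrow> fps_nth G m = 0" "n < i + j"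
  shows "fps_nth (F * G) n = (0::'a::ring_1)"
  unfolding fps_mult_nth
proof (rule sum.neutral, rule ballI)
  fix k assume "k \<in> {0..n}"
  then have "k < i \<or> n - k < j" using assms(3) by auto
  then show "fps_nth F k * fps_nth G (n - k) = 0" using assms(1,2) by auto
qed

lemma fps_power_nth_eq_0:
  assumes "fps_nth F 0 = (0::'a::ring_1)"
  shows "n < i \<Longrightarrow> fps_nth (F ^ i) n = 0"
proof (induction i arbitrary: n)
  case (Suc i)
  show ?case unfolding power_Suc
    by (rule fps_mult_nth_eq_0[of 1 _ i]) (use assms Suc in auto)
qed simp

text \<open>Since \<open>F\<close> has no constant term, \<open>F ^ i\<close> starts in degree i and
  all terms beyond n are zero. With the bound free, coefficients of different degrees share one
  index range and finite sums can be interchanged.\<close>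

lemma fps_subst_nth_upto:
  assumes "fps_nth F 0 = 0" "n \<le> m"
  shows "fps_nth (fps_subst c F) n = (\<Sum>i\<le>m. fps_nth c i *\<^sub>C fps_nth (F ^ i) n)"
  unfolding fps_subst_def fps_nth_Abs_fps atLeast0AtMost
  by (rule sum.mono_neutral_left)
    (use assms(2) in \<open>auto simp: fps_power_nth_eq_0[OF assms(1)] not_le\<close>)

lemma fps_subst_nth_0 [simp]: "fps_nth (fps_subst c F) 0 = fps_nth c 0 *\<^sub>C 1"
  by (simp add: fps_subst_def)

lemma mult_fps_subst_nth:
  assumes "fps_nth F 0 = 0" "n \<le> m"
  shows "fps_nth (P * fps_subst c F) n = (\<Sum>i\<le>m. fps_nth c i *\<^sub>C fps_nth (P * F ^ i) n)"
    and "fps_nth (fps_subst c F * P) n = (\<Sum>i\<le>m. fps_nth c i *\<^sub>C fps_nth (F ^ i * P) n)"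
proof -
  have "fps_nth (P * fps_subst c F) n
      = (\<Sum>k=0..n. \<Sum>i\<le>m. fps_nth c i *\<^sub>C (fps_nth P k * fps_nth (F ^ i) (n - k)))"
    unfolding fps_mult_nth
    by (rule sum.cong[OF HOL.refl], subst fps_subst_nth_upto[OF assms(1), of _ m])
      (use assms(2) in \<open>auto simp: sum_distrib_left mult_scaleC_right\<close>)
  also have "\<dots> = (\<Sum>i\<le>m. fps_nth c i *\<^sub>C fps_nth (P * F ^ i) n)"
    by (subst sum.swap) (simp add: fps_mult_nth scaleC_sum)
  finally show "fps_nth (P * fps_subst c F) n = \<dots>" .
  have "fps_nth (fps_subst c F * P) n
      = (\<Sum>k=0..n. \<Sum>i\<le>m. fps_nth c i *\<^sub>C (fps_nth (F ^ i) k * fps_nth P (n - k)))"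
    unfolding fps_mult_nth
    by (rule sum.cong[OF HOL.refl], subst fps_subst_nth_upto[OF assms(1), of _ m])
      (use assms(2) in \<open>auto simp: sum_distrib_right mult_scaleC_left\<close>)
  also have "\<dots> = (\<Sum>i\<le>m. fps_nth c i *\<^sub>C fps_nth (F ^ i * P) n)"
    by (subst sum.swap) (simp add: fps_mult_nth scaleC_sum)
  finally show "fps_nth (fps_subst c F * P) n = \<dots>" .
qed

text \<open>The relation P F = G P passes to powers and then to each coefficient. Every conjugation
  below takes this form, which makes sense whether or not \<open>P\<close> is invertible.\<close>

lemma fps_subst_intertwine:
  assumes "fps_nth F 0 = 0" "fps_nth G 0 = 0" "P * F = G * P"
  shows "P * fps_subst c F = fps_subst c G * P"
proof -
  have "P * F ^ i = G ^ i * P" for i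
    by (induction i) (use assms(3) in \<open>simp_all add: mult.assoc[symmetric] power_Suc2\<close>,
      metis mult.assoc power_Suc power_Suc2)
  then show ?thesis
    by (simp add: fps_eq_iff mult_fps_subst_nth[OF assms(1) le_refl] mult_fps_subst_nth[OF assms(2) le_refl])
qed

text \<open>The terms are grouped by i + j because this is where the Cauchy product (for equal
  arguments) and the binomial formula (for commuting arguments) can be inserted. Terms with i + j >
  n vanish by order, so the square of indices shrinks to a triangle.\<close>

lemma fps_subst_mult_nth:
  assumes "fps_nth F 0 = 0" "fps_nth G 0 = 0"
  shows "fps_nth (fps_subst a F * fps_subst b G) n
    = (\<Sum>k\<le>n. \<Sum>i\<le>k. (fps_nth a i * fps_nth b (k - i)) *\<^sub>C fps_nth (F ^ i * G ^ (k - i)) n)"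
proof -
  let ?h = "\<lambda>(i, j). (fps_nth a i * fps_nth b j) *\<^sub>C fps_nth (F ^ i * G ^ j) n"
  have "fps_nth (fps_subst a F * fps_subst b G) n = (\<Sum>i\<le>n. \<Sum>j\<le>n. ?h (i, j))"
    unfolding mult_fps_subst_nth(2)[OF assms(1) le_refl]
    unfolding mult_fps_subst_nth(1)[OF assms(2) le_refl]
    by (simp add: scaleC_sum scaleC_scaleC)
  also have "\<dots> = sum ?h ({..n} \<times> {..n})"
    by (simp add: sum.cartesian_product)
  also have "\<dots> = sum ?h {(i, j). i + j \<le> n}"
  proof (rule sum.mono_neutral_right)
    show "\<forall>p\<in>{..n} \<times> {..n} - {(i, j). i + j \<le> n}. ?h p = 0"
    proof
      fix p assume p: "p \<in> {..n} \<times> {..n} - {(i, j). i + j \<le> n}"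
      obtain i j where ij: "p = (i, j)" by force
      then have "fps_nth (F ^ i * G ^ j) n = 0"
        using p by (intro fps_mult_nth_eq_0[of i _ j]) (use assms fps_power_nth_eq_0 in auto)
      then show "?h p = 0" by (simp add: ij)
    qed
  qed auto
  also have "\<dots> = (\<Sum>k\<le>n. \<Sum>i\<le>k. ?h (i, k - i))"
    by (subst sum.triangle_reindex_eq) simp
  finally show ?thesis by simp
qed

lemma fps_subst_mult:
  assumes "fps_nth F 0 = 0"
  shows "fps_subst (a * b) F = fps_subst a F * fps_subst b F"
proof (rule fps_ext)
  fix n
  show "fps_nth (fps_subst (a * b) F) n = fps_nth (fps_subst a F * fps_subst b F) n"
    unfolding fps_subst_mult_nth[OF assms assms] fps_subst_nth_upto[OF assms le_refl]
    by (intro sum.cong HOL.refl)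
      (simp add: fps_mult_nth sum_scaleC atLeast0AtMost power_add[symmetric])
qed

lemma fps_subst_add: "fps_subst (a + b) F = fps_subst a F + fps_subst b F"
  by (simp add: fps_eq_iff fps_subst_def scaleC_add_left sum.distrib)

lemma fps_subst_1 [simp]: "fps_subst 1 F = 1"
proof (rule fps_ext)
  fix n
  have "(\<Sum>i=0..n. fps_nth 1 i *\<^sub>C fps_nth (F ^ i) n) = (\<Sum>i\<in>{0}. fps_nth 1 i *\<^sub>C fps_nth (F ^ i) n)"
    by (rule sum.mono_neutral_right) auto
  then show "fps_nth (fps_subst 1 F) n = fps_nth 1 n"
    by (simp add: fps_subst_def scaleC_one)
qed

lemma fps_subst_X:
  assumes "fps_nth F 0 = 0"
  shows "fps_subst fps_X F = F"
proof (rule fps_ext)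
  fix n
  have "(\<Sum>i\<le>Suc n. fps_nth fps_X i *\<^sub>C fps_nth (F ^ i) n)
      = (\<Sum>i\<in>{1}. fps_nth fps_X i *\<^sub>C fps_nth (F ^ i) n)"
    by (rule sum.mono_neutral_right) auto
  then show "fps_nth (fps_subst fps_X F) n = fps_nth F n"
    by (simp add: fps_subst_nth_upto[OF assms, of n "Suc n"] scaleC_one)
qed

lemma fps_subst_power:
  "fps_nth F 0 = 0 \<Longrightarrow> fps_subst (d ^ i) F = fps_subst d F ^ i"
  by (induction i) (simp_all add: fps_subst_mult)

text \<open>Only powers of the single series \<open>F\<close> occur, so identities between ordinary
  complex series, such as exp and ln being mutually inverse, carry over to a noncommutative
  algebra.\<close>

lemma fps_subst_compose:
  assumes "fps_nth F 0 = 0" "fps_nth d 0 = 0"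
  shows "fps_subst c (fps_subst d F) = fps_subst (c oo d) F"
proof (rule fps_ext)
  fix n
  have d0: "fps_nth (fps_subst d F) 0 = 0" using assms(2) by simp
  have "fps_nth (fps_subst c (fps_subst d F)) n
      = (\<Sum>i\<le>n. \<Sum>j\<le>n. (fps_nth c i * fps_nth (d ^ i) j) *\<^sub>C fps_nth (F ^ j) n)"
    by (simp add: fps_subst_nth_upto[OF d0 le_refl] fps_subst_power[OF assms(1), symmetric]
      fps_subst_nth_upto[OF assms(1) le_refl] scaleC_sum scaleC_scaleC)
  also have "\<dots> = (\<Sum>j\<le>n. (\<Sum>i\<le>n. fps_nth c i * fps_nth (d ^ i) j) *\<^sub>C fps_nth (F ^ j) n)"
    by (subst sum.swap) (simp add: sum_scaleC)
  also have "\<dots> = (\<Sum>j\<le>n. fps_nth (c oo d) j *\<^sub>C fps_nth (F ^ j) n)"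
  proof (rule sum.cong[OF HOL.refl])
    fix j assume "j \<in> {..n}"
    then have "(\<Sum>i\<le>n. fps_nth c i * fps_nth (d ^ i) j) = fps_nth (c oo d) j"
      unfolding fps_compose_nth
      by (intro sum.mono_neutral_right) (use assms(2) in \<open>auto simp: fps_power_nth_eq_0[OF assms(2)] not_le\<close>)
    then show "(\<Sum>i\<le>n. fps_nth c i * fps_nth (d ^ i) j) *\<^sub>C fps_nth (F ^ j) n
        = fps_nth (c oo d) j *\<^sub>C fps_nth (F ^ j) n" by simp
  qed
  finally show "fps_nth (fps_subst c (fps_subst d F)) n = fps_nth (fps_subst (c oo d) F) n"
    by (simp add: fps_subst_nth_upto[OF assms(1) le_refl])
qed

lemma fps_map_subst:
  assumes "calg_hom f"
  shows "fps_map f (fps_subst c F) = fps_subst c (fps_map f F)"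
proof (rule fps_ext)
  have p: "f (fps_nth (F ^ i) n) = fps_nth (fps_map f F ^ i) n" for i n
    by (metis assms calg_hom_fps_map calg_hom_power fps_map_nth)
  show "fps_nth (fps_map f (fps_subst c F)) n = fps_nth (fps_subst c (fps_map f F)) n" for n
    by (simp add: fps_subst_def calg_hom_sum[OF assms] calg_hom_scaleC[OF assms] p)
qed

section \<open>Exponentials and logarithms\<close>

lemma fps_map_exp: "calg_hom f \<Longrightarrow> fps_map f (exp_fps F) = exp_fps (fps_map f F)"
  by (simp add: exp_fps_def fps_map_subst)

lemma fps_map_ln1p: "calg_hom f \<Longrightarrow> fps_map f (ln1p_fps F) = ln1p_fps (fps_map f F)"
  by (simp add: ln1p_fps_def fps_map_subst)

lemma exp_fps_nth_0 [simp]: "fps_nth (exp_fps F) 0 = 1"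
  by (simp add: exp_fps_def scaleC_one)

lemma ln1p_fps_nth_0 [simp]: "fps_nth (ln1p_fps F) 0 = 0"
  by (simp add: ln1p_fps_def fps_ln_def)

lemma fps_subst_0: "fps_subst c 0 = fps_const (fps_nth c 0 *\<^sub>C 1)"
proof (rule fps_ext)
  fix n
  have "(\<Sum>i=0..n. fps_nth c i *\<^sub>C fps_nth (0 ^ i) n) = (\<Sum>i\<in>{0}. fps_nth c i *\<^sub>C fps_nth ((0::'a fps) ^ i) n)"
    by (rule sum.mono_neutral_right) (auto simp: power_0_left)
  then show "fps_nth (fps_subst c 0) n = fps_nth (fps_const (fps_nth c 0 *\<^sub>C (1::'a))) n"
    by (simp add: fps_subst_def)
qed

lemma exp_fps_0 [simp]: "exp_fps 0 = 1"
  by (simp add: exp_fps_def fps_subst_0 scaleC_one)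

lemma ln1p_fps_0 [simp]: "ln1p_fps 0 = 0"
  by (simp add: ln1p_fps_def fps_subst_0 fps_ln_def)

lemma exp_fps_intertwine:
  "fps_nth F 0 = 0 \<Longrightarrow> fps_nth G 0 = 0 \<Longrightarrow> P * F = G * P \<Longrightarrow> P * exp_fps F = exp_fps G * P"
  unfolding exp_fps_def by (rule fps_subst_intertwine)

lemma exp_fps_commute:
  "fps_nth F 0 = 0 \<Longrightarrow> P * F = F * P \<Longrightarrow> P * exp_fps F = exp_fps F * P"
  by (rule exp_fps_intertwine)

lemma ln1p_fps_intertwine:
  "fps_nth F 0 = 0 \<Longrightarrow> fps_nth G 0 = 0 \<Longrightarrow> P * F = G * P \<Longrightarrow> P * ln1p_fps F = ln1p_fps G * P"
  unfolding ln1p_fps_def by (rule fps_subst_intertwine)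

text \<open>The binomial theorem for commuting elements in terms of divided powers z^n / n!.
  Multiplying by x + y raises one of the two exponents; the resulting weights i and n + 1 - i add up
  to n + 1, which is then divided out.\<close>

lemma power_add_div_fact:
  fixes x y :: "'a::calgebra_1"
  assumes comm: "x * y = y * x"
  shows "(1 / fact n) *\<^sub>C (x + y) ^ n
    = (\<Sum>i\<le>n. (1 / (fact i * fact (n - i))) *\<^sub>C (x ^ i * y ^ (n - i)))"
proof (induction n)
  case (Suc n)
  define s where "s = (\<lambda>x n. (1 / fact n) *\<^sub>C (x::'a) ^ n)"
  have IH: "s (x + y) n = (\<Sum>i\<le>n. s x i * s y (n - i))"
    using Suc.IH by (simp add: s_def mult_scaleC_left mult_scaleC_right scaleC_scaleC mult.commute)
  have ts: "z * s z n = of_nat (Suc n) *\<^sub>C s z (Suc n)" for z n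
    unfolding s_def mult_scaleC_right scaleC_scaleC power_Suc
    by (rule arg_cong[of _ _ "\<lambda>c. c *\<^sub>C _"]) (simp add: fact_Suc divide_simps del: of_nat_Suc)
  have sc: "y * s x n = s x n * y" for n
    unfolding s_def mult_scaleC_right mult_scaleC_left
    by (simp add: power_commuting_commutes[OF comm])
  have "of_nat (Suc n) *\<^sub>C s (x + y) (Suc n) = (x + y) * (\<Sum>i\<le>n. s x i * s y (n - i))"
    by (metis IH ts)
  also have "\<dots> = (\<Sum>i\<le>n. x * s x i * s y (n - i)) + (\<Sum>i\<le>n. s x i * (y * s y (n - i)))"
    unfolding semiring_class.distrib_right by (simp only: sum_distrib_left mult.assoc[symmetric] sc)
  also have "\<dots> = (\<Sum>i\<le>n. of_nat (Suc i) *\<^sub>C (s x (Suc i) * s y (n - i)))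
      + (\<Sum>i\<le>n. of_nat (Suc n - i) *\<^sub>C (s x i * s y (Suc n - i)))"
    unfolding ts mult_scaleC_left mult_scaleC_right by (simp add: Suc_diff_le)
  also have "(\<Sum>i\<le>n. of_nat (Suc i) *\<^sub>C (s x (Suc i) * s y (n - i)))
      = (\<Sum>i\<le>Suc n. of_nat i *\<^sub>C (s x i * s y (Suc n - i)))"
    by (subst sum.atMost_Suc_shift) simp
  also have "(\<Sum>i\<le>n. of_nat (Suc n - i) *\<^sub>C (s x i * s y (Suc n - i)))
      = (\<Sum>i\<le>Suc n. of_nat (Suc n - i) *\<^sub>C (s x i * s y (Suc n - i)))"
    by simp
  also have "(\<Sum>i\<le>Suc n. of_nat i *\<^sub>C (s x i * s y (Suc n - i)))
      + (\<Sum>i\<le>Suc n. of_nat (Suc n - i) *\<^sub>C (s x i * s y (Suc n - i)))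
      = (\<Sum>i\<le>Suc n. of_nat (Suc n) *\<^sub>C (s x i * s y (Suc n - i)))"
    unfolding sum.distrib[symmetric] scaleC_add_left[symmetric] of_nat_add[symmetric]
    by (intro sum.cong) auto
  also have "\<dots> = of_nat (Suc n) *\<^sub>C (\<Sum>i\<le>Suc n. s x i * s y (Suc n - i))"
    by (simp only: scaleC_sum)
  finally have "inverse (of_nat (Suc n)) *\<^sub>C of_nat (Suc n) *\<^sub>C s (x + y) (Suc n)
      = inverse (of_nat (Suc n)) *\<^sub>C of_nat (Suc n) *\<^sub>C (\<Sum>i\<le>Suc n. s x i * s y (Suc n - i))"
    by (rule arg_cong)
  then have "s (x + y) (Suc n) = (\<Sum>i\<le>Suc n. s x i * s y (Suc n - i))"
    unfolding scaleC_scaleC by (simp add: scaleC_one del: of_nat_Suc sum.atMost_Suc)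
  then show ?case
    unfolding s_def mult_scaleC_left mult_scaleC_right scaleC_scaleC by (simp add: mult.commute del: sum.atMost_Suc power_Suc fact_Suc)
qed (simp add: scaleC_one)

lemma exp_fps_add:
  assumes "fps_nth F 0 = 0" "fps_nth G 0 = 0" "F * G = G * F"
  shows "exp_fps (F + G) = exp_fps F * exp_fps G"
proof (rule fps_ext)
  fix n
  have z: "fps_nth (F + G) 0 = 0" using assms by simp
  have "fps_nth (exp_fps (F + G)) n = (\<Sum>k\<le>n. fps_nth ((1 / fact k) *\<^sub>C (F + G) ^ k) n)"
    by (simp add: exp_fps_def fps_subst_nth_upto[OF z le_refl] fps_exp_def)
  also have "\<dots> = fps_nth (exp_fps F * exp_fps G) n"
    unfolding exp_fps_def fps_subst_mult_nth[OF assms(1,2)] power_add_div_fact[OF assms(3)]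
    by (simp add: fps_sum_nth fps_exp_def)
  finally show "fps_nth (exp_fps (F + G)) n = fps_nth (exp_fps F * exp_fps G) n" .
qed

lemma exp_fps_minus_mult:
  assumes "fps_nth F 0 = 0"
  shows "exp_fps F * exp_fps (- F) = 1" "exp_fps (- F) * exp_fps F = 1"
  using exp_fps_add[of F "- F"] exp_fps_add[of "- F" F] assms by simp_all

lemma exp_fps_sum:
  assumes "finite I" "\<And>i. i \<in> I \<Longrightarrow> fps_nth (F i) 0 = 0"
    and "\<And>i j. i \<in> I \<Longrightarrow> j \<in> I \<Longrightarrow> F i * F j = F j * F i"
    and "distinct xs" "set xs = I"
  shows "prod_list (map (\<lambda>i. exp_fps (F i)) xs) = exp_fps (\<Sum>i\<in>I. F i)"
  using assms
proof (induction xs arbitrary: I)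
  case (Cons x xs)
  have "F x * (\<Sum>i\<in>set xs. F i) = (\<Sum>i\<in>set xs. F i) * F x"
    unfolding sum_distrib_left sum_distrib_right
    by (rule sum.cong) (use Cons.prems in auto)
  moreover have "prod_list (map (\<lambda>i. exp_fps (F i)) xs) = exp_fps (\<Sum>i\<in>set xs. F i)"
    by (rule Cons.IH) (use Cons.prems in auto)
  moreover have "fps_nth (sum F (set xs)) 0 = 0"
    using Cons.prems(2,5) by (auto simp: fps_sum_nth)
  moreover have "sum F I = F x + sum F (set xs)"
    using Cons.prems by auto
  ultimately show ?case
    using Cons.prems exp_fps_add[of "F x" "sum F (set xs)"] by auto
qed simp

lemma exp_fps_ln1p:
  assumes "fps_nth F 0 = 0"
  shows "exp_fps (ln1p_fps F) = 1 + F"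
proof -
  have "fps_nth (fps_exp 1 - 1 :: complex fps) 0 = 0" "fps_nth (fps_exp 1 - 1 :: complex fps) 1 \<noteq> 0"
    by simp_all
  then have "(fps_exp 1 - 1) oo fps_ln 1 = (fps_X :: complex fps)"
    by (simp add: fps_ln_fps_exp_inv fps_inv_right)
  then have "fps_exp 1 oo fps_ln 1 = (1 + fps_X :: complex fps)"
    by (simp add: fps_compose_sub_distrib algebra_simps)
  then show ?thesis
    unfolding exp_fps_def ln1p_fps_def
    by (simp add: fps_subst_compose assms fps_ln_def fps_subst_add fps_subst_X)
qed

lemma ln1p_fps_exp:
  assumes "fps_nth F 0 = 0"
  shows "ln1p_fps (exp_fps F - 1) = F"
proof -
  have i: "fps_ln 1 oo (fps_exp 1 - 1) = (fps_X :: complex fps)"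
    by (simp add: fps_ln_fps_exp_inv fps_inv_fps_exp_compose)
  have "exp_fps F - 1 = fps_subst (fps_exp 1 - 1) F"
    using fps_subst_add[of "fps_exp 1 - 1" 1 F] by (simp add: exp_fps_def)
  then show ?thesis
    unfolding ln1p_fps_def by (simp add: fps_subst_compose assms i fps_subst_X)
qed

text \<open>Commutation with \<open>X\<close> is a derivation, and [X, Y] = W commutes with
  \<open>Y\<close>, so [X, Y^i] = i Y^(i-1) W. Division by i! turns the sum of these terms into e^Y
  W.\<close>

lemma exp_fps_derivation:
  assumes "fps_nth Y 0 = 0" "X * Y = Y * X + W" "W * Y = Y * W"
  shows "X * exp_fps Y = exp_fps Y * (X + W)"
proof (rule fps_ext)
  fix n
  have YW: "W * Y ^ i = Y ^ i * W" for i
    using power_commuting_commutes[of Y W i] assms(3) by simp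
  have p: "X * Y ^ i = Y ^ i * X + of_nat i *\<^sub>C (Y ^ (i - 1) * W)" for i
  proof (induction i)
    case (Suc i)
    have "X * Y ^ Suc i = (X * Y ^ i) * Y" by (simp only: power_Suc2 mult.assoc)
    also have "\<dots> = Y ^ i * (X * Y) + of_nat i *\<^sub>C (Y ^ (i - 1) * (W * Y))"
      unfolding Suc by (simp add: algebra_simps mult_scaleC_left)
    also have "of_nat i *\<^sub>C (Y ^ (i - 1) * (W * Y)) = of_nat i *\<^sub>C (Y ^ i * W)"
      by (cases i) (simp_all add: assms(3) power_Suc2 mult.assoc del: of_nat_Suc power_Suc)
    finally show ?case
      by (simp add: assms(2) algebra_simps power_Suc2 scaleC_add_left scaleC_one del: power_Suc)
  qed (simp)
  \<comment> \<open>One term more than needed, so that lowering the exponent of \<open>Y\<close> by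
    one leaves exactly the range up to n.\<close>
  have "fps_nth (X * exp_fps Y) n = (\<Sum>i\<le>Suc n. (1 / fact i) *\<^sub>C fps_nth (X * Y ^ i) n)"
    by (simp add: exp_fps_def mult_fps_subst_nth(1)[OF assms(1), of n "Suc n"] fps_exp_def del: sum.atMost_Suc)
  also have "\<dots> = (\<Sum>i\<le>Suc n. (1 / fact i) *\<^sub>C fps_nth (Y ^ i * X) n)
      + (\<Sum>i\<le>Suc n. (of_nat i / fact i) *\<^sub>C fps_nth (Y ^ (i - 1) * W) n)"
    by (simp add: p scaleC_add_right sum.distrib scaleC_scaleC del: sum.atMost_Suc)
  also have "(\<Sum>i\<le>Suc n. (of_nat i / fact i) *\<^sub>C fps_nth (Y ^ (i - 1) * W) n)
      = (\<Sum>i\<le>n. (1 / fact i) *\<^sub>C fps_nth (Y ^ i * W) n)"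
    by (subst sum.atMost_Suc_shift) (simp add: fact_Suc divide_simps del: of_nat_Suc)
  also have "\<dots> = fps_nth (exp_fps Y * W) n"
    by (simp add: exp_fps_def mult_fps_subst_nth(2)[OF assms(1) le_refl] fps_exp_def)
  also have "(\<Sum>i\<le>Suc n. (1 / fact i) *\<^sub>C fps_nth (Y ^ i * X) n) = fps_nth (exp_fps Y * X) n"
    by (simp add: exp_fps_def mult_fps_subst_nth(2)[OF assms(1), of n "Suc n"] fps_exp_def del: sum.atMost_Suc)
  finally show "fps_nth (X * exp_fps Y) n = fps_nth (exp_fps Y * (X + W)) n"
    by (simp add: semiring_class.distrib_left)
qed

text \<open>The previous lemma says that e^Y intertwines X + W with X. Exponentiating gives e^Y
  e^(X+W) = e^X e^Y, and e^(X+W) splits because \<open>W\<close> is central for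
  \<open>X\<close>.\<close>

lemma exp_fps_Heisenberg:
  assumes "fps_nth X 0 = 0" "fps_nth Y 0 = 0" "fps_nth W 0 = 0"
    and "X * Y = Y * X + W" "W * X = X * W" "W * Y = Y * W"
  shows "exp_fps X * exp_fps Y = exp_fps Y * exp_fps X * exp_fps W"
proof -
  have "exp_fps Y * (X + W) = X * exp_fps Y"
    using exp_fps_derivation[OF assms(2,4,6)] by simp
  then have "exp_fps Y * exp_fps (X + W) = exp_fps X * exp_fps Y"
    by (intro exp_fps_intertwine) (use assms in auto)
  moreover have "exp_fps (X + W) = exp_fps X * exp_fps W"
    by (rule exp_fps_add) (use assms in auto)
  ultimately show ?thesis by (simp add: mult.assoc)
qed

section \<open>Homomorphisms between tensor powers\<close>

lemma clinear_tensor_eqI: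
  assumes "clinear f" "clinear g" "\<And>a b. f (a \<otimes>\<^sub>C b) = g (a \<otimes>\<^sub>C b)"
  shows "f t = g t"
  by (induction t rule: tensor_induct) (use assms in \<open>auto simp: clinear_def clinear_0[OF assms(1)] clinear_0[OF assms(2)]\<close>)

lemma clinear_comp: "clinear f \<Longrightarrow> clinear g \<Longrightarrow> clinear (\<lambda>x. f (g x))"
  by (simp add: clinear_def)

lemma calg_hom_clinear: "calg_hom f \<Longrightarrow> clinear f"
  by (simp add: calg_hom_def)

lemma tens_zero [simp]: "0 \<otimes>\<^sub>C (b::'b::cvector) = (0 :: ('a::cvector, 'b) tensor)"
    "(a::'a) \<otimes>\<^sub>C 0 = (0 :: ('a, 'b) tensor)"
  using tens_simps(3)[of 0 "0::'a" b] tens_simps(4)[of a 0 "0::'b"] by simp_all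

lemma calg_hom_tens_1: "calg_hom (\<lambda>a::'a::calgebra_1. a \<otimes>\<^sub>C (1::'b::calgebra_1))"
  by (simp add: calg_hom_def clinear_def tens_simps tens_mult_tens one_tensor_def)

lemma calg_hom_1_tens: "calg_hom (\<lambda>b::'b::calgebra_1. (1::'a::calgebra_1) \<otimes>\<^sub>C b)"
  by (simp add: calg_hom_def clinear_def tens_simps tens_mult_tens one_tensor_def)

text \<open>The universal property of the tensor product of algebras. The counit maps, the embedding
  into positions 23 and both coproduct maps are recognized as such lifts, and this is how they are
  seen to be multiplicative.\<close>

lemma calg_hom_tensor_lift:
  assumes f: "calg_hom f" and g: "calg_hom g" and comm: "\<And>a b. f a * g b = g b * f a"
  shows "calg_hom (tensor_lift (\<lambda>a b. f a * g b))"
    and "tensor_lift (\<lambda>a b. f a * g b) (a \<otimes>\<^sub>C b) = f a * g b"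
proof -
  let ?h = "tensor_lift (\<lambda>a b. f a * g b)"
  have bil: "cbilinear (\<lambda>a b. f a * g b)"
    by (rule cbilinearI) (simp_all add: calg_hom_add[OF f] calg_hom_add[OF g] calg_hom_scaleC[OF f]
      calg_hom_scaleC[OF g] algebra_simps mult_scaleC_left mult_scaleC_right)
  have lin: "clinear ?h" by (rule tensor_lift_linear[OF bil])
  have pure: "?h (a \<otimes>\<^sub>C b) = f a * g b" for a b by (rule tensor_lift_tens[OF bil])
  then show "?h (a \<otimes>\<^sub>C b) = f a * g b" .
  have add: "?h (s + t) = ?h s + ?h t" and zero: "?h 0 = 0" for s t
    using lin clinear_0 by (auto simp: clinear_def)
  have 1: "?h ((a \<otimes>\<^sub>C b) * t) = f a * g b * ?h t" for a b t
  proof (induction t rule: tensor_induct)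
    case (add c d t)
    have "f (a * c) * g (b * d) = f a * g b * (f c * g d)"
      unfolding calg_hom_mult[OF f] calg_hom_mult[OF g] by (metis comm mult.assoc)
    then show ?case using add.IH by (simp add: semiring_class.distrib_left tens_mult_tens \<open>\<And>s t. ?h (s + t) = ?h s + ?h t\<close> pure)
  qed (simp add: zero)
  have "?h (s * t) = ?h s * ?h t" for s t
    by (induction s rule: tensor_induct) (simp_all add: zero add pure 1 semiring_class.distrib_right)
  moreover have "?h 1 = 1"
    by (simp add: one_tensor_def pure calg_hom_1[OF f] calg_hom_1[OF g])
  ultimately show "calg_hom ?h" using lin by (simp add: calg_hom_def)
qed

lemma
  fixes a :: "'a::cvector" and b :: "'b::cvector" and c :: "'c::cvector"
  shows tensor_assoc_linear: "clinear (tensor_assoc :: ('a, ('b, 'c) tensor) tensor \<Rightarrow> _)"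
    and tensor_assoc_tens: "tensor_assoc (a \<otimes>\<^sub>C b \<otimes>\<^sub>C c) = (a \<otimes>\<^sub>C b) \<otimes>\<^sub>C c"
proof -
  define h where "h = (\<lambda>a::'a. tensor_lift (\<lambda>(b::'b) (c::'c). (a \<otimes>\<^sub>C b) \<otimes>\<^sub>C c))"
  have inner: "cbilinear (\<lambda>(b::'b) (c::'c). (a \<otimes>\<^sub>C b) \<otimes>\<^sub>C c)" for a :: 'a
    by (rule cbilinearI) (simp_all add: tens_simps)
  have lin: "clinear (h a)" and pure: "h a (b \<otimes>\<^sub>C c) = (a \<otimes>\<^sub>C b) \<otimes>\<^sub>C c" for a b c
    unfolding h_def using tensor_lift_linear[OF inner] tensor_lift_tens[OF inner] by auto
  have h0: "h a 0 = 0" for a using clinear_0[OF lin] .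
  \<comment> \<open>Linearity in the outer argument is not a property of the inner lift; it needs an
    induction over the inner tensor.\<close>
  have "h (a + a') t = h a t + h a' t \<and> h (x *\<^sub>C a) t = x *\<^sub>C h a t" for a a' x t
    by (induction t rule: tensor_induct)
      (use lin in \<open>simp_all add: h0 clinear_def pure tens_simps scaleC_add_right\<close>)
  then have outer: "cbilinear h"
    using lin by (intro cbilinearI) (simp_all add: clinear_def)
  show "clinear (tensor_assoc :: ('a, ('b, 'c) tensor) tensor \<Rightarrow> _)"
    unfolding tensor_assoc_def h_def[symmetric] by (rule tensor_lift_linear[OF outer])
  show "tensor_assoc (a \<otimes>\<^sub>C b \<otimes>\<^sub>C c) = (a \<otimes>\<^sub>C b) \<otimes>\<^sub>C c"
    unfolding tensor_assoc_def h_def[symmetric] by (simp add: tensor_lift_tens[OF outer] pure)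
qed

lemma clinear_tensor_assoc_tens: "clinear (\<lambda>t. tensor_assoc (a \<otimes>\<^sub>C t))"
  by (rule clinear_comp[OF tensor_assoc_linear]) (simp add: clinear_def tens_simps)

lemma calg_hom_coproduct: "calg_hom coproduct"
  unfolding calg_hom_def clinear_def coproduct_def
  by (simp add: u_lift_hom[OF lie_hom_coproduct])

lemma coproduct_incl: "coproduct (incl x) = incl x \<otimes>\<^sub>C 1 + 1 \<otimes>\<^sub>C incl x"
  by (simp add: coproduct_def u_lift_hom[OF lie_hom_coproduct])

lemma calg_hom_counit: "calg_hom counit"
  unfolding calg_hom_def clinear_def counit_def
  by (simp add: u_lift_hom[OF lie_hom_counit])

lemma counit_incl: "counit (incl x) = 0"
  by (simp add: counit_def u_lift_hom[OF lie_hom_counit])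

lemma calg_hom_counit_scaleC: "calg_hom (\<lambda>a. counit a *\<^sub>C 1)"
  unfolding calg_hom_def clinear_def
  by (simp add: calg_hom_add[OF calg_hom_counit] calg_hom_scaleC[OF calg_hom_counit]
    calg_hom_mult[OF calg_hom_counit] calg_hom_1[OF calg_hom_counit] scaleC_add_left scaleC_scaleC
    scaleC_one scaleC_complex_def mult_scaleC_left mult_scaleC_right mult.commute)

lemma calg_hom_id: "calg_hom (\<lambda>x. x)"
  by (simp add: calg_hom_def clinear_def)

lemma
  shows calg_hom_counit_left: "calg_hom (tensor_lift (\<lambda>a b. counit a *\<^sub>C b))"
    and counit_left_tens: "tensor_lift (\<lambda>a b. counit a *\<^sub>C b) (a \<otimes>\<^sub>C b) = counit a *\<^sub>C b"
    and calg_hom_counit_right: "calg_hom (tensor_lift (\<lambda>a b. counit b *\<^sub>C a))"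
    and counit_right_tens: "tensor_lift (\<lambda>a b. counit b *\<^sub>C a) (a \<otimes>\<^sub>C b) = counit b *\<^sub>C a"
  using calg_hom_tensor_lift[OF calg_hom_counit_scaleC calg_hom_id]
    calg_hom_tensor_lift[OF calg_hom_id calg_hom_counit_scaleC]
  by (simp_all add: mult_scaleC_left mult_scaleC_right)

lemma calg_hom_embed_23: "calg_hom (\<lambda>t :: ('b::calgebra_1, 'c::calgebra_1) tensor.
  tensor_assoc ((1::'a::calgebra_1) \<otimes>\<^sub>C t))"
proof -
  let ?f = "\<lambda>b::'b. ((1::'a) \<otimes>\<^sub>C b) \<otimes>\<^sub>C (1::'c)" and ?g = "\<lambda>c::'c. (1 :: ('a, 'b) tensor) \<otimes>\<^sub>C c"
  have f: "calg_hom ?f" by (rule calg_hom_comp[OF calg_hom_tens_1 calg_hom_1_tens])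
  note l = calg_hom_tensor_lift[OF f calg_hom_1_tens, unfolded tens_mult_tens]
  have "tensor_assoc ((1::'a) \<otimes>\<^sub>C t) = tensor_lift (\<lambda>b c. ?f b * ?g c) t" for t
    by (rule clinear_tensor_eqI[OF clinear_tensor_assoc_tens calg_hom_clinear])
      (use l in \<open>simp_all add: tensor_assoc_tens tens_mult_tens\<close>)
  then show ?thesis using l(1) by (simp add: tens_mult_tens)
qed

text \<open>The first leg commutes with the other two. The two factorizations together supply the
  commuting images needed to lift the map that applies the coproduct to the second leg.\<close>

lemma tensor_assoc_tens_split:
  fixes t :: "('b::calgebra_1, 'c::calgebra_1) tensor" and a :: "'a::calgebra_1"
  shows "tensor_assoc (a \<otimes>\<^sub>C t) = ((a \<otimes>\<^sub>C 1) \<otimes>\<^sub>C 1) * tensor_assoc (1 \<otimes>\<^sub>C t)"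
    and "tensor_assoc (a \<otimes>\<^sub>C t) = tensor_assoc (1 \<otimes>\<^sub>C t) * ((a \<otimes>\<^sub>C 1) \<otimes>\<^sub>C 1)"
proof -
  have t: "clinear (\<lambda>t :: ('b, 'c) tensor. tensor_assoc ((1::'a) \<otimes>\<^sub>C t))"
    by (rule clinear_tensor_assoc_tens)
  have lin: "clinear (\<lambda>t. x * tensor_assoc ((1::'a) \<otimes>\<^sub>C t))" "clinear (\<lambda>t. tensor_assoc ((1::'a) \<otimes>\<^sub>C t) * x)"
    for x :: "(('a, 'b) tensor, 'c) tensor"
    using t by (simp_all add: clinear_def ring_distribs mult_scaleC_left mult_scaleC_right)
  show "tensor_assoc (a \<otimes>\<^sub>C t) = ((a \<otimes>\<^sub>C 1) \<otimes>\<^sub>C 1) * tensor_assoc (1 \<otimes>\<^sub>C t)"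
    by (rule clinear_tensor_eqI[OF clinear_tensor_assoc_tens lin(1)])
      (simp add: tensor_assoc_tens tens_mult_tens)
  show "tensor_assoc (a \<otimes>\<^sub>C t) = tensor_assoc (1 \<otimes>\<^sub>C t) * ((a \<otimes>\<^sub>C 1) \<otimes>\<^sub>C 1)"
    by (rule clinear_tensor_eqI[OF clinear_tensor_assoc_tens lin(2)])
      (simp add: tensor_assoc_tens tens_mult_tens)
qed

lemma
  fixes a :: "'a::lie_algebra U" and b :: "'b::calgebra_1"
  shows calg_hom_coproduct_left: "calg_hom (tensor_map coproduct (id :: 'b \<Rightarrow> 'b))"
    and coproduct_left_tens: "tensor_map coproduct id (a \<otimes>\<^sub>C b) = coproduct a \<otimes>\<^sub>C b"
proof -
  have e: "tensor_map coproduct (id :: 'b \<Rightarrow> 'b) = tensor_lift (\<lambda>a b. (coproduct a \<otimes>\<^sub>C 1) * (1 \<otimes>\<^sub>C b))"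
    by (simp add: tens_mult_tens tensor_map_def)
  note l = calg_hom_tensor_lift[OF calg_hom_comp[OF calg_hom_tens_1 calg_hom_coproduct] calg_hom_1_tens]
  show "calg_hom (tensor_map coproduct (id :: 'b \<Rightarrow> 'b))"
    unfolding e by (rule l) (simp add: tens_mult_tens)
  show "tensor_map coproduct id (a \<otimes>\<^sub>C b) = coproduct a \<otimes>\<^sub>C b"
    unfolding e by (subst l(2)) (simp_all add: tens_mult_tens)
qed

lemma
  fixes a b :: "'a::lie_algebra U"
  shows calg_hom_coproduct_right: "calg_hom (\<lambda>t :: ('a U, 'a U) tensor. tensor_assoc (tensor_map id coproduct t))"
    and coproduct_right_tens:
      "tensor_assoc (tensor_map id coproduct (a \<otimes>\<^sub>C b)) = tensor_assoc (a \<otimes>\<^sub>C coproduct b)"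
proof -
  let ?f = "\<lambda>a::'a U. (a \<otimes>\<^sub>C (1::'a U)) \<otimes>\<^sub>C (1::'a U)"
  let ?g = "\<lambda>b::'a U. tensor_assoc ((1::'a U) \<otimes>\<^sub>C coproduct b)"
  have f: "calg_hom ?f" by (rule calg_hom_comp[OF calg_hom_tens_1 calg_hom_tens_1])
  have g: "calg_hom ?g" by (rule calg_hom_comp[OF calg_hom_embed_23 calg_hom_coproduct])
  have "?f a * ?g b = ?g b * ?f a" for a b
    using tensor_assoc_tens_split by metis
  note l = calg_hom_tensor_lift[OF f g this]
  have bil: "cbilinear (\<lambda>(a::'a U) b. a \<otimes>\<^sub>C coproduct b)"
    by (rule cbilinearI) (simp_all add: tens_simps calg_hom_add[OF calg_hom_coproduct]
      calg_hom_scaleC[OF calg_hom_coproduct])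
  have pure: "tensor_map id coproduct (a \<otimes>\<^sub>C b) = a \<otimes>\<^sub>C coproduct b" for a b :: "'a U"
    by (simp add: tensor_map_def tensor_lift_tens[OF bil])
  then show "tensor_assoc (tensor_map id coproduct (a \<otimes>\<^sub>C b)) = tensor_assoc (a \<otimes>\<^sub>C coproduct b)"
    by simp
  have lin: "clinear (tensor_map id coproduct :: ('a U, 'a U) tensor \<Rightarrow> _)"
    using tensor_lift_linear[OF bil] by (simp add: tensor_map_def)
  have "tensor_assoc (tensor_map id coproduct t) = tensor_lift (\<lambda>a b. ?f a * ?g b) t" for t
    by (rule clinear_tensor_eqI[OF clinear_comp[OF tensor_assoc_linear lin] calg_hom_clinear[OF l(1)]])
      (simp only: pure, subst l(2), rule tensor_assoc_tens_split(1))
  then show "calg_hom (\<lambda>t :: ('a U, 'a U) tensor. tensor_assoc (tensor_map id coproduct t))"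
    using l(1) by simp
qed

text \<open>Restricting to maps that act coefficientwise ensures that they fix xi and respect the
  infinite sums behind exp and ln, which an arbitrary algebra homomorphism of series rings need not
  do.\<close>

definition fps_hom :: "('a::calgebra_1 fps \<Rightarrow> 'b::calgebra_1 fps) \<Rightarrow> bool" where
  "fps_hom \<Phi> \<longleftrightarrow> (\<exists>f. calg_hom f \<and> \<Phi> = fps_map f)"

lemma fps_hom_calg_hom: "fps_hom \<Phi> \<Longrightarrow> calg_hom \<Phi>"
  by (auto simp: fps_hom_def calg_hom_fps_map)

lemma
  assumes "fps_hom \<Phi>"
  shows fps_hom_add: "\<Phi> (F + G) = \<Phi> F + \<Phi> G"
    and fps_hom_mult: "\<Phi> (F * G) = \<Phi> F * \<Phi> G"
    and fps_hom_scaleC: "\<Phi> (c *\<^sub>C F) = c *\<^sub>C \<Phi> F"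
    and fps_hom_minus: "\<Phi> (- F) = - \<Phi> F"
    and fps_hom_1: "\<Phi> 1 = 1"
    and fps_hom_0: "\<Phi> 0 = 0"
    and fps_hom_sum: "\<Phi> (sum h A) = (\<Sum>i\<in>A. \<Phi> (h i))"
    and fps_hom_X: "\<Phi> fps_X = fps_X"
    and fps_hom_exp: "\<Phi> (exp_fps F) = exp_fps (\<Phi> F)"
    and fps_hom_ln1p: "\<Phi> (ln1p_fps F) = ln1p_fps (\<Phi> F)"
  using fps_hom_calg_hom[OF assms] assms
  by (auto simp: calg_hom_add calg_hom_mult calg_hom_scaleC calg_hom_minus calg_hom_1 calg_hom_0
    calg_hom_sum fps_map_X fps_map_exp fps_map_ln1p fps_hom_def)

lemma fps_hom_nth_0: "fps_hom \<Phi> \<Longrightarrow> fps_nth F 0 = 0 \<Longrightarrow> fps_nth (\<Phi> F) 0 = 0"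
  by (auto simp: fps_hom_def calg_hom_0)

lemmas fps_hom_simps = fps_hom_add fps_hom_mult fps_hom_scaleC fps_hom_minus fps_hom_1 fps_hom_0
  fps_hom_sum fps_hom_X fps_hom_exp fps_hom_ln1p

section \<open>Slots of the double and triple tensor powers\<close>

type_synonym 'g U2 = "('g U, 'g U) tensor"
type_synonym 'g U3 = "(('g U, 'g U) tensor, 'g U) tensor"

text \<open>\<open>E\<^sub>i\<close> and \<open>S\<^sub>i\<close> embed \<open>U\<close> as the \<open>i\<close>-th factor of \<open>U \<otimes> U\<close> and \<open>U \<otimes> U \<otimes> U\<close>; \<open>I12, I23\<close> and
  \<open>D12, D23\<close> are the four maps \<open>U \<otimes> U \<rightarrow> U \<otimes> U \<otimes> U\<close> of the twist equation.\<close>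

definition E1 :: "'g::lie_algebra U fps \<Rightarrow> 'g U2 fps" where "E1 = fps_map (\<lambda>a. a \<otimes>\<^sub>C 1)"
definition E2 :: "'g::lie_algebra U fps \<Rightarrow> 'g U2 fps" where "E2 = fps_map (\<lambda>b. 1 \<otimes>\<^sub>C b)"
definition Cop :: "'g::lie_algebra U fps \<Rightarrow> 'g U2 fps" where "Cop = fps_map coproduct"
definition I12 :: "'g::lie_algebra U2 fps \<Rightarrow> 'g U3 fps" where "I12 = fps_map (\<lambda>t. t \<otimes>\<^sub>C 1)"
definition I23 :: "'g::lie_algebra U2 fps \<Rightarrow> 'g U3 fps" where
  "I23 = fps_map (\<lambda>t. tensor_assoc (1 \<otimes>\<^sub>C t))"
definition D12 :: "'g::lie_algebra U2 fps \<Rightarrow> 'g U3 fps" where "D12 = fps_map (tensor_map coproduct id)"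
definition D23 :: "'g::lie_algebra U2 fps \<Rightarrow> 'g U3 fps" where
  "D23 = fps_map (\<lambda>t. tensor_assoc (tensor_map id coproduct t))"
definition S1 :: "'g::lie_algebra U fps \<Rightarrow> 'g U3 fps" where "S1 = fps_map (\<lambda>a. (a \<otimes>\<^sub>C 1) \<otimes>\<^sub>C 1)"
definition S2 :: "'g::lie_algebra U fps \<Rightarrow> 'g U3 fps" where "S2 = fps_map (\<lambda>a. (1 \<otimes>\<^sub>C a) \<otimes>\<^sub>C 1)"
definition S3 :: "'g::lie_algebra U fps \<Rightarrow> 'g U3 fps" where "S3 = fps_map (\<lambda>a. 1 \<otimes>\<^sub>C a)"
definition counit1 :: "'g::lie_algebra U2 fps \<Rightarrow> 'g U fps" where
  "counit1 = fps_map (tensor_lift (\<lambda>a b. counit a *\<^sub>C b))"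
definition counit2 :: "'g::lie_algebra U2 fps \<Rightarrow> 'g U fps" where
  "counit2 = fps_map (tensor_lift (\<lambda>a b. counit b *\<^sub>C a))"

lemma fps_homs:
  shows fps_hom_E1: "fps_hom E1" and fps_hom_E2: "fps_hom E2" and fps_hom_Cop: "fps_hom Cop"
    and fps_hom_I12: "fps_hom I12" and fps_hom_I23: "fps_hom I23"
    and fps_hom_D12: "fps_hom D12" and fps_hom_D23: "fps_hom D23"
    and fps_hom_S1: "fps_hom S1" and fps_hom_S2: "fps_hom S2" and fps_hom_S3: "fps_hom S3"
    and fps_hom_counit1: "fps_hom counit1" and fps_hom_counit2: "fps_hom counit2"
  unfolding fps_hom_def E1_def E2_def Cop_def I12_def I23_def D12_def D23_def S1_def S2_def S3_def
    counit1_def counit2_def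
  using calg_hom_tens_1 calg_hom_1_tens calg_hom_coproduct calg_hom_embed_23 calg_hom_coproduct_left
    calg_hom_coproduct_right calg_hom_comp[OF calg_hom_tens_1 calg_hom_tens_1]
    calg_hom_comp[OF calg_hom_tens_1 calg_hom_1_tens] calg_hom_counit_left calg_hom_counit_right
  by blast+

lemmas hom_simps = fps_hom_simps[OF fps_hom_E1] fps_hom_simps[OF fps_hom_E2]
  fps_hom_simps[OF fps_hom_Cop] fps_hom_simps[OF fps_hom_I12] fps_hom_simps[OF fps_hom_I23]
  fps_hom_simps[OF fps_hom_D12] fps_hom_simps[OF fps_hom_D23] fps_hom_simps[OF fps_hom_S1]
  fps_hom_simps[OF fps_hom_S2] fps_hom_simps[OF fps_hom_S3] fps_hom_simps[OF fps_hom_counit1]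
  fps_hom_simps[OF fps_hom_counit2]

lemmas hom_nth_0 = fps_homs[THEN fps_hom_nth_0]

text \<open>With these rules the coproduct only has to be computed on U itself; both sides of the
  twist equation become placements of the results into slots.\<close>

lemma slot_simps:
  "I12 (E1 F) = S1 F" "I12 (E2 F) = S2 F" "I23 (E1 F) = S2 F" "I23 (E2 F) = S3 F"
  "D12 (E1 F) = I12 (Cop F)" "D12 (E2 F) = S3 F" "D23 (E1 F) = S1 F" "D23 (E2 F) = I23 (Cop F)"
  by (simp_all add: I12_def I23_def D12_def D23_def E1_def E2_def S1_def S2_def S3_def Cop_def
    fps_map_comp tensor_assoc_tens coproduct_left_tens coproduct_right_tens
    calg_hom_1[OF calg_hom_coproduct] one_tensor_def)

definition cincl :: "'g::lie_algebra \<Rightarrow> 'g U fps" where "cincl x = fps_const (incl x)"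

lemma Cop_cincl: "Cop (cincl x) = E1 (cincl x) + E2 (cincl x)"
  by (simp add: Cop_def E1_def E2_def cincl_def fps_eq_iff coproduct_incl calg_hom_0[OF calg_hom_coproduct])

lemma cincl_bracket: "cincl x * cincl y = cincl y * cincl x + cincl (bracket x y)"
  by (simp add: cincl_def incl_bracket)

lemma cincl_linear: "clinear cincl"
  using incl_linear by (auto simp: clinear_def cincl_def fps_eq_iff)

lemma counit_simps:
  "counit1 (E1 (cincl x)) = 0" "counit1 (E2 F) = F" "counit2 (E1 F) = F" "counit2 (E2 (cincl x)) = 0"
  by (simp_all add: counit1_def counit2_def E1_def E2_def cincl_def fps_eq_iff counit_left_tens
    counit_right_tens counit_incl calg_hom_1[OF calg_hom_counit] scaleC_one calg_hom_0[OF calg_hom_counit])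

lemma fps_map_commute:
  assumes "\<And>a b. f a * g b = g b * (f a :: 'a::ring_1)"
  shows "fps_map f F * fps_map g G = fps_map g G * fps_map f F"
proof (rule fps_ext)
  fix n
  show "fps_nth (fps_map f F * fps_map g G) n = fps_nth (fps_map g G * fps_map f F) n"
    unfolding fps_mult_nth by (subst sum.atLeastAtMost_rev) (simp add: assms)
qed

lemma slots_commute:
  "E1 F * E2 G = E2 G * E1 F"
  "S1 F * S2 G = S2 G * S1 F" "S1 F * S3 G = S3 G * S1 F" "S2 F * S3 G = S3 G * S2 F"
  "I12 P * S3 G = S3 G * I12 P" "S1 F * I23 P = I23 P * S1 F"
  unfolding E1_def E2_def S1_def S2_def S3_def I12_def I23_def
  by (rule fps_map_commute, simp add: tens_mult_tens tensor_assoc_tens_split(1)[symmetric]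
     tensor_assoc_tens_split(2)[symmetric])+

text \<open>Connects the factors of the theorem, written as a map applied to the second leg, with
  products of slot embeddings.\<close>

lemma fps_map_tens_eq: "fps_map (\<lambda>u. incl x \<otimes>\<^sub>C u) F = E1 (cincl x) * E2 F"
proof -
  have "E1 (cincl x) = fps_const (incl x \<otimes>\<^sub>C 1)"
    by (simp add: E1_def cincl_def fps_map_const[OF calg_hom_tens_1])
  show ?thesis unfolding \<open>E1 (cincl x) = _\<close> by (simp add: fps_eq_iff E2_def tens_mult_tens)
qed

lemma fps_X_commute: "F * fps_X = fps_X * (F :: 'a::ring_1 fps)"
  by (simp add: fps_mult_fps_X_commute)

lemma twisting_element_iff:
  "twisting_element F \<longleftrightarrow> (\<exists>G. F * G = 1 \<and> G * F = 1) \<and> counit1 F = 1 \<and> counit2 F = 1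
     \<and> I12 F * D12 F = I23 F * D23 F"
  by (simp add: twisting_element_def counit1_def counit2_def I12_def I23_def D12_def D23_def)

section \<open>A single extended Jordanian twist\<close>

text \<open>\<open>T2\<close> and \<open>T3\<close> are pure tensors of series over the scalars
  C[[xi]], so xi may be moved freely between the slots.\<close>

definition T2 :: "'g::lie_algebra U fps \<Rightarrow> 'g U fps \<Rightarrow> 'g U2 fps" where "T2 a b = E1 a * E2 b"

definition T3 :: "'g::lie_algebra U fps \<Rightarrow> 'g U fps \<Rightarrow> 'g U fps \<Rightarrow> 'g U3 fps" where
  "T3 a b c = S1 a * (S2 b * S3 c)"

lemma fps_X_pull: "F * (fps_X * G) = fps_X * (F * (G :: 'a::ring_1 fps))"
  by (metis fps_X_commute mult.assoc)

lemma T2_mult: "T2 a b * T2 a' b' = T2 (a * a') (b * b')"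
  proof -
  have "T2 a b * T2 a' b' = E1 a * (E2 b * E1 a') * E2 b'" by (simp only: T2_def mult.assoc)
  then show ?thesis unfolding slots_commute(1)[symmetric] by (simp only: T2_def hom_simps mult.assoc)
qed

lemma T3_mult: "T3 a b c * T3 a' b' c' = T3 (a * a') (b * b') (c * c')"
proof -
  have "T3 a b c * T3 a' b' c' = S1 a * (S2 b * (S3 c * S1 a')) * S2 b' * S3 c'"
    by (simp add: T3_def mult.assoc)
  also have "\<dots> = S1 a * (S2 b * S1 a') * S3 c * S2 b' * S3 c'"
    unfolding slots_commute(3)[symmetric] by (simp only: mult.assoc)
  also have "\<dots> = S1 a * S1 a' * S2 b * (S3 c * S2 b') * S3 c'"
    unfolding slots_commute(2)[symmetric] by (simp only: mult.assoc)
  also have "\<dots> = S1 a * S1 a' * (S2 b * S2 b') * (S3 c * S3 c')"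
    unfolding slots_commute(4)[symmetric] by (simp only: mult.assoc)
  finally show ?thesis by (simp add: T3_def hom_simps mult.assoc)
qed

lemma T2_simps:
  "T2 1 1 = 1" "T2 (a + a') b = T2 a b + T2 a' b" "T2 a (b + b') = T2 a b + T2 a b'"
  "T2 (x *\<^sub>C a) b = x *\<^sub>C T2 a b" "T2 a (x *\<^sub>C b) = x *\<^sub>C T2 a b"
  "T2 0 b = 0" "T2 a 0 = 0"
  by (simp_all add: T2_def hom_simps ring_distribs mult_scaleC_left mult_scaleC_right)

lemma T3_simps:
  "T3 1 1 1 = 1" "T3 a (b + b') c = T3 a b c + T3 a b' c" "T3 a (x *\<^sub>C b) c = x *\<^sub>C T3 a b c"
  "T3 a (b - b') c = T3 a b c - T3 a b' c" "T3 a b (c + c') = T3 a b c + T3 a b c'"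
  "T3 a 0 c = 0"
proof -
  have "S2 (b - b') = S2 b - S2 b'"
    using fps_hom_add[OF fps_hom_S2, of b "- b'"] fps_hom_minus[OF fps_hom_S2, of b'] by simp
  then show "T3 a (b - b') c = T3 a b c - T3 a b' c"
    by (simp add: T3_def ring_distribs)
qed (simp_all add: T3_def hom_simps ring_distribs mult_scaleC_left mult_scaleC_right)

lemma T2_slots:
  "I12 (T2 a b) = T3 a b 1" "I23 (T2 a b) = T3 1 a b"
  "D12 (T2 a b) = I12 (Cop a) * T3 1 1 b" "D23 (T2 a b) = T3 a 1 1 * I23 (Cop b)"
  by (simp_all add: T2_def T3_def slot_simps hom_simps)

lemma Cop_cincl_T2: "Cop (cincl x) = T2 (cincl x) 1 + T2 1 (cincl x)"
  by (simp add: Cop_cincl T2_def hom_simps)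

lemma T2_nth_0: "fps_nth a 0 = 0 \<or> fps_nth b 0 = 0 \<Longrightarrow> fps_nth (T2 a b) 0 = 0"
  by (auto simp: T2_def hom_nth_0)

lemma T3_nth_0: "fps_nth a 0 = 0 \<or> fps_nth b 0 = 0 \<or> fps_nth c 0 = 0 \<Longrightarrow> fps_nth (T3 a b c) 0 = 0"
  by (auto simp: T3_def hom_nth_0)

lemma I12_T3_commute: "I12 P * T3 1 1 c = T3 1 1 c * I12 P"
  by (simp add: T3_def hom_simps slots_commute)

lemma I23_T3_commute: "I23 P * T3 a 1 1 = T3 a 1 1 * I23 P"
  by (simp add: T3_def hom_simps slots_commute)

lemma sum_commute:
  assumes "\<And>i j. i \<in> I \<Longrightarrow> j \<in> J \<Longrightarrow> f i * g j = g j * (f i :: 'a::ring)"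
  shows "sum f I * sum g J = sum g J * sum f I"
  unfolding sum_product by (subst sum.swap) (simp add: assms)

lemma sum_nth_0: "(\<And>i. i \<in> I \<Longrightarrow> fps_nth (f i) 0 = 0) \<Longrightarrow> fps_nth (sum f I) 0 = 0"
  by (simp add: fps_sum_nth)

lemma inverse_mult_ex:
  assumes "x * x' = 1" "x' * x = 1" "y * y' = 1" "y' * y = (1 :: 'a::monoid_mult)"
  shows "\<exists>z. (x * y) * z = 1 \<and> z * (x * y) = 1"
proof (intro exI conjI)
  show "(x * y) * (y' * x') = 1" by (metis assms(1,3) mult.assoc mult_1_left)
  show "(y' * x') * (x * y) = 1" by (metis assms(2,4) mult.assoc mult_1_left)
qed

lemma cincl_commute: "bracket x y = 0 \<Longrightarrow> cincl x * cincl y = cincl y * cincl x"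
  using cincl_bracket[of x y] clinear_0[OF cincl_linear] by simp

lemma cincl_scaleC: "cincl (c *\<^sub>C x) = c *\<^sub>C cincl x"
  using cincl_linear unfolding clinear_def by blast

text \<open>The relations of one link, freed from roots: the \<open>A i\<close>, \<open>B i\<close>
  and \<open>E\<close> form a Heisenberg algebra graded by \<open>H\<close> with degrees 1/2, 1/2
  and 1. \<open>normalized_generators\<close> contains \<open>AB\<close> only for i = j, and neither
  \<open>AA\<close> nor \<open>BB\<close>; these are obtained later from the shape of the
  roots.\<close>

locale extended_jordanian =
  fixes H E :: "'g::lie_algebra" and A B :: "'i \<Rightarrow> 'g" and I :: "'i set"
  assumes finite_I: "finite I"
    and HE: "bracket H E = E"
    and HA: "i \<in> I \<Longrightarrow> bracket H (A i) = (1/2) *\<^sub>C A i"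
    and HB: "i \<in> I \<Longrightarrow> bracket H (B i) = (1/2) *\<^sub>C B i"
    and AB: "i \<in> I \<Longrightarrow> j \<in> I \<Longrightarrow> bracket (A i) (B j) = (if i = j then E else 0)"
    and EA: "i \<in> I \<Longrightarrow> bracket E (A i) = 0"
    and EB: "i \<in> I \<Longrightarrow> bracket E (B i) = 0"
    and AA: "i \<in> I \<Longrightarrow> j \<in> I \<Longrightarrow> bracket (A i) (A j) = 0"
    and BB: "i \<in> I \<Longrightarrow> j \<in> I \<Longrightarrow> bracket (B i) (B j) = 0"
begin

definition e :: "'g U fps" where "e = fps_X * cincl E"
definition sg :: "'g U fps" where "sg = ln1p_fps e"
text \<open>The complex power (1 + xi E)^w.\<close>

definition K :: "complex \<Rightarrow> 'g U fps" where "K w = exp_fps (w *\<^sub>C sg)"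
definition C :: "'i \<Rightarrow> 'g U fps" where "C i = fps_X * (cincl (B i) * K (-1/2))"
definition FJ :: "'g U2 fps" where "FJ = exp_fps (T2 (cincl H) sg)"
definition FE :: "'g U2 fps" where "FE = exp_fps (\<Sum>i\<in>I. T2 (cincl (A i)) (C i))"

section \<open>Commutation relations of the ingredients of one link\<close>

lemma e_nth_0 [simp]: "fps_nth e 0 = 0" by (simp add: e_def)
lemma sg_nth_0 [simp]: "fps_nth sg 0 = 0" by (simp add: sg_def)
lemma C_nth_0 [simp]: "fps_nth (C i) 0 = 0" by (simp add: C_def)

lemma e_commute: "bracket E x = 0 \<Longrightarrow> e * cincl x = cincl x * e"
  unfolding e_def by (metis cincl_commute fps_X_commute mult.assoc)

lemma sg_commute: "e * x = x * e \<Longrightarrow> sg * x = x * sg"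
  unfolding sg_def by (rule ln1p_fps_intertwine[symmetric]) auto

lemma K_commute: "sg * x = x * sg \<Longrightarrow> K w * x = x * K w"
  unfolding K_def by (rule exp_fps_commute[symmetric]) (auto simp: mult_scaleC_left mult_scaleC_right)

lemma K_K: "K v * K w = K (v + w)"
  unfolding K_def scaleC_add_left
  by (rule exp_fps_add[symmetric]) (auto simp: mult_scaleC_left mult_scaleC_right scaleC_scaleC mult.commute)

lemma K_1: "K 1 = 1 + e"
  unfolding K_def sg_def scaleC_one by (simp add: exp_fps_ln1p)

lemma K_0: "K 0 = 1"
  by (simp add: K_def)

lemma sg_A: "i \<in> I \<Longrightarrow> sg * cincl (A i) = cincl (A i) * sg"
  by (intro sg_commute e_commute EA)

lemma sg_B: "i \<in> I \<Longrightarrow> sg * cincl (B i) = cincl (B i) * sg"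
  by (intro sg_commute e_commute EB)

lemma K_A: "i \<in> I \<Longrightarrow> K w * cincl (A i) = cincl (A i) * K w"
  by (intro K_commute sg_A)

lemma K_B: "i \<in> I \<Longrightarrow> K w * cincl (B i) = cincl (B i) * K w"
  by (intro K_commute sg_B)

lemma A_A: "i \<in> I \<Longrightarrow> j \<in> I \<Longrightarrow> cincl (A i) * cincl (A j) = cincl (A j) * cincl (A i)"
  by (intro cincl_commute AA)

lemma B_B: "i \<in> I \<Longrightarrow> j \<in> I \<Longrightarrow> cincl (B i) * cincl (B j) = cincl (B j) * cincl (B i)"
  by (intro cincl_commute BB)

lemma K_C:
  assumes "i \<in> I" shows "K w * C i = C i * K w"
proof -
  have "K w * (cincl (B i) * K v) = cincl (B i) * K v * K w" for v
    by (metis K_B[OF assms] K_K add.commute mult.assoc)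
  then show ?thesis unfolding C_def fps_X_pull by (simp only: mult.assoc)
qed

lemma C_C:
  assumes "i \<in> I" "j \<in> I" shows "C i * C j = C j * C i"
proof -
  let ?K = "K (-1/2)"
  have p: "C k * C l = fps_X * (fps_X * (cincl (B k) * cincl (B l) * (?K * ?K)))" if "l \<in> I" for k l
  proof -
    have "C k * C l = fps_X * (fps_X * (cincl (B k) * (?K * cincl (B l)) * ?K))"
      by (simp only: C_def mult.assoc fps_X_pull[of "cincl (B k)"] fps_X_pull[of ?K])
    then show ?thesis unfolding K_B[OF that] by (simp only: mult.assoc)
  qed
  show ?thesis unfolding p[OF assms(1)] p[OF assms(2)] B_B[OF assms] ..
qed

text \<open>Moving \<open>A i\<close> past \<open>B i\<close> produces E, hence xi E e^(-sigma/2).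
  As xi E = e^sigma - 1, this is e^(sigma/2) - e^(-sigma/2): the origin of the two values 1/2 and
  -1/2 of the parameter of \<open>Z\<close>.\<close>

lemma C_A:
  assumes "i \<in> I" "j \<in> I"
  shows "C i * cincl (A j) = cincl (A j) * C i - (if i = j then K (1/2) - K (-1/2) else 0)"
proof -
  have "cincl (B i) * cincl (A j) = cincl (A j) * cincl (B i) - (if i = j then cincl E else 0)"
    using cincl_bracket[of "A j" "B i"] AB[OF assms(2,1)] clinear_0[OF cincl_linear] by auto
  moreover have "C i * cincl (A j) = fps_X * ((cincl (B i) * cincl (A j)) * K (-1/2))"
    by (simp only: C_def mult.assoc K_A[OF assms(2)])
  ultimately have "C i * cincl (A j) = fps_X * ((cincl (A j) * cincl (B i) - (if i = j then cincl E else 0)) * K (-1/2))"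
    by simp
  also have "\<dots> = cincl (A j) * C i - (if i = j then e * K (-1/2) else 0)"
    unfolding C_def e_def
    by (simp add: ring_distribs mult.assoc fps_X_pull[of "cincl (A j)"])
  also have "e * K (-1/2) = K (1/2) - K (-1/2)"
  proof -
    have "(1 + e) * K (-1/2) = K (1/2)" unfolding K_1[symmetric] K_K by simp
    then show ?thesis by (simp add: ring_distribs algebra_simps)
  qed
  finally show ?thesis .
qed

text \<open>If x has degree w under H, then moving x (x) 1 past H (x) sigma shifts the exponent by w
  (1 (x) sigma). This commutes with H (x) sigma, so its exponential splits off as e^(w sigma) in the
  second slot.\<close>

lemma FJ_E1:
  assumes "cincl H * x = x * cincl H + w *\<^sub>C x"
  shows "FJ * T2 x 1 = T2 x (K w) * FJ"
proof -
  have "T2 x 1 * (T2 (cincl H) sg + w *\<^sub>C T2 1 sg) = T2 (cincl H) sg * T2 x 1"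
    by (simp add: T2_mult T2_simps assms ring_distribs mult_scaleC_right)
  then have "T2 x 1 * exp_fps (T2 (cincl H) sg + w *\<^sub>C T2 1 sg) = FJ * T2 x 1"
    unfolding FJ_def by (intro exp_fps_intertwine) (auto simp: T2_nth_0)
  also have "exp_fps (T2 (cincl H) sg + w *\<^sub>C T2 1 sg) = exp_fps (w *\<^sub>C T2 1 sg) * FJ"
    unfolding FJ_def add.commute[of "T2 (cincl H) sg"]
    by (rule exp_fps_add) (auto simp: T2_nth_0 T2_mult mult_scaleC_left mult_scaleC_right)
  also have "exp_fps (w *\<^sub>C T2 1 sg) = T2 1 (K w)"
    by (simp add: T2_def K_def hom_simps)
  finally show ?thesis by (simp add: mult.assoc[symmetric] T2_mult)
qed

lemma FJ_E2: "sg * x = x * sg \<Longrightarrow> FJ * T2 1 x = T2 1 x * FJ"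
  unfolding FJ_def by (rule exp_fps_commute[symmetric]) (auto simp: T2_nth_0 T2_mult)

lemma H_cincl: "bracket H x = w *\<^sub>C x \<Longrightarrow> cincl H * cincl x = cincl x * cincl H + w *\<^sub>C cincl x"
  using cincl_bracket[of H x] by (simp add: cincl_scaleC)

lemma FJ_Cop_A: "i \<in> I \<Longrightarrow> FJ * Cop (cincl (A i)) = (T2 (cincl (A i)) (K (1/2)) + T2 1 (cincl (A i))) * FJ"
  by (simp add: Cop_cincl_T2 ring_distribs FJ_E1[OF H_cincl[OF HA]] FJ_E2 sg_A)

lemma FJ_Cop_B: "i \<in> I \<Longrightarrow> FJ * Cop (cincl (B i)) = (T2 (cincl (B i)) (K (1/2)) + T2 1 (cincl (B i))) * FJ"
  by (simp add: Cop_cincl_T2 ring_distribs FJ_E1[OF H_cincl[OF HB]] FJ_E2 sg_B)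

text \<open>Conjugation turns the coproduct of e into e (x) (1 + e) + 1 (x) e, which is (1 + e) (x)
  (1 + e) - 1. So 1 + e becomes grouplike, and its logarithm sigma is primitive again.\<close>

lemma FJ_Cop_sg: "FJ * Cop sg = (T2 sg 1 + T2 1 sg) * FJ"
proof -
  have ce: "Cop e = T2 e 1 + T2 1 e"
    by (simp add: e_def hom_simps Cop_cincl T2_def ring_distribs)
  have "cincl H * cincl E = cincl E * cincl H + 1 *\<^sub>C cincl E"
    by (rule H_cincl) (simp add: HE scaleC_one)
  then have "cincl H * e = e * cincl H + 1 *\<^sub>C e"
    unfolding e_def scaleC_one fps_X_pull by (simp only: mult.assoc ring_distribs)
  then have "FJ * Cop e = (T2 e (K 1) + T2 1 e) * FJ"
    unfolding ce ring_distribs by (simp add: FJ_E1 FJ_E2 sg_commute)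
  moreover have "T2 e (K 1) + T2 1 e = exp_fps (T2 sg 1 + T2 1 sg) - 1"
  proof -
    have "exp_fps (T2 sg 1 + T2 1 sg) = exp_fps (T2 sg 1) * exp_fps (T2 1 sg)"
      by (rule exp_fps_add) (auto simp: T2_nth_0 T2_mult)
    also have "\<dots> = T2 (K 1) 1 * T2 1 (K 1)"
      by (simp add: T2_def K_def hom_simps scaleC_one)
    also have "\<dots> = 1 + (T2 e (K 1) + T2 1 e)"
      by (simp add: T2_mult K_1 T2_simps ring_distribs)
    finally show ?thesis by simp
  qed
  ultimately have "FJ * ln1p_fps (Cop e) = ln1p_fps (exp_fps (T2 sg 1 + T2 1 sg) - 1) * FJ"
    by (intro ln1p_fps_intertwine) (auto simp: hom_nth_0)
  then show ?thesis
    by (simp add: ln1p_fps_exp T2_nth_0 sg_def[symmetric] fps_hom_ln1p[OF fps_hom_Cop, symmetric])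
qed

lemma FJ_Cop_K: "FJ * Cop (K w) = T2 (K w) (K w) * FJ"
proof -
  have "FJ * exp_fps (w *\<^sub>C Cop sg) = exp_fps (w *\<^sub>C T2 sg 1 + w *\<^sub>C T2 1 sg) * FJ"
    by (rule exp_fps_intertwine)
      (auto simp: hom_nth_0 T2_nth_0 mult_scaleC_left mult_scaleC_right FJ_Cop_sg scaleC_add_right[symmetric])
  also have "exp_fps (w *\<^sub>C T2 sg 1 + w *\<^sub>C T2 1 sg) = exp_fps (w *\<^sub>C T2 sg 1) * exp_fps (w *\<^sub>C T2 1 sg)"
    by (rule exp_fps_add) (auto simp: T2_nth_0 T2_mult mult_scaleC_left mult_scaleC_right scaleC_scaleC mult.commute)
  also have "\<dots> = T2 (K w) (K w)"
    by (simp add: T2_def K_def hom_simps)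
  finally show ?thesis by (simp add: K_def hom_simps)
qed

text \<open>This explains the exponent -1/2 in the extension factors: the grouplike factor
  e^(-sigma/2) (x) e^(-sigma/2) cancels the e^(sigma/2) which the degree 1/2 of \<open>B i\<close>
  puts into the second slot, leaving C (x) 1.\<close>

lemma FJ_Cop_C:
  assumes "i \<in> I" shows "FJ * Cop (C i) = (T2 (C i) 1 + T2 (K (-1/2)) (C i)) * FJ"
proof -
  let ?B = "cincl (B i)" and ?K = "K (-1/2)"
  have "FJ * Cop (C i) = fps_X * ((FJ * Cop ?B) * Cop ?K)"
    unfolding C_def hom_simps by (simp only: mult.assoc fps_X_pull[of FJ])
  also have "\<dots> = fps_X * ((T2 ?B (K (1/2)) + T2 1 ?B) * (FJ * Cop ?K))"
    unfolding FJ_Cop_B[OF assms] by (simp only: mult.assoc)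
  also have "\<dots> = fps_X * ((T2 ?B (K (1/2)) + T2 1 ?B) * T2 ?K ?K) * FJ"
    unfolding FJ_Cop_K by (simp only: mult.assoc)
  also have "fps_X * ((T2 ?B (K (1/2)) + T2 1 ?B) * T2 ?K ?K) = T2 (C i) 1 + T2 ?K (C i)"
  proof -
    have "fps_X * T2 a b = T2 (fps_X * a) b" "fps_X * T2 a b = T2 a (fps_X * b)" for a b :: "'g U fps"
      by (simp_all only: T2_def hom_simps mult.assoc fps_X_pull[of "E1 a"])
    then show ?thesis
      by (simp add: ring_distribs T2_mult K_K K_0 C_def)
  qed
  finally show ?thesis .
qed

text \<open>\<open>W12\<close> and \<open>W23\<close> are the X and Y of the overview, named after
  the slots that they occupy.\<close>

definition W12 :: "'g U3 fps" where "W12 = (\<Sum>i\<in>I. T3 (cincl (A i)) (C i) 1)"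
definition W23 :: "'g U3 fps" where "W23 = (\<Sum>i\<in>I. T3 1 (cincl (A i)) (C i))"
definition Z :: "complex \<Rightarrow> 'g U3 fps" where "Z w = (\<Sum>i\<in>I. T3 (cincl (A i)) (K w) (C i))"

lemma W_nth_0 [simp]: "fps_nth W12 0 = 0" "fps_nth W23 0 = 0" "fps_nth (Z w) 0 = 0"
  unfolding W12_def W23_def Z_def by (auto intro!: sum_nth_0 T3_nth_0)

lemma Z_W12: "Z w * W12 = W12 * Z w"
  unfolding Z_def W12_def by (rule sum_commute) (simp add: T3_mult A_A K_C)

lemma Z_W23: "Z w * W23 = W23 * Z w"
  unfolding Z_def W23_def by (rule sum_commute) (simp add: T3_mult K_A C_C)

lemma Z_Z: "Z v * Z w = Z w * Z v"
  unfolding Z_def by (rule sum_commute) (simp add: T3_mult K_K A_A C_C add.commute)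

text \<open>The two products differ only in the middle slot, by commutators of \<open>C i\<close>
  with \<open>A j\<close>. These vanish unless i = j, and \<open>C_A\<close> evaluates the diagonal
  ones.\<close>

lemma W12_W23: "W12 * W23 = W23 * W12 + (Z (-1/2) - Z (1/2))"
proof -
  have "W12 * W23 = (\<Sum>i\<in>I. \<Sum>j\<in>I. T3 (cincl (A i)) (C i * cincl (A j)) (C j))"
    by (simp add: W12_def W23_def sum_product T3_mult)
  also have "\<dots> = (\<Sum>i\<in>I. \<Sum>j\<in>I. T3 (cincl (A i)) (cincl (A j) * C i) (C j)
      + (if i = j then T3 (cincl (A i)) (K (-1/2)) (C i) - T3 (cincl (A i)) (K (1/2)) (C i) else 0))"
    by (intro sum.cong HOL.refl) (simp add: C_A T3_simps)
  also have "\<dots> = (\<Sum>i\<in>I. \<Sum>j\<in>I. T3 (cincl (A i)) (cincl (A j) * C i) (C j)) + (Z (-1/2) - Z (1/2))"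
    by (simp add: sum.distrib finite_I Z_def sum_subtractf)
  also have "(\<Sum>i\<in>I. \<Sum>j\<in>I. T3 (cincl (A i)) (cincl (A j) * C i) (C j)) = W23 * W12"
    unfolding W12_def W23_def sum_product by (subst sum.swap) (simp add: T3_mult)
  finally show ?thesis .
qed

lemma I12_FE: "I12 FE = exp_fps W12"
  by (simp add: FE_def W12_def hom_simps T2_slots)

lemma I23_FE: "I23 FE = exp_fps W23"
  by (simp add: FE_def W23_def hom_simps T2_slots)

text \<open>The coproduct of the first leg concerns \<open>A i\<close> alone, and \<open>C i\<close>
  in slot 3 commutes with everything in slots 1 and 2; \<open>FJ_Cop_A\<close> then yields one term
  of \<open>Z (1/2)\<close> and one of \<open>W23\<close>.\<close>

lemma I12_FJ_D12_FE: "I12 FJ * D12 FE = exp_fps (Z (1/2) + W23) * I12 FJ"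
proof -
  have t: "I12 FJ * D12 (T2 (cincl (A i)) (C i))
      = (T3 (cincl (A i)) (K (1/2)) (C i) + T3 1 (cincl (A i)) (C i)) * I12 FJ" if "i \<in> I" for i
  proof -
    have "I12 FJ * D12 (T2 (cincl (A i)) (C i)) = I12 (FJ * Cop (cincl (A i))) * T3 1 1 (C i)"
      by (simp add: T2_slots hom_simps mult.assoc)
    also have "\<dots> = I12 (T2 (cincl (A i)) (K (1/2)) + T2 1 (cincl (A i))) * T3 1 1 (C i) * I12 FJ"
      by (simp only: FJ_Cop_A[OF that] fps_hom_mult[OF fps_hom_I12] mult.assoc I12_T3_commute[of FJ])
    also have "I12 (T2 (cincl (A i)) (K (1/2)) + T2 1 (cincl (A i))) * T3 1 1 (C i)
        = T3 (cincl (A i)) (K (1/2)) (C i) + T3 1 (cincl (A i)) (C i)"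
      by (simp add: hom_simps T2_slots ring_distribs T3_mult)
    finally show ?thesis .
  qed
  have "I12 FJ * D12 (\<Sum>i\<in>I. T2 (cincl (A i)) (C i)) = (Z (1/2) + W23) * I12 FJ"
    by (simp add: hom_simps Z_def W23_def sum.distrib[symmetric] sum_distrib_left sum_distrib_right t)
  then show ?thesis
    unfolding FE_def fps_hom_exp[OF fps_hom_D12]
    by (intro exp_fps_intertwine) (auto intro!: hom_nth_0 sum_nth_0 T2_nth_0)
qed

text \<open>Here the coproduct falls on \<open>C i\<close>, whose second term carries e^(-sigma/2)
  in what is now the middle slot; hence \<open>Z (-1/2)\<close>.\<close>

lemma I23_FJ_D23_FE: "I23 FJ * D23 FE = exp_fps (W12 + Z (-1/2)) * I23 FJ"
proof -
  have t: "I23 FJ * D23 (T2 (cincl (A i)) (C i))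
      = (T3 (cincl (A i)) (C i) 1 + T3 (cincl (A i)) (K (-1/2)) (C i)) * I23 FJ" if "i \<in> I" for i
  proof -
    have "I23 FJ * D23 (T2 (cincl (A i)) (C i)) = T3 (cincl (A i)) 1 1 * I23 (FJ * Cop (C i))"
      by (simp only: T2_slots fps_hom_mult[OF fps_hom_I23] mult.assoc[symmetric] I23_T3_commute)
    also have "\<dots> = T3 (cincl (A i)) 1 1 * I23 (T2 (C i) 1 + T2 (K (-1/2)) (C i)) * I23 FJ"
      unfolding FJ_Cop_C[OF that] fps_hom_mult[OF fps_hom_I23] by (simp only: mult.assoc)
    also have "T3 (cincl (A i)) 1 1 * I23 (T2 (C i) 1 + T2 (K (-1/2)) (C i))
        = T3 (cincl (A i)) (C i) 1 + T3 (cincl (A i)) (K (-1/2)) (C i)"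
      by (simp add: hom_simps T2_slots ring_distribs T3_mult)
    finally show ?thesis .
  qed
  have "I23 FJ * D23 (\<Sum>i\<in>I. T2 (cincl (A i)) (C i)) = (W12 + Z (-1/2)) * I23 FJ"
    unfolding fps_hom_sum[OF fps_hom_D23] Z_def W12_def sum.distrib[symmetric] sum_distrib_left sum_distrib_right
    by (rule sum.cong[OF HOL.refl]) (rule t)
  then show ?thesis
    unfolding FE_def fps_hom_exp[OF fps_hom_D23]
    by (intro exp_fps_intertwine) (auto intro!: hom_nth_0 sum_nth_0 T2_nth_0)
qed

text \<open>Both sides equal e^J12 e^J13 e^J23 with Jab having H in slot a and sigma in slot b. On
  the left H is primitive; on the right sigma is so after conjugation by F_J, and J12 commutes with
  J13.\<close>

lemma jordanian_twist: "I12 FJ * D12 FJ = I23 FJ * D23 FJ"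
proof -
  let ?J12 = "T3 (cincl H) sg 1" and ?J13 = "T3 (cincl H) 1 sg" and ?J23 = "T3 1 (cincl H) sg"
  have "D12 FJ = exp_fps (?J13 + ?J23)"
    by (simp add: FJ_def hom_simps T2_slots Cop_cincl_T2 ring_distribs T3_mult)
  also have "\<dots> = exp_fps ?J13 * exp_fps ?J23"
    by (rule exp_fps_add) (auto simp: T3_nth_0 T3_mult)
  finally have "I12 FJ * D12 FJ = exp_fps ?J12 * exp_fps ?J13 * exp_fps ?J23"
    by (simp add: FJ_def hom_simps T2_slots mult.assoc)
  also have "exp_fps ?J12 * exp_fps ?J13 = exp_fps (?J12 + ?J13)"
    by (rule exp_fps_add[symmetric]) (auto simp: T3_nth_0 T3_mult)
  also have "exp_fps (?J12 + ?J13) * exp_fps ?J23 = I23 FJ * D23 FJ"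
  proof -
    have "I23 FJ * D23 (T2 (cincl H) sg) = T3 (cincl H) 1 1 * I23 (FJ * Cop sg)"
      by (simp only: T2_slots fps_hom_mult[OF fps_hom_I23] mult.assoc[symmetric] I23_T3_commute)
    also have "\<dots> = T3 (cincl H) 1 1 * I23 (T2 sg 1 + T2 1 sg) * I23 FJ"
      unfolding FJ_Cop_sg fps_hom_mult[OF fps_hom_I23] by (simp only: mult.assoc)
    also have "T3 (cincl H) 1 1 * I23 (T2 sg 1 + T2 1 sg) = ?J12 + ?J13"
      by (simp add: hom_simps T2_slots ring_distribs T3_mult)
    finally have "I23 FJ * exp_fps (D23 (T2 (cincl H) sg)) = exp_fps (?J12 + ?J13) * I23 FJ"
      by (intro exp_fps_intertwine[rotated 2]) (simp_all add: hom_nth_0 T2_nth_0 T3_nth_0)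
    moreover have "I23 FJ = exp_fps ?J23"
      by (simp add: FJ_def hom_simps T2_slots)
    moreover have "exp_fps (D23 (T2 (cincl H) sg)) = D23 FJ"
      by (simp add: FJ_def hom_simps)
    ultimately show ?thesis by simp
  qed
  finally show ?thesis .
qed

lemma twist_equation: "I12 (FE * FJ) * D12 (FE * FJ) = I23 (FE * FJ) * D23 (FE * FJ)"
proof -
  have W: "(Z (-1/2) - Z (1/2)) * W12 = W12 * (Z (-1/2) - Z (1/2))"
    "(Z (-1/2) - Z (1/2)) * W23 = W23 * (Z (-1/2) - Z (1/2))"
    by (simp_all add: ring_distribs Z_W12 Z_W23)
  have "exp_fps W12 * exp_fps (Z (1/2) + W23) = exp_fps W12 * exp_fps (Z (1/2)) * exp_fps W23"
    by (simp add: exp_fps_add Z_W23 mult.assoc)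
  also have "exp_fps W12 * exp_fps (Z (1/2)) = exp_fps (Z (1/2)) * exp_fps W12"
    by (intro exp_fps_commute exp_fps_commute[symmetric]) (auto simp: Z_W12)
  also have "exp_fps (Z (1/2)) * exp_fps W12 * exp_fps W23
      = exp_fps (Z (1/2)) * exp_fps W23 * exp_fps W12 * exp_fps (Z (-1/2) - Z (1/2))"
    using exp_fps_Heisenberg[OF _ _ _ W12_W23 W] by (simp add: mult.assoc)
  also have "exp_fps (Z (1/2)) * exp_fps W23 = exp_fps W23 * exp_fps (Z (1/2))"
    by (intro exp_fps_commute exp_fps_commute[symmetric]) (auto simp: Z_W23)
  also have "exp_fps W23 * exp_fps (Z (1/2)) * exp_fps W12 = exp_fps W23 * exp_fps W12 * exp_fps (Z (1/2))"
    unfolding mult.assoc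
    by (rule arg_cong[of _ _ "(*) _"]) (intro exp_fps_commute exp_fps_commute[symmetric], auto simp: Z_W12)
  \<comment> \<open>The factor e^(Z (1/2)) has been carried unchanged to the right end, where it
    cancels against the commutator and leaves \<open>Z (-1/2)\<close>.\<close>
  also have "\<dots> * exp_fps (Z (-1/2) - Z (1/2)) = exp_fps W23 * exp_fps W12 * exp_fps (Z (-1/2))"
    using exp_fps_add[of "Z (1/2)" "Z (-1/2) - Z (1/2)"]
    by (simp add: mult.assoc ring_distribs Z_Z)
  also have "\<dots> = exp_fps W23 * exp_fps (W12 + Z (-1/2))"
    by (simp add: exp_fps_add Z_W12 mult.assoc)
  finally have key: "exp_fps W12 * exp_fps (Z (1/2) + W23) = exp_fps W23 * exp_fps (W12 + Z (-1/2))" .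
  have "I12 (FE * FJ) * D12 (FE * FJ) = I12 FE * (I12 FJ * D12 FE) * D12 FJ"
    by (simp only: hom_simps mult.assoc)
  also have "\<dots> = (exp_fps W12 * exp_fps (Z (1/2) + W23)) * (I12 FJ * D12 FJ)"
    unfolding I12_FJ_D12_FE I12_FE by (simp only: mult.assoc)
  also have "\<dots> = (exp_fps W23 * exp_fps (W12 + Z (-1/2))) * (I23 FJ * D23 FJ)"
    unfolding key jordanian_twist ..
  also have "\<dots> = I23 FE * (I23 FJ * D23 FE) * D23 FJ"
    unfolding I23_FJ_D23_FE I23_FE by (simp only: mult.assoc)
  also have "\<dots> = I23 (FE * FJ) * D23 (FE * FJ)"
    by (simp only: hom_simps mult.assoc)
  finally show ?thesis .
qed

theorem twisting_element_link: "twisting_element (FE * FJ)"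
proof -
  \<comment> \<open>In the second leg the exponents die because the counit kills e, hence sigma, and
    \<open>B i\<close>; in the first leg because it kills \<open>H\<close> and
    \<open>A i\<close>.\<close>
  have "counit2 (E2 e) = 0" by (simp add: e_def hom_simps counit_simps)
  then have sg: "counit2 (E2 sg) = 0" by (simp add: sg_def hom_simps)
  have "counit1 (FE * FJ) = 1"
    by (simp add: FE_def FJ_def T2_def hom_simps counit_simps)
  moreover have "counit2 (FE * FJ) = 1"
    by (simp add: FE_def FJ_def T2_def hom_simps counit_simps C_def sg)
  moreover have "\<exists>G. (FE * FJ) * G = 1 \<and> G * (FE * FJ) = 1"
  proof -
    let ?e = "\<Sum>i\<in>I. T2 (cincl (A i)) (C i)" and ?j = "T2 (cincl H) sg"
    have e: "exp_fps ?e * exp_fps (- ?e) = 1" "exp_fps (- ?e) * exp_fps ?e = 1"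
      and j: "exp_fps ?j * exp_fps (- ?j) = 1" "exp_fps (- ?j) * exp_fps ?j = 1"
      by (intro exp_fps_minus_mult; auto intro!: sum_nth_0 T2_nth_0)+
    show ?thesis
      unfolding FE_def FJ_def
      by (rule inverse_mult_ex[OF e j])
  qed
  ultimately show ?thesis
    unfolding twisting_element_iff using twist_equation by blast
qed

end

section \<open>Products of twists\<close>

text \<open>\<open>c12\<close> and \<open>c23\<close> say that conjugation by \<open>F\<close> does
  not affect the coproducts inside \<open>G\<close>, so \<open>G\<close> solves the twist equation
  also for the coproduct twisted by \<open>F\<close>. Exchanging the inner factors separates the two
  twist equations.\<close>

lemma twisting_element_mult:
  assumes G: "twisting_element G" and F: "twisting_element F"
    and c12: "I12 F * D12 G = D12 G * I12 F" and c23: "I23 F * D23 G = D23 G * I23 F"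
  shows "twisting_element (G * F)"
proof -
  have "I12 (G * F) * D12 (G * F) = I12 G * (I12 F * D12 G) * D12 F"
    by (simp only: hom_simps mult.assoc)
  also have "\<dots> = (I12 G * D12 G) * (I12 F * D12 F)"
    unfolding c12 by (simp only: mult.assoc)
  also have "\<dots> = (I23 G * D23 G) * (I23 F * D23 F)"
    using G F by (simp add: twisting_element_iff)
  also have "\<dots> = I23 G * (I23 F * D23 G) * D23 F"
    unfolding c23 by (simp only: mult.assoc)
  also have "\<dots> = I23 (G * F) * D23 (G * F)"
    by (simp only: hom_simps mult.assoc)
  finally have tw: "I12 (G * F) * D12 (G * F) = I23 (G * F) * D23 (G * F)" .
  obtain G' F' where "G * G' = 1" "G' * G = 1" "F * F' = 1" "F' * F = 1"
    using G F by (auto simp: twisting_element_iff)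
  then have "\<exists>J. G * F * J = 1 \<and> J * (G * F) = 1" by (rule inverse_mult_ex)
  with tw G F show ?thesis by (simp add: twisting_element_iff hom_simps)
qed

lemma mult_commute_mult:
  "x * y = y * x \<Longrightarrow> x * z = z * x \<Longrightarrow> x * (y * z) = y * z * (x :: 'a::semigroup_mult)"
  by (metis mult.assoc)

lemma mult_commute_sum:
  "(\<And>i. i \<in> I \<Longrightarrow> x * f i = f i * x) \<Longrightarrow> x * sum f I = sum f I * (x :: 'a::ring)"
  by (simp add: sum_distrib_left sum_distrib_right)

section \<open>Commutation of a link with coproducts\<close>

context extended_jordanian
begin

text \<open>\<open>inv\<close> concerns the canonical element built from \<open>A i\<close> and
  \<open>B i\<close>, without sigma. This suffices: x commutes with E, hence with all series in E,
  and passing from \<open>B i\<close> to \<open>C i\<close> only multiplies the second slot by xi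
  e^(-sigma/2).\<close>

lemma commute_coproduct_link:
  assumes "bracket x H = 0" "bracket x E = 0"
    and inv: "(\<Sum>i\<in>I. T2 (cincl (bracket x (A i))) (cincl (B i))
                    + T2 (cincl (A i)) (cincl (bracket x (B i)))) = 0"
  shows "Cop (cincl x) * (FE * FJ) = FE * FJ * Cop (cincl x)"
proof -
  let ?x = "cincl x"
  have xE: "?x * e = e * ?x" and xH: "?x * cincl H = cincl H * ?x"
    using assms(1,2) cincl_commute[of x] unfolding e_def fps_X_pull by (simp_all only: mult.assoc)
  have xsg: "sg * ?x = ?x * sg" by (rule sg_commute[OF xE[symmetric]])
  have "Cop ?x * T2 (cincl H) sg = T2 (cincl H) sg * Cop ?x"
    by (simp add: Cop_cincl_T2 ring_distribs T2_mult xH xsg)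
  then have J: "Cop ?x * FJ = FJ * Cop ?x"
    unfolding FJ_def by (intro exp_fps_commute T2_nth_0) auto
  have xK: "?x * K w = K w * ?x" for w using K_commute[OF xsg] by simp
  \<comment> \<open>The error term has a right factor that is the same for all \<open>i\<close>, so
    that summation makes \<open>inv\<close> applicable.\<close>
  have t: "Cop ?x * T2 (cincl (A i)) (C i) = T2 (cincl (A i)) (C i) * Cop ?x
      + (T2 (cincl (bracket x (A i))) (cincl (B i)) + T2 (cincl (A i)) (cincl (bracket x (B i))))
        * T2 1 (fps_X * K (-1/2))" for i
  proof -
    let ?a = "cincl (A i)" and ?b = "cincl (B i)" and ?K = "K (-1/2)"
    have a: "?x * ?a = ?a * ?x + cincl (bracket x (A i))" by (rule cincl_bracket)
    have "?x * C i = fps_X * ((?x * ?b) * ?K)"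
      by (simp only: C_def fps_X_pull[of ?x] mult.assoc)
    also have "\<dots> = C i * ?x + fps_X * (cincl (bracket x (B i)) * ?K)"
      unfolding cincl_bracket[of x "B i"] by (simp add: C_def ring_distribs mult.assoc xK)
    finally have b: "?x * C i = C i * ?x + fps_X * (cincl (bracket x (B i)) * ?K)" .
    show ?thesis
      unfolding Cop_cincl_T2
      by (simp add: ring_distribs T2_mult T2_simps a b fps_X_pull[of ?b] fps_X_pull[of "cincl (bracket x (B i))"])
        (simp add: C_def xK)
  qed
  have "Cop ?x * (\<Sum>i\<in>I. T2 (cincl (A i)) (C i)) = (\<Sum>i\<in>I. T2 (cincl (A i)) (C i)) * Cop ?x"
    unfolding sum_distrib_left t sum.distrib
    by (simp add: sum_distrib_right[symmetric] inv)
  then have "Cop ?x * FE = FE * Cop ?x"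
    unfolding FE_def by (intro exp_fps_commute sum_nth_0 T2_nth_0) auto
  then show ?thesis using J by (rule mult_commute_mult)
qed

text \<open>An element commuting with the coproducts of the generators commutes with those of all
  series built from them. The statement for slots 12 involves the first legs \<open>H\<close> and
  \<open>A i\<close>; the one for slots 23 the second legs sigma and \<open>C i\<close>, made from
  \<open>E\<close> and \<open>B i\<close>.\<close>

lemma commute_slots_link:
  assumes "P * Cop (cincl H) = Cop (cincl H) * P" "P * Cop (cincl E) = Cop (cincl E) * P"
    and "\<And>i. i \<in> I \<Longrightarrow> P * Cop (cincl (A i)) = Cop (cincl (A i)) * P"
    and "\<And>i. i \<in> I \<Longrightarrow> P * Cop (cincl (B i)) = Cop (cincl (B i)) * P"
  shows "I12 P * D12 (FE * FJ) = D12 (FE * FJ) * I12 P"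
    and "I23 P * D23 (FE * FJ) = D23 (FE * FJ) * I23 P"
proof -
  have 12: "I12 P * D12 (T2 a b) = D12 (T2 a b) * I12 P" if "P * Cop a = Cop a * P" for a b
    unfolding T2_slots
    by (intro mult_commute_mult I12_T3_commute) (simp only: fps_hom_mult[OF fps_hom_I12, symmetric] that)
  have 23: "I23 P * D23 (T2 a b) = D23 (T2 a b) * I23 P" if "P * Cop b = Cop b * P" for a b
    unfolding T2_slots
    by (intro mult_commute_mult I23_T3_commute) (simp only: fps_hom_mult[OF fps_hom_I23, symmetric] that)
  have e: "P * Cop e = Cop e * P"
    unfolding e_def hom_simps using assms(2) by (intro mult_commute_mult fps_X_commute)
  have sg: "P * Cop sg = Cop sg * P"
    unfolding sg_def hom_simps using e by (intro ln1p_fps_intertwine) (auto simp: hom_nth_0)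
  have "P * Cop (K w) = Cop (K w) * P" for w
    unfolding K_def hom_simps using sg
    by (intro exp_fps_commute) (auto simp: hom_nth_0 mult_scaleC_left mult_scaleC_right)
  then have C: "P * Cop (C i) = Cop (C i) * P" if "i \<in> I" for i
    unfolding C_def hom_simps using assms(4)[OF that] by (intro mult_commute_mult fps_X_commute)
  show "I12 P * D12 (FE * FJ) = D12 (FE * FJ) * I12 P"
    unfolding fps_hom_mult[OF fps_hom_D12] FE_def FJ_def fps_hom_exp[OF fps_hom_D12] fps_hom_sum[OF fps_hom_D12]
    by (intro mult_commute_mult exp_fps_commute mult_commute_sum 12 assms)
      (auto intro!: sum_nth_0 hom_nth_0 T2_nth_0)
  show "I23 P * D23 (FE * FJ) = D23 (FE * FJ) * I23 P"
    unfolding fps_hom_mult[OF fps_hom_D23] FE_def FJ_def fps_hom_exp[OF fps_hom_D23] fps_hom_sum[OF fps_hom_D23]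
    by (intro mult_commute_mult exp_fps_commute mult_commute_sum 23 C sg)
      (auto intro!: sum_nth_0 hom_nth_0 T2_nth_0)
qed

lemma extension_factors_commute:
  assumes "i \<in> I" "j \<in> I"
  shows "exp_fps (T2 (cincl (A i)) (C i)) * exp_fps (T2 (cincl (A j)) (C j))
    = exp_fps (T2 (cincl (A j)) (C j)) * exp_fps (T2 (cincl (A i)) (C i))"
  by (intro exp_fps_commute exp_fps_commute[symmetric] T2_nth_0) (use assms in \<open>auto simp: T2_mult A_A C_C\<close>)

lemma FE_eq_prod_list:
  assumes "distinct xs" "set xs = I"
  shows "prod_list (map (\<lambda>i. exp_fps (T2 (cincl (A i)) (C i))) xs) = FE"
  unfolding FE_def by (rule exp_fps_sum) (use assms finite_I in \<open>auto simp: T2_mult A_A C_C T2_nth_0\<close>)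

end

section \<open>Links indexed by roots, and their chains\<close>

definition extended_jordanian_link ::
  "series \<Rightarrow> nat \<Rightarrow> (weight \<Rightarrow> 'g::lie_algebra) \<Rightarrow> (weight \<Rightarrow> 'g) \<Rightarrow> nat \<Rightarrow> bool" where
  "extended_jordanian_link T N H L k \<longleftrightarrow> extended_jordanian (H (init_root T k)) (L (init_root T k)) L
     (\<lambda>\<alpha>. L (init_root T k - \<alpha>)) (constituent' T N k)"

lemma extension_factor_eq:
  assumes "extended_jordanian_link T N H L k"
  shows "extension_factor L (init_root T k) \<alpha>
    = exp_fps (T2 (cincl (L \<alpha>)) (extended_jordanian.C (L (init_root T k)) (\<lambda>\<alpha>. L (init_root T k - \<alpha>)) \<alpha>))"
proof -
  interpret extended_jordanian "H (init_root T k)" "L (init_root T k)" L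
    "\<lambda>\<alpha>. L (init_root T k - \<alpha>)" "constituent' T N k" by (rule assms[unfolded extended_jordanian_link_def])
  have "fps_X * (E1 a * E2 b) = T2 a (fps_X * b)" for a b :: "'a U fps"
    by (simp only: T2_def hom_simps fps_X_pull)
  then show ?thesis
    unfolding extension_factor_def fps_map_tens_eq sigma_def C_def K_def sg_def e_def by (simp add: cincl_def)
qed

lemma twist_link_eq:
  assumes "extended_jordanian_link T N H L k" "distinct (ls k)" "set (ls k) = constituent' T N k"
  shows "twist_link T H L ls k
    = extended_jordanian.FE (L (init_root T k)) L (\<lambda>\<alpha>. L (init_root T k - \<alpha>)) (constituent' T N k)
      * extended_jordanian.FJ (H (init_root T k)) (L (init_root T k))"
proof -
  interpret extended_jordanian "H (init_root T k)" "L (init_root T k)" L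
    "\<lambda>\<alpha>. L (init_root T k - \<alpha>)" "constituent' T N k" by (rule assms(1)[unfolded extended_jordanian_link_def])
  have "jordanian_factor H L (init_root T k) = FJ"
    unfolding jordanian_factor_def fps_map_tens_eq sigma_def FJ_def sg_def e_def T2_def by (simp add: cincl_def)
  moreover have "extension_factor L (init_root T k) = (\<lambda>\<alpha>. exp_fps (T2 (cincl (L \<alpha>)) (C \<alpha>)))"
    using extension_factor_eq[OF assms(1)] by blast
  ultimately show ?thesis
    unfolding twist_link_def using FE_eq_prod_list[OF assms(2,3)] by simp
qed

definition link_generators ::
  "series \<Rightarrow> nat \<Rightarrow> (weight \<Rightarrow> 'g) \<Rightarrow> (weight \<Rightarrow> 'g) \<Rightarrow> nat \<Rightarrow> 'g set" where
  "link_generators T N H L k = {H (init_root T k), L (init_root T k)} \<union> L ` constituent T N k"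

text \<open>All facts about roots enter through \<open>inv\<close>. They make each earlier link, and
  so the earlier chain, commute with the coproducts of the generators of link \<open>k\<close>;
  \<open>commute_slots_link\<close> converts this into the exchange conditions of
  \<open>twisting_element_mult\<close>.\<close>

lemma twisting_element_chain:
  assumes link: "\<And>k. k \<le> p \<Longrightarrow> extended_jordanian_link T N H L k"
    and ls: "\<And>k. k \<le> p \<Longrightarrow> distinct (ls k) \<and> set (ls k) = constituent' T N k"
    and inv: "\<And>j k x. j < k \<Longrightarrow> k \<le> p \<Longrightarrow> x \<in> link_generators T N H L k \<Longrightarrow>
        bracket x (H (init_root T j)) = 0 \<and> bracket x (L (init_root T j)) = 0
      \<and> (\<Sum>\<alpha>\<in>constituent' T N j. T2 (cincl (bracket x (L \<alpha>))) (cincl (L (init_root T j - \<alpha>)))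
          + T2 (cincl (L \<alpha>)) (cincl (bracket x (L (init_root T j - \<alpha>))))) = 0"
  shows "k \<le> p \<Longrightarrow> twisting_element (twist_chain T H L ls k)"
proof -
  note ej = link[unfolded extended_jordanian_link_def]
  have comm: "Cop (cincl x) * twist_link T H L ls j = twist_link T H L ls j * Cop (cincl x)"
    if "j < k" "k \<le> p" "x \<in> link_generators T N H L k" for j k x
    using extended_jordanian.commute_coproduct_link[OF ej[of j], of x] inv[OF that] that ls[of j]
    by (simp add: twist_link_eq[where N=N] link)
  have tw: "twisting_element (twist_link T H L ls k)" if "k \<le> p" for k
    using extended_jordanian.twisting_element_link[OF ej[OF that]] ls[OF that] that
    by (simp add: twist_link_eq[where N=N] link)
  have step: "twist_chain T H L ls (Suc k) = twist_link T H L ls (Suc k) * twist_chain T H L ls k" for k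
    by (simp add: twist_chain_def)
  \<comment> \<open>The link \<open>k\<close> that contains x stays fixed while the chain grows,
    hence an induction on \<open>j\<close> alone.\<close>
  have comm': "twist_chain T H L ls j * Cop (cincl x) = Cop (cincl x) * twist_chain T H L ls j"
    if "j < k" "k \<le> p" "x \<in> link_generators T N H L k" for j k x
    using that(1)
  proof (induction j)
    case 0
    then show ?case using comm[OF 0 that(2,3)] by (simp add: twist_chain_def)
  next
    case (Suc j)
    then show ?case unfolding step
      using comm[OF Suc.prems that(2,3)] by (intro mult_commute_mult[symmetric]) auto
  qed
  show "k \<le> p \<Longrightarrow> twisting_element (twist_chain T H L ls k)"
  proof (induction k)
    case 0
    then show ?case using tw[of 0] by (simp add: twist_chain_def)
  next
    case (Suc k)
    have g: "twist_chain T H L ls k * Cop (cincl x) = Cop (cincl x) * twist_chain T H L ls k"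
      if "x \<in> link_generators T N H L (Suc k)" for x
      using comm'[OF _ Suc.prems that] by simp
    note l = twist_link_eq[where ls=ls, OF link[OF Suc.prems] conjunct1[OF ls[OF Suc.prems]]
      conjunct2[OF ls[OF Suc.prems]]]
    note c = extended_jordanian.commute_slots_link[OF ej[OF Suc.prems],
      of "twist_chain T H L ls k", OF g g g g]
    show ?case unfolding step
    proof (rule twisting_element_mult[OF tw[OF Suc.prems] Suc.IH])
      show "I12 (twist_chain T H L ls k) * D12 (twist_link T H L ls (Suc k))
          = D12 (twist_link T H L ls (Suc k)) * I12 (twist_chain T H L ls k)"
        unfolding l by (rule c(1)) (auto simp: link_generators_def constituent_def)
      show "I23 (twist_chain T H L ls k) * D23 (twist_link T H L ls (Suc k))
          = D23 (twist_link T H L ls (Suc k)) * I23 (twist_chain T H L ls k)"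
        unfolding l by (rule c(2)) (auto simp: link_generators_def constituent_def)
    qed (use Suc.prems in simp)
  qed
qed

section \<open>Weights of the defining representation\<close>

definition wprod :: "nat \<Rightarrow> weight \<Rightarrow> weight \<Rightarrow> int" where
  "wprod N \<alpha> \<beta> = (\<Sum>c=1..N. \<alpha> c * \<beta> c)"

fun mat_dim :: "series \<Rightarrow> nat \<Rightarrow> nat" where
  "mat_dim SL N = N"
| "mat_dim SO_even N = 2 * N"
| "mat_dim SO_odd N = 2 * N + 1"

text \<open>The weight of the i-th standard basis vector; the matrix entry (i, j) has the difference
  of the weights of i and j. Rows count from 0 but weights from 1: row 0 carries e_1 and, for so,
  the last row -e_1. Among valid rows only the middle one of \<open>SO_odd\<close> takes the value
  0.\<close>

definition mat_wt :: "series \<Rightarrow> nat \<Rightarrow> nat \<Rightarrow> weight" where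
  "mat_wt T N i = (if i < N then ebasis (i + 1)
     else if mat_dim T N - Suc i < N then - ebasis (mat_dim T N - i) else 0)"

text \<open>The weights of the dual of the defining representation. Every root is u + s with -u and
  s in this set.\<close>

definition sgn_basis :: "series \<Rightarrow> nat \<Rightarrow> weight set" where
  "sgn_basis T N = {s. (\<exists>b\<in>{1..N}. s = - ebasis b) \<or> (T \<noteq> SL \<and> (\<exists>b\<in>{1..N}. s = ebasis b))
     \<or> (T = SO_odd \<and> s = 0)}"

text \<open>On traceless diagonal matrices e_1 + ... + e_N vanishes, so for sl the values on the
  Cartan subalgebra fix a weight only up to multiples of that sum; sum zero removes the ambiguity.
  It also makes every admissible vector the diagonal of a Cartan element.\<close>

definition admissible :: "series \<Rightarrow> nat \<Rightarrow> weight \<Rightarrow> bool" where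
  "admissible T N v \<longleftrightarrow> (\<forall>c. c \<notin> {1..N} \<longrightarrow> v c = 0) \<and> (T = SL \<longrightarrow> (\<Sum>c=1..N. v c) = 0)"

lemma admissible_add: "admissible T N v \<Longrightarrow> admissible T N w \<Longrightarrow> admissible T N (v + w)"
  by (auto simp: admissible_def sum.distrib)

lemma admissible_diff: "admissible T N v \<Longrightarrow> admissible T N w \<Longrightarrow> admissible T N (v - w)"
  by (auto simp: admissible_def sum_subtractf)

lemma ebasis_nth: "ebasis b c = (if c = b then 1 else 0)"
  by (simp add: ebasis_def)

lemma wprod_simps:
  "wprod N (\<alpha> + \<beta>) \<gamma> = wprod N \<alpha> \<gamma> + wprod N \<beta> \<gamma>" "wprod N (\<alpha> - \<beta>) \<gamma> = wprod N \<alpha> \<gamma> - wprod N \<beta> \<gamma>"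
  "wprod N (- \<alpha>) \<gamma> = - wprod N \<alpha> \<gamma>" "wprod N 0 \<gamma> = 0"
  "wprod N \<gamma> (\<alpha> + \<beta>) = wprod N \<gamma> \<alpha> + wprod N \<gamma> \<beta>" "wprod N \<gamma> (\<alpha> - \<beta>) = wprod N \<gamma> \<alpha> - wprod N \<gamma> \<beta>"
  "wprod N \<gamma> (- \<alpha>) = - wprod N \<gamma> \<alpha>" "wprod N \<gamma> 0 = 0"
  by (simp_all add: wprod_def sum.distrib sum_subtractf sum_negf algebra_simps)

lemma wprod_ebasis: "wprod N (ebasis b) v = (if b \<in> {1..N} then v b else 0)"
proof -
  have "wprod N (ebasis b) v = (\<Sum>c=1..N. if c = b then v c else 0)"
    unfolding wprod_def by (rule sum.cong) (auto simp: ebasis_def)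
  then show ?thesis by simp
qed

lemma wprod_self_eq_0:
  assumes "admissible T N v" "wprod N v v = 0" shows "v = 0"
proof
  fix c
  have "\<forall>c\<in>{1..N}. v c * v c = 0"
    using assms(2) unfolding wprod_def by (subst sum_nonneg_eq_0_iff[symmetric]) auto
  then show "v c = 0 c" using assms(1) by (cases "c \<in> {1..N}") (auto simp: admissible_def)
qed

lemma ebasis_admissible: "T \<noteq> SL \<Longrightarrow> b \<in> {1..N} \<Longrightarrow> admissible T N (ebasis b)"
  "b \<in> {1..N} \<Longrightarrow> c \<in> {1..N} \<Longrightarrow> admissible T N (ebasis b - ebasis c)"
  by (auto simp: admissible_def ebasis_def sum_subtractf)

lemma mat_wt_sgn_basis:
  assumes "i < mat_dim T N" shows "- mat_wt T N i \<in> sgn_basis T N"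
proof (cases "i < N")
  case True
  then show ?thesis by (auto simp: mat_wt_def sgn_basis_def)
next
  case False
  then have "mat_dim T N - i \<in> {1..N} \<and> T \<noteq> SL" if "mat_dim T N - Suc i < N"
    using that assms by (cases T) auto
  then show ?thesis using False assms by (cases T) (auto simp: mat_wt_def sgn_basis_def)
qed

lemma mat_wt_admissible:
  assumes "i < mat_dim T N" "j < mat_dim T N" shows "admissible T N (mat_wt T N i - mat_wt T N j)"
proof (cases "T = SL")
  case True
  then show ?thesis using assms ebasis_admissible(2)[of "i+1" N "j+1" T] by (simp add: mat_wt_def)
next
  case False
  have "admissible T N (mat_wt T N i)" if "i < mat_dim T N" for i
    using False that by (cases T) (auto simp: mat_wt_def admissible_def ebasis_def)
  then show ?thesis using assms admissible_diff by blast
qed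

lemma mat_wt_cases [consumes 1, case_names pos neg zero]:
  assumes "i < mat_dim T N"
  obtains (pos) "i < N" "mat_wt T N i = ebasis (i + 1)"
  | (neg) i' where "T \<noteq> SL" "2 * N \<le> mat_dim T N" "i' < N" "i = mat_dim T N - Suc i'" "mat_wt T N i = - ebasis (i' + 1)"
  | (zero) "T = SO_odd" "mat_dim T N = 2 * N + 1" "i = N" "mat_wt T N i = 0"
proof (cases "i < N")
  case True
  then show thesis by (intro pos) (simp_all add: mat_wt_def)
next
  case False
  show thesis
  proof (cases "mat_dim T N - Suc i < N")
    case True
    have "T \<noteq> SL" "2 * N \<le> mat_dim T N" using False assms by (cases T; simp)+
    moreover have "Suc (mat_dim T N - Suc i) = mat_dim T N - i" using assms by simp
    ultimately show thesis using True False assms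
      by (intro neg[of "mat_dim T N - Suc i"]) (simp_all add: mat_wt_def)
  next
    case False
    with \<open>\<not> i < N\<close> show thesis
      using assms by (intro zero; cases T) (simp_all add: mat_wt_def)
  qed
qed

lemma wprod_mat_wt:
  assumes i: "i < mat_dim T N" and j: "j < mat_dim T N"
  shows "wprod N (mat_wt T N i) (mat_wt T N j) =
    (if mat_wt T N i = 0 then 0 else if i = j then 1 else if T \<noteq> SL \<and> i + j + 1 = mat_dim T N then -1 else 0)"
proof -
  have e: "ebasis b \<noteq> 0" for b
    by (auto simp: ebasis_def fun_eq_iff)
  from i show ?thesis
  proof (cases rule: mat_wt_cases)
    case pos
    from j show ?thesis
    proof (cases rule: mat_wt_cases)
      case pos
      have "T \<noteq> SL \<Longrightarrow> i + j + 1 \<noteq> mat_dim T N" using pos(1) \<open>i < N\<close> by (cases T) auto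
      then show ?thesis using pos \<open>i < N\<close> \<open>mat_wt T N i = _\<close> by (auto simp: wprod_ebasis e ebasis_nth)
    next
      case (neg j')
      have "i \<noteq> j" "i + j + 1 = mat_dim T N \<longleftrightarrow> i = j'" using neg \<open>i < N\<close> by auto
      then show ?thesis using neg(1,3,5) \<open>i < N\<close> \<open>mat_wt T N i = _\<close>
        by (auto simp: wprod_ebasis wprod_simps e ebasis_nth)
    next
      case zero
      then show ?thesis using \<open>i < N\<close> by (simp add: wprod_simps)
    qed
  next
    case (neg i')
    from j show ?thesis
    proof (cases rule: mat_wt_cases)
      case pos
      have "i \<noteq> j" "i + j + 1 = mat_dim T N \<longleftrightarrow> i' = j" using neg \<open>j < N\<close> by auto
      then show ?thesis using pos neg(1,3,5) by (auto simp: wprod_ebasis wprod_simps e ebasis_nth)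
    next
      case (neg j')
      have "i = j \<longleftrightarrow> i' = j'" "i + j + 1 \<noteq> mat_dim T N"
        using neg \<open>i' < N\<close> \<open>i = mat_dim T N - Suc i'\<close> by auto
      then show ?thesis using neg(1,3,5) \<open>i' < N\<close> \<open>mat_wt T N i = _\<close>
        by (auto simp: wprod_ebasis wprod_simps e ebasis_nth)
    next
      case zero
      then show ?thesis using neg by (auto simp: wprod_simps)
    qed
  next
    case zero
    then show ?thesis by (simp add: wprod_simps)
  qed
qed

lemma mat_wt_inj:
  assumes "i < mat_dim T N" "j < mat_dim T N" "mat_wt T N i = mat_wt T N j"
  shows "i = j"
proof (cases "mat_wt T N i = 0")
  case True
  have e: "ebasis b \<noteq> 0" for b
    by (auto simp: ebasis_def fun_eq_iff)
  have "k = N" if "k < mat_dim T N" "mat_wt T N k = 0" for k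
    using that by (cases rule: mat_wt_cases) (use e in auto)
  then show ?thesis using assms True by metis
next
  case False
  then have "wprod N (mat_wt T N i) (mat_wt T N i) = 1"
    using wprod_mat_wt[OF assms(1,1)] by simp
  then have "wprod N (mat_wt T N i) (mat_wt T N j) = 1" using assms(3) by simp
  then show ?thesis using wprod_mat_wt[OF assms(1,2)] by (simp split: if_splits)
qed

lemma mat_wt_mirror:
  assumes "T \<noteq> SL" "i < mat_dim T N"
  shows "mat_wt T N (mat_dim T N - Suc i) = - mat_wt T N i"
proof -
  have "Suc (mat_dim T N - Suc i) = mat_dim T N - i" using assms(2) by simp
  then show ?thesis using assms by (cases T) (auto simp: mat_wt_def)
qed

text \<open>A difference of size 2 needs e_b against -e_b, that is, two positions mirrored in the
  antidiagonal.\<close>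

lemma mat_wt_diff_le:
  assumes i: "i < mat_dim T N" and j: "j < mat_dim T N" and "T \<noteq> SL \<Longrightarrow> i + j + 1 \<noteq> mat_dim T N"
  shows "\<bar>mat_wt T N i c - mat_wt T N j c\<bar> \<le> 1"
  using i
proof (cases rule: mat_wt_cases)
  case pos
  from j show ?thesis
    by (cases rule: mat_wt_cases) (use pos assms in \<open>auto simp: ebasis_nth\<close>)
next
  case (neg i')
  from j show ?thesis
  proof (cases rule: mat_wt_cases)
    case pos
    then show ?thesis using neg assms by (auto simp: ebasis_nth)
  next
    case (neg j')
    then show ?thesis using \<open>mat_wt T N i = _\<close> by (auto simp: ebasis_nth)
  next
    case zero
    then show ?thesis using neg by (auto simp: ebasis_nth)
  qed
next
  case zero
  from j show ?thesis
    by (cases rule: mat_wt_cases) (use zero in \<open>auto simp: ebasis_nth\<close>)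
qed

lemma mat_wt_eq_minus:
  assumes "T \<noteq> SL" "i < mat_dim T N" "j < mat_dim T N" "mat_wt T N i = - mat_wt T N j"
  shows "i = mat_dim T N - Suc j"
  by (rule mat_wt_inj[of _ T N]) (use assms mat_wt_mirror[OF assms(1,3)] in auto)

lemma wprod_mat_wt_cases:
  assumes "i < mat_dim T N" "j < mat_dim T N"
  shows "i \<noteq> j \<Longrightarrow> wprod N (mat_wt T N i) (mat_wt T N j) \<le> 0"
    and "wprod N (mat_wt T N i) (mat_wt T N j) \<in> {-1, 0, 1}"
    and "wprod N (mat_wt T N i) (mat_wt T N j) = 1 \<Longrightarrow> i = j"
    and "wprod N (mat_wt T N i) (mat_wt T N j) = -1 \<Longrightarrow>
      T \<noteq> SL \<and> mat_wt T N i = - mat_wt T N j"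
proof -
  note w = wprod_mat_wt[OF assms]
  show "i \<noteq> j \<Longrightarrow> wprod N (mat_wt T N i) (mat_wt T N j) \<le> 0"
    and "wprod N (mat_wt T N i) (mat_wt T N j) \<in> {-1, 0, 1}"
    and "wprod N (mat_wt T N i) (mat_wt T N j) = 1 \<Longrightarrow> i = j"
    unfolding w by (auto split: if_splits)
  assume "wprod N (mat_wt T N i) (mat_wt T N j) = -1"
  then have "T \<noteq> SL" "i + j + 1 = mat_dim T N" unfolding w by (auto split: if_splits)
  moreover from this have "i = mat_dim T N - Suc j" by simp
  ultimately show "T \<noteq> SL \<and> mat_wt T N i = - mat_wt T N j"
    using mat_wt_mirror[of T j N] assms by simp
qed

text \<open>A nonzero weight determines the matrix position up to reflection in the antidiagonal.
  Pairing both differences with the unit vector at a gives at least 1 on the left, and since all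
  pairings lie in {-1, 0, 1} this forces a = i or opposite weights at a and j.\<close>

lemma mat_wt_diff_eq:
  assumes M: "a < mat_dim T N" "b < mat_dim T N" "i < mat_dim T N" "j < mat_dim T N"
    and eq: "mat_wt T N a - mat_wt T N b = mat_wt T N i - mat_wt T N j" and "a \<noteq> b"
  shows "a = i \<and> b = j \<or> (T \<noteq> SL \<and> a = mat_dim T N - Suc j \<and> b = mat_dim T N - Suc i)"
proof -
  let ?w = "mat_wt T N" and ?p = "\<lambda>c d. wprod N (mat_wt T N c) (mat_wt T N d)"
  have p: "?p c a - ?p c b = ?p c i - ?p c j" for c
    using arg_cong[OF eq, of "wprod N (?w c)"] by (simp add: wprod_simps)
  have "a = i \<or> b = j \<or> (T \<noteq> SL \<and> (?w a = - ?w j \<or> ?w b = - ?w i))"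
  proof (cases "?w a = 0")
    case False
    then have "?p a a = 1" using wprod_mat_wt[OF M(1,1)] by simp
    moreover have "?p a b \<le> 0" using wprod_mat_wt_cases(1)[OF M(1,2) \<open>a \<noteq> b\<close>] .
    ultimately have "?p a i = 1 \<or> ?p a j = -1"
      using p[of a] wprod_mat_wt_cases(2)[OF M(1,3)] wprod_mat_wt_cases(2)[OF M(1,4)] by auto
    then show ?thesis
      using wprod_mat_wt_cases(3)[OF M(1,3)] wprod_mat_wt_cases(4)[OF M(1,4)] by blast
  next
    case True
    \<comment> \<open>At the middle row of \<open>SO_odd\<close> the pairing with a gives nothing,
      so b is used instead.\<close>
    then have "?w b \<noteq> 0" using mat_wt_inj[OF M(1,2)] \<open>a \<noteq> b\<close> by metis
    then have "?p b b = 1" using wprod_mat_wt[OF M(2,2)] by simp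
    moreover have "?p b a = 0" using True by (simp add: wprod_simps)
    ultimately have "?p b j = 1 \<or> ?p b i = -1"
      using p[of b] wprod_mat_wt_cases(2)[OF M(2,3)] wprod_mat_wt_cases(2)[OF M(2,4)] by auto
    then show ?thesis
      using wprod_mat_wt_cases(3)[OF M(2,4)] wprod_mat_wt_cases(4)[OF M(2,3)] by blast
  qed
  moreover have "b = j" if "a = i" using that eq mat_wt_inj[OF M(2,4)] by simp
  moreover have "a = i" if "b = j" using that eq mat_wt_inj[OF M(1,3)] by simp
  moreover have "a = mat_dim T N - Suc j \<and> b = mat_dim T N - Suc i"
    if "T \<noteq> SL" "?w a = - ?w j \<or> ?w b = - ?w i"
  proof -
    have "?w a + ?w j = ?w b + ?w i" using eq by (simp add: algebra_simps)
    then have "?w a = - ?w j" "?w b = - ?w i" using that(2) by (auto simp: eq_neg_iff_add_eq_0)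
    then show ?thesis using mat_wt_eq_minus[OF that(1)] M by blast
  qed
  ultimately show ?thesis by blast
qed

section \<open>Root spaces of the classical Lie algebras\<close>

lemma so_mat_iff:
  assumes "A \<in> carrier_mat M M"
  shows "A \<in> so_mat M \<longleftrightarrow> (\<forall>i<M. \<forall>j<M. A $$ (M - Suc j, i) = - A $$ (M - Suc i, j))"
proof -
  have 1: "(transpose_mat A * antidiag_mat M) $$ (i, j) = A $$ (M - Suc j, i)" if "i < M" "j < M" for i j
  proof -
    have "(transpose_mat A * antidiag_mat M) $$ (i, j)
        = (\<Sum>k = 0..<M. A $$ (k, i) * (if k + j + 1 = M then 1 else 0))"
      using assms that by (simp add: antidiag_mat_def scalar_prod_def)
    also have "\<dots> = (\<Sum>k = 0..<M. if k = M - Suc j then A $$ (k, i) else 0)"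
      by (rule sum.cong) (use that in auto)
    finally show ?thesis using that by simp
  qed
  have 2: "(antidiag_mat M * A) $$ (i, j) = A $$ (M - Suc i, j)" if "i < M" "j < M" for i j
  proof -
    have "(antidiag_mat M * A) $$ (i, j)
        = (\<Sum>k = 0..<M. (if i + k + 1 = M then 1 else 0) * A $$ (k, j))"
      using assms that by (simp add: antidiag_mat_def scalar_prod_def)
    also have "\<dots> = (\<Sum>k = 0..<M. if k = M - Suc i then A $$ (k, j) else 0)"
      by (rule sum.cong) (use that in auto)
    finally show ?thesis using that by simp
  qed
  have d: "transpose_mat A * antidiag_mat M + antidiag_mat M * A \<in> carrier_mat M M"
    using assms by (auto simp: antidiag_mat_def)
  have "transpose_mat A * antidiag_mat M + antidiag_mat M * A = 0\<^sub>m M M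
      \<longleftrightarrow> (\<forall>i<M. \<forall>j<M. A $$ (M - Suc j, i) + A $$ (M - Suc i, j) = 0)"
  proof
    assume eq: "transpose_mat A * antidiag_mat M + antidiag_mat M * A = 0\<^sub>m M M"
    have "A $$ (M - Suc j, i) + A $$ (M - Suc i, j) = 0" if "i < M" "j < M" for i j
      using arg_cong[OF eq, of "\<lambda>B. B $$ (i, j)"] that assms 1[OF that] 2[OF that]
      by (simp add: antidiag_mat_def)
    then show "\<forall>i<M. \<forall>j<M. A $$ (M - Suc j, i) + A $$ (M - Suc i, j) = 0" by blast
  next
    assume "\<forall>i<M. \<forall>j<M. A $$ (M - Suc j, i) + A $$ (M - Suc i, j) = 0"
    then show "transpose_mat A * antidiag_mat M + antidiag_mat M * A = 0\<^sub>m M M"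
      by (intro eq_matI) (use assms d 1 2 in \<open>auto simp: antidiag_mat_def\<close>)
  qed
  then show ?thesis using assms by (simp add: so_mat_def eq_neg_iff_add_eq_0)
qed

lemma classical_algebra_carrier: "classical_algebra T N \<subseteq> carrier_mat (mat_dim T N) (mat_dim T N)"
  by (cases T) (auto simp: sl_mat_def so_mat_def)

lemma classical_algebra_mirror:
  assumes "T \<noteq> SL" "A \<in> classical_algebra T N" "i < mat_dim T N" "j < mat_dim T N"
  shows "A $$ (mat_dim T N - Suc j, mat_dim T N - Suc i) = - A $$ (i, j)"
proof -
  let ?M = "mat_dim T N"
  have "A \<in> so_mat ?M" using assms by (cases T) auto
  moreover have "A \<in> carrier_mat ?M ?M" using assms classical_algebra_carrier by blast
  ultimately have "\<forall>i<?M. \<forall>j<?M. A $$ (?M - Suc j, i) = - A $$ (?M - Suc i, j)"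
    using so_mat_iff by blast
  moreover have "?M - Suc i < ?M" "?M - Suc (?M - Suc i) = i" using assms(3) by auto
  ultimately show ?thesis using assms(4) by metis
qed

text \<open>The Cartan element that corresponds to \<open>v\<close>: a weight \<alpha> takes the
  value \<open>wprod N \<alpha> v\<close> on it. Pairing with all weights of the defining
  representation produces the mirrored negative entries of so as well.\<close>

definition diag_wt :: "series \<Rightarrow> nat \<Rightarrow> weight \<Rightarrow> complex mat" where
  "diag_wt T N v = mat (mat_dim T N) (mat_dim T N)
     (\<lambda>(i, j). if i = j then of_int (wprod N (mat_wt T N i) v) else 0)"

lemma diag_wt_in:
  assumes "admissible T N v" shows "diag_wt T N v \<in> classical_algebra T N"
proof (cases "T = SL")
  case True
  have "(\<Sum>i<N. v (Suc i)) = (\<Sum>c=1..N. v c)"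
    by (rule sum.reindex_bij_witness[of _ "\<lambda>c. c - 1" Suc]) auto
  then have "(\<Sum>i<N. v (Suc i)) = 0" using assms True by (simp add: admissible_def)
  then have "(\<Sum>i<N. of_int (v (Suc i)) :: complex) = 0"
    by (metis of_int_0 of_int_sum)
  moreover have "diag_wt SL N v $$ (i, i) = of_int (v (Suc i))" if "i < N" for i
    using that by (simp add: diag_wt_def mat_wt_def wprod_ebasis)
  ultimately show ?thesis using True by (simp add: sl_mat_def) (simp add: diag_wt_def)
next
  case False
  let ?M = "mat_dim T N"
  have c: "diag_wt T N v \<in> carrier_mat ?M ?M" by (simp add: diag_wt_def)
  have "diag_wt T N v $$ (?M - Suc j, i) = - diag_wt T N v $$ (?M - Suc i, j)" if "i < ?M" "j < ?M" for i j
  proof (cases "i + j + 1 = ?M")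
    case True
    then have "?M - Suc j = i" "?M - Suc i = j" by auto
    then show ?thesis using that mat_wt_mirror[OF False that(2)] by (simp add: diag_wt_def wprod_simps)
  next
    case False
    then have "?M - Suc j \<noteq> i" "?M - Suc i \<noteq> j" using that by auto
    then show ?thesis using that by (simp add: diag_wt_def)
  qed
  then have "diag_wt T N v \<in> so_mat ?M" using so_mat_iff[OF c] by blast
  then show ?thesis using False by (cases T) auto
qed

lemma bracket_swap: "bracket x y = - bracket y (x :: 'g::lie_algebra)"
proof -
  have "bracket (x + y) (x + y) = bracket x y + bracket y x"
    unfolding bracket_add_left bracket_add_right by (simp add: bracket_self)
  then have "bracket x y + bracket y x = 0" unfolding bracket_self by (rule HOL.sym)
  then show ?thesis by (simp add: eq_neg_iff_add_eq_0)
qed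

lemma bracket_0 [simp]: "bracket 0 x = 0" "bracket x 0 = (0 :: 'g::lie_algebra)"
  using bracket_scaleC_left[of 0 x x] bracket_scaleC_right[of x 0 x] by simp_all

lemma bracket_minus_right: "bracket x (- y) = - bracket x (y :: 'g::lie_algebra)"
  using bracket_scaleC_right[of x "-1" y] by (simp add: scaleC_one)

lemma bracket_derivation:
  "bracket h (bracket x y) = bracket (bracket h x) y + bracket x (bracket h (y :: 'g::lie_algebra))"
proof -
  have "bracket x (bracket y h) = - bracket x (bracket h y)"
    by (subst bracket_swap[of y h]) (rule bracket_minus_right)
  moreover have "bracket y (bracket h x) = - bracket (bracket h x) y"
    by (rule bracket_swap)
  ultimately have "bracket h (bracket x y) - bracket x (bracket h y) - bracket (bracket h x) y = 0"
    using jacobi[of h x y] by simp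
  then show ?thesis by (simp add: algebra_simps)
qed

lemma weight_eval_add: "weight_eval \<phi> N (\<alpha> + \<beta>) h = weight_eval \<phi> N \<alpha> h + weight_eval \<phi> N \<beta> h"
  by (simp add: weight_eval_def sum.distrib algebra_simps)

lemma root_space_bracket:
  "x \<in> root_space \<phi> N \<alpha> \<Longrightarrow> y \<in> root_space \<phi> N \<beta> \<Longrightarrow> bracket x y \<in> root_space \<phi> N (\<alpha> + \<beta>)"
  by (simp add: root_space_def bracket_derivation bracket_scaleC_left bracket_scaleC_right
    weight_eval_add scaleC_add_left)

lemma root_space_combination:
  assumes "x \<in> root_space \<phi> N \<alpha>" "y \<in> root_space \<phi> N \<alpha>"
  shows "x + c *\<^sub>C y \<in> root_space \<phi> N \<alpha>"
  using assms by (auto simp: root_space_def bracket_add_right bracket_scaleC_right scaleC_add_right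
    scaleC_scaleC mult.commute)

locale classical_lie =
  fixes \<phi> :: "'g::lie_algebra \<Rightarrow> complex mat" and T :: series and N :: nat
  assumes iso: "lie_iso \<phi> (classical_algebra T N)"
begin

abbreviation "M \<equiv> mat_dim T N"

lemma phi_in: "\<phi> x \<in> classical_algebra T N"
  using iso by (auto simp: lie_iso_def bij_betw_def)

lemma phi_carrier [simp]: "\<phi> x \<in> carrier_mat M M"
  using phi_in classical_algebra_carrier by blast

lemma phi_dim [simp]: "dim_row (\<phi> x) = M" "dim_col (\<phi> x) = M"
  using carrier_matD[OF phi_carrier] by blast+

lemma phi_inj: "\<phi> x = \<phi> y \<Longrightarrow> x = y"
  using iso by (auto simp: lie_iso_def bij_betw_def inj_on_def)

lemma phi_add: "\<phi> (x + y) = \<phi> x + \<phi> y" and phi_scale: "\<phi> (c *\<^sub>C x) = c \<cdot>\<^sub>m \<phi> x"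
  and phi_bracket: "\<phi> (bracket x y) = \<phi> x * \<phi> y - \<phi> y * \<phi> x"
  using iso by (auto simp: lie_iso_def)

lemma phi_0: "i < M \<Longrightarrow> j < M \<Longrightarrow> \<phi> 0 $$ (i, j) = 0"
  using phi_scale[of 0 0] by (metis index_smult_mat(1) mult_zero_left phi_dim scaleC_zero_left)

lemma eq_0_iff: "x = 0 \<longleftrightarrow> (\<forall>i<M. \<forall>j<M. \<phi> x $$ (i, j) = 0)"
proof
  assume "\<forall>i<M. \<forall>j<M. \<phi> x $$ (i, j) = 0"
  then have "\<phi> x = \<phi> 0" by (intro eq_matI) (auto simp: phi_0)
  then show "x = 0" by (rule phi_inj)
qed (simp add: phi_0)

lemma bracket_cartan_nth:
  assumes "h \<in> cartan \<phi>" "i < M" "j < M"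
  shows "\<phi> (bracket h x) $$ (i, j) = (\<phi> h $$ (i, i) - \<phi> h $$ (j, j)) * \<phi> x $$ (i, j)"
proof -
  have d: "\<phi> h $$ (a, b) = 0" if "a < M" "b < M" "a \<noteq> b" for a b
    using assms(1) that by (auto simp: cartan_def diagonal_mat_def)
  have "(\<phi> h * \<phi> x) $$ (i, j) = (\<Sum>k = 0..<M. \<phi> h $$ (i, k) * \<phi> x $$ (k, j))"
    using assms by (simp add: scalar_prod_def)
  also have "\<dots> = (\<Sum>k = 0..<M. if k = i then \<phi> h $$ (i, i) * \<phi> x $$ (i, j) else 0)"
    by (rule sum.cong) (use assms d[of i] in auto)
  finally have 1: "(\<phi> h * \<phi> x) $$ (i, j) = \<phi> h $$ (i, i) * \<phi> x $$ (i, j)"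
    using assms by simp
  have "(\<phi> x * \<phi> h) $$ (i, j) = (\<Sum>k = 0..<M. \<phi> x $$ (i, k) * \<phi> h $$ (k, j))"
    using assms by (simp add: scalar_prod_def)
  also have "\<dots> = (\<Sum>k = 0..<M. if k = j then \<phi> x $$ (i, j) * \<phi> h $$ (j, j) else 0)"
    by (rule sum.cong) (use assms d[of _ j] in auto)
  finally have 2: "(\<phi> x * \<phi> h) $$ (i, j) = \<phi> x $$ (i, j) * \<phi> h $$ (j, j)"
    using assms by simp
  show ?thesis using assms 1 2 by (simp add: phi_bracket algebra_simps)
qed

lemma cartan_commute:
  assumes "h \<in> cartan \<phi>" "h' \<in> cartan \<phi>" shows "bracket h h' = 0"
  unfolding eq_0_iff using assms(2) by (auto simp: bracket_cartan_nth[OF assms(1)] cartan_def diagonal_mat_def)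

lemma obtain_dual:
  assumes "admissible T N v"
  obtains h where "h \<in> cartan \<phi>" "\<phi> h = diag_wt T N v"
    "\<And>\<alpha>. weight_eval \<phi> N \<alpha> h = of_int (wprod N \<alpha> v)"
    "\<And>i. i \<in> {1..N} \<Longrightarrow> \<phi> h $$ (i - 1, i - 1) = of_int (v i)"
proof -
  have "diag_wt T N v \<in> \<phi> ` UNIV"
    using diag_wt_in[OF assms] iso by (simp add: lie_iso_def bij_betw_def)
  then obtain h where h: "\<phi> h = diag_wt T N v" by auto
  have le: "N \<le> M" by (cases T) auto
  have c: "h \<in> cartan \<phi>" by (auto simp: cartan_def diagonal_mat_def h diag_wt_def)
  have d: "\<phi> h $$ (i - 1, i - 1) = of_int (v i)" if "i \<in> {1..N}" for i
    using that le by (auto simp: h diag_wt_def mat_wt_def wprod_ebasis)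
  then have "weight_eval \<phi> N \<alpha> h = of_int (wprod N \<alpha> v)" for \<alpha>
    by (simp add: weight_eval_def wprod_def)
  then show thesis using that c d h by blast
qed

lemma root_space_nth:
  assumes x: "x \<in> root_space \<phi> N \<omega>" and adm: "admissible T N \<omega>"
    and ij: "i < M" "j < M" and nz: "\<phi> x $$ (i, j) \<noteq> 0"
  shows "mat_wt T N i - mat_wt T N j = \<omega>"
proof -
  \<comment> \<open>The test element is dual to the very difference that should vanish: comparing
    eigenvalues on it gives <v, v> = 0, and the form is positive definite.\<close>
  define v where "v = mat_wt T N i - mat_wt T N j - \<omega>"
  have v: "admissible T N v"
    unfolding v_def using admissible_diff[OF mat_wt_admissible[OF ij] adm] .
  obtain h where h: "h \<in> cartan \<phi>" "\<phi> h = diag_wt T N v"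
    "\<And>\<alpha>. weight_eval \<phi> N \<alpha> h = of_int (wprod N \<alpha> v)"
    using obtain_dual[OF v] by metis
  have "\<phi> (bracket h x) = of_int (wprod N \<omega> v) \<cdot>\<^sub>m \<phi> x"
    using x h(1) by (simp add: root_space_def h(3) phi_scale)
  then have "(\<phi> h $$ (i, i) - \<phi> h $$ (j, j)) * \<phi> x $$ (i, j) = of_int (wprod N \<omega> v) * \<phi> x $$ (i, j)"
    using bracket_cartan_nth[OF h(1) ij, of x] ij by auto
  then have "\<phi> h $$ (i, i) - \<phi> h $$ (j, j) = of_int (wprod N \<omega> v)"
    using nz by simp
  then have "of_int (wprod N (mat_wt T N i) v - wprod N (mat_wt T N j) v) = (of_int (wprod N \<omega> v) :: complex)"
    using ij by (simp add: h(2) diag_wt_def)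
  then have "wprod N v v = 0"
    unfolding of_int_eq_iff by (subst (1) v_def) (simp add: wprod_simps)
  then show ?thesis using wprod_self_eq_0[OF v] by (simp add: v_def)
qed

lemma phi_mirror_0:
  assumes "T \<noteq> SL" "i < M" shows "\<phi> x $$ (i, M - Suc i) = 0"
proof -
  have "M - Suc i < M" "M - Suc (M - Suc i) = i" using assms by auto
  then show ?thesis using classical_algebra_mirror[OF assms(1) phi_in assms(2), of "M - Suc i" x] by simp
qed

text \<open>Any nonzero matrix entry exhibits the weight as such a sum. Read backwards, this is the
  vanishing test for brackets. The bound holds because the antidiagonal entries of so matrices are
  zero.\<close>

lemma root_space_nonzero:
  assumes "x \<in> root_space \<phi> N \<omega>" "admissible T N \<omega>" "x \<noteq> 0"
  obtains u s where "- u \<in> sgn_basis T N" "s \<in> sgn_basis T N" "\<omega> = u + s"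
    "\<And>c. \<bar>\<omega> c\<bar> \<le> 1"
proof -
  obtain i j where ij: "i < M" "j < M" "\<phi> x $$ (i, j) \<noteq> 0"
    using assms(3) unfolding eq_0_iff[of x] by blast
  have w: "\<omega> = mat_wt T N i + - mat_wt T N j"
    using root_space_nth[OF assms(1,2) ij] by simp
  have le: "\<bar>\<omega> c\<bar> \<le> 1" for c
  proof -
    have "i + j + 1 \<noteq> M" if "T \<noteq> SL"
    proof
      assume "i + j + 1 = M"
      then have "j = M - Suc i" by simp
      then show False using phi_mirror_0[OF that ij(1), of x] ij(3) by simp
    qed
    then show ?thesis
      using mat_wt_diff_le[OF ij(1,2)] unfolding w by simp
  qed
  show thesis
    by (rule that[OF mat_wt_sgn_basis[OF ij(1)] mat_wt_sgn_basis[OF ij(2)] w le])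
qed

text \<open>Choose c so that x - c y vanishes at one entry where y does not. Any other entry with
  the same weight is the mirror image of that one and vanishes with it.\<close>

lemma root_space_1_dim:
  assumes x: "x \<in> root_space \<phi> N \<omega>" and y: "y \<in> root_space \<phi> N \<omega>"
    and adm: "admissible T N \<omega>" and "\<omega> \<noteq> 0" "y \<noteq> 0"
  shows "\<exists>c. x = c *\<^sub>C y"
proof -
  obtain i j where ij: "i < M" "j < M" "\<phi> y $$ (i, j) \<noteq> 0"
    using \<open>y \<noteq> 0\<close> unfolding eq_0_iff[of y] by blast
  define c where "c = \<phi> x $$ (i, j) / \<phi> y $$ (i, j)"
  define z where "z = x + (- c) *\<^sub>C y"
  have z: "z \<in> root_space \<phi> N \<omega>" unfolding z_def by (rule root_space_combination[OF x y])
  have w: "mat_wt T N i - mat_wt T N j = \<omega>" by (rule root_space_nth[OF y adm ij])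
  have z0: "\<phi> z $$ (i, j) = 0"
    using ij by (simp add: z_def phi_add phi_scale c_def del: scaleC_minus_left)
  have "\<phi> z $$ (a, b) = 0" if "a < M" "b < M" for a b
  proof (rule ccontr)
    assume nz: "\<phi> z $$ (a, b) \<noteq> 0"
    have "mat_wt T N a - mat_wt T N b = mat_wt T N i - mat_wt T N j"
      using root_space_nth[OF z adm that nz] w by simp
    moreover have "a \<noteq> b" using root_space_nth[OF z adm that nz] \<open>\<omega> \<noteq> 0\<close> by auto
    ultimately have "a = i \<and> b = j \<or> (T \<noteq> SL \<and> a = M - Suc j \<and> b = M - Suc i)"
      using mat_wt_diff_eq that ij(1,2) by blast
    then show False
      using nz z0 classical_algebra_mirror[OF _ phi_in ij(1,2), of z] by auto
  qed
  then have "z = 0" by (simp add: eq_0_iff)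
  have "(- c) *\<^sub>C y + c *\<^sub>C y = 0" using scaleC_add_left[of "- c" c y] by simp
  then have "x = z + c *\<^sub>C y" by (simp only: z_def add.assoc add_0_right)
  with \<open>z = 0\<close> have "x = c *\<^sub>C y" by simp
  then show ?thesis ..
qed

text \<open>Duality fixes \<open>H\<close> only up to an unknown scalar, so orthogonality is what
  can be extracted. Tested on the Cartan element with coordinates \<gamma>, the pairing is \<gamma>
  (H) on one side and a multiple of <\<alpha>, \<gamma>> = 0 on the other.\<close>

lemma dual_to_orthogonal:
  assumes "dual_to \<phi> N \<alpha> H" "admissible T N \<gamma>" "wprod N \<alpha> \<gamma> = 0"
  shows "weight_eval \<phi> N \<gamma> H = 0"
proof -
  obtain h where h: "h \<in> cartan \<phi>" "\<And>\<alpha>. weight_eval \<phi> N \<alpha> h = of_int (wprod N \<alpha> \<gamma>)"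
    "\<And>i. i \<in> {1..N} \<Longrightarrow> \<phi> h $$ (i - 1, i - 1) = of_int (\<gamma> i)"
    using obtain_dual[OF assms(2)] by metis
  obtain c where "(\<Sum>i=1..N. \<phi> H $$ (i - 1, i - 1) * \<phi> h $$ (i - 1, i - 1)) = c * weight_eval \<phi> N \<alpha> h"
    using assms(1) h(1) by (auto simp: dual_to_def)
  then have "(\<Sum>i=1..N. \<phi> H $$ (i - 1, i - 1) * \<phi> h $$ (i - 1, i - 1)) = 0"
    using h(2) assms(3) by simp
  moreover have "(\<Sum>i=1..N. \<phi> H $$ (i - 1, i - 1) * \<phi> h $$ (i - 1, i - 1)) = weight_eval \<phi> N \<gamma> H"
    unfolding weight_eval_def by (rule sum.cong) (use h(3) in auto)
  ultimately show ?thesis by simp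
qed

end

section \<open>Roots of the links\<close>

lemma sgn_basis_nth:
  assumes "s \<in> sgn_basis T N"
  shows "s c \<in> {-1, 0, 1}" and "s c = 1 \<Longrightarrow> T \<noteq> SL \<and> s = ebasis c" and "s c = -1 \<Longrightarrow> s = - ebasis c"
    and "s a \<noteq> 0 \<Longrightarrow> s b \<noteq> 0 \<Longrightarrow> a = b"
  using assms by (auto simp: sgn_basis_def ebasis_nth split: if_splits)

lemma sgn_basis_uminus: "T \<noteq> SL \<Longrightarrow> s \<in> sgn_basis T N \<Longrightarrow> - s \<in> sgn_basis T N"
  by (auto simp: sgn_basis_def)

text \<open>The coefficient 1 comes from u or from s. In the second case the series is so, where
  signs may be reversed and u takes over the role of s.\<close>

lemma sgn_basis_split_first:
  assumes u: "- u \<in> sgn_basis T N" and s: "s \<in> sgn_basis T N" and c: "(u + s) c = 1"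
  shows "u + s - ebasis c \<in> sgn_basis T N"
proof -
  have "u c = 1 \<or> s c = 1"
    using sgn_basis_nth(1)[OF u, of c] sgn_basis_nth(1)[OF s, of c] c by auto
  then show ?thesis
  proof
    assume "u c = 1"
    then have "- u = - ebasis c" using sgn_basis_nth(3)[OF u, of c] by simp
    then show ?thesis using s by simp
  next
    assume "s c = 1"
    then have "T \<noteq> SL" "s = ebasis c" using sgn_basis_nth(2)[OF s] by auto
    then show ?thesis using sgn_basis_uminus[OF _ u] by simp
  qed
qed

abbreviation (input) second_sign :: "series \<Rightarrow> weight \<Rightarrow> weight" where
  "second_sign T v \<equiv> (if T = SL then - v else v)"

lemma sgn_basis_split_second:
  assumes u: "- u \<in> sgn_basis T N" and s: "s \<in> sgn_basis T N"
    and c: "(u + s) c = (if T = SL then -1 else 1)"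
  shows "second_sign T (ebasis c) - (u + s) \<in> sgn_basis T N"
proof (cases "T = SL")
  case True
  have "u c = -1 \<or> s c = -1"
    using sgn_basis_nth(1)[OF u, of c] sgn_basis_nth(1)[OF s, of c] c True by auto
  then have "s c = -1" using sgn_basis_nth(2)[OF u, of c] True by auto
  then have "s = - ebasis c" using sgn_basis_nth(3)[OF s] by simp
  then show ?thesis using u True by simp
next
  case False
  then have "- (u + s - ebasis c) \<in> sgn_basis T N"
    using sgn_basis_uminus[OF False sgn_basis_split_first[OF u s]] c by simp
  then show ?thesis using False by simp
qed

lemma sgn_basis_two_coordinates:
  assumes u: "- u \<in> sgn_basis T N" and s: "s \<in> sgn_basis T N"
    and "(u + s) a \<noteq> 0" "(u + s) b \<noteq> 0" "a \<noteq> b" "c \<noteq> a" "c \<noteq> b"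
  shows "(u + s) c = 0"
proof -
  have u': "u p \<noteq> 0 \<Longrightarrow> u q \<noteq> 0 \<Longrightarrow> p = q" for p q using sgn_basis_nth(4)[OF u, of p q] by simp
  have s': "s p \<noteq> 0 \<Longrightarrow> s q \<noteq> 0 \<Longrightarrow> p = q" for p q using sgn_basis_nth(4)[OF s] .
  have "u a \<noteq> 0 \<or> s a \<noteq> 0" "u b \<noteq> 0 \<or> s b \<noteq> 0" using assms(3,4) by auto
  then have "u c = 0 \<and> s c = 0" using u' s' assms(5-7) by metis
  then show ?thesis by simp
qed

lemma init_root_eq: "init_root T k = ebasis (2*k+1) + second_sign T (ebasis (2*k+2))"
  by (cases T) auto

lemma init_root_nth:
  "init_root T k (2*k+1) = 1" "init_root T k (2*k+2) = (if T = SL then -1 else 1)"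
  "c \<noteq> 2*k+1 \<Longrightarrow> c \<noteq> 2*k+2 \<Longrightarrow> init_root T k c = 0"
  by (simp_all add: init_root_eq ebasis_nth)

lemma init_root_admissible: "2*k+2 \<le> N \<Longrightarrow> admissible T N (init_root T k)"
  using ebasis_admissible(2)[of "2*k+1" N "2*k+2" T] ebasis_admissible(1)[of T "2*k+1" N]
    ebasis_admissible(1)[of T "2*k+2" N] admissible_add[of T N "ebasis (2*k+1)" "ebasis (2*k+2)"]
  by (cases "T = SL") (simp_all add: init_root_eq)

lemma sgn_basis_zero_below:
  assumes "s \<in> sgn_basis T N" "\<forall>c\<le>m. s c = 0"
  shows "(\<exists>b\<in>{m+1..N}. s = - ebasis b) \<or> (T \<noteq> SL \<and> (\<exists>b\<in>{m+1..N}. s = ebasis b)) \<or> (T = SO_odd \<and> s = 0)"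
proof -
  have "m + 1 \<le> b" if "s b \<noteq> 0" for b using that assms(2) by (metis not_less_eq_eq Suc_eq_plus1)
  then show ?thesis using assms(1) by (auto simp: sgn_basis_def ebasis_nth)
qed

text \<open>One description for all three series, which spares later case distinctions. The element
  0 of the signed basis accounts for the short root e_(2k+1) of so(2N+1).\<close>

lemma constituent'_iff:
  assumes "2*k+2 \<le> N"
  shows "\<alpha> \<in> constituent' T N k \<longleftrightarrow>
    (\<exists>s\<in>sgn_basis T N. \<alpha> = ebasis (2*k+1) + s \<and> (\<forall>c\<le>2*k+2. s c = 0))"
proof
  assume "\<alpha> \<in> constituent' T N k"
  moreover have "- ebasis l \<in> sgn_basis T N" "T \<noteq> SL \<Longrightarrow> ebasis l \<in> sgn_basis T N"
    "\<forall>c\<le>2*k+2. ebasis l c = 0" if "l \<in> {2*k+3..N}" for l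
    using that by (auto simp: sgn_basis_def ebasis_nth)
  moreover have "T = SO_odd \<Longrightarrow> 0 \<in> sgn_basis T N" by (auto simp: sgn_basis_def)
  ultimately show "\<exists>s\<in>sgn_basis T N. \<alpha> = ebasis (2*k+1) + s \<and> (\<forall>c\<le>2*k+2. s c = 0)"
    by (cases T) (force intro: bexI[of _ "- ebasis _"] bexI[of _ "ebasis _"] bexI[of _ 0])+
next
  assume "\<exists>s\<in>sgn_basis T N. \<alpha> = ebasis (2*k+1) + s \<and> (\<forall>c\<le>2*k+2. s c = 0)"
  then obtain s where s: "s \<in> sgn_basis T N" "\<alpha> = ebasis (2*k+1) + s" "\<forall>c\<le>2*k+2. s c = 0" by blast
  have "2*k+2+1 = 2*k+3" by simp
  then show "\<alpha> \<in> constituent' T N k"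
    using sgn_basis_zero_below[OF s(1,3)] s(2) by (cases T) auto
qed

lemma constituent'_nth:
  assumes "2*k+2 \<le> N" "\<alpha> \<in> constituent' T N k"
  shows "\<alpha> (2*k+1) = 1" "\<alpha> (2*k+2) = 0" "c \<le> 2*k \<Longrightarrow> \<alpha> c = 0"
  using assms by (auto simp: constituent'_iff ebasis_nth)

lemma constituent'_admissible:
  assumes "2*k+2 \<le> N" "\<alpha> \<in> constituent' T N k" shows "admissible T N \<alpha>"
proof -
  obtain s where s: "s \<in> sgn_basis T N" "\<alpha> = ebasis (2*k+1) + s" using assms by (auto simp: constituent'_iff)
  show ?thesis
  proof (cases "T = SL")
    case True
    then obtain b where "b \<in> {1..N}" "s = - ebasis b" using s(1) by (auto simp: sgn_basis_def)
    then show ?thesis using s(2) ebasis_admissible(2)[of "2*k+1" N b T] assms(1) by simp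
  next
    case False
    then have "admissible T N s" using s(1) by (auto simp: sgn_basis_def admissible_def ebasis_nth)
    then show ?thesis using s(2) admissible_add ebasis_admissible(1)[OF False, of "2*k+1" N] assms(1) by simp
  qed
qed

lemma finite_constituent': "finite (constituent' T N k)"
  by (cases T) auto

lemma link_weights:
  assumes k: "2*k+2 \<le> N" and "\<gamma> \<in> constituent T N k \<union> {init_root T k}"
  shows "admissible T N \<gamma>" "\<gamma> \<noteq> 0" "c \<le> 2*k \<Longrightarrow> \<gamma> c = 0"
proof -
  consider "\<gamma> = init_root T k" | "\<gamma> \<in> constituent' T N k"
    | \<alpha> where "\<alpha> \<in> constituent' T N k" "\<gamma> = init_root T k - \<alpha>"
    using assms(2) by (auto simp: constituent_def)
  then have "admissible T N \<gamma> \<and> (\<gamma> (2*k+1) \<noteq> 0 \<or> \<gamma> (2*k+2) \<noteq> 0) \<and> (c \<le> 2*k \<longrightarrow> \<gamma> c = 0)"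
  proof cases
    case 3
    then show ?thesis using constituent'_nth[OF k 3(1)] init_root_nth(2)[of T k] init_root_nth(3)[of c k T]
      admissible_diff[OF init_root_admissible[OF k] constituent'_admissible[OF k 3(1)]] by simp
  next
    case 2
    then show ?thesis using constituent'_nth[OF k 2] constituent'_admissible[OF k 2] by simp
  qed (use init_root_nth(1)[of T k] init_root_nth(3)[of c k T] init_root_admissible[OF k, of T] in simp_all)
  then show "admissible T N \<gamma>" "\<gamma> \<noteq> 0" "c \<le> 2*k \<Longrightarrow> \<gamma> c = 0" by auto
qed

lemma normalized_generatorsD:
  assumes "normalized_generators \<phi> T N H L k"
  shows "dual_to \<phi> N (init_root T k) (H (init_root T k))"
    and "L (init_root T k) \<in> root_space \<phi> N (init_root T k)" "L (init_root T k) \<noteq> 0"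
    and "bracket (H (init_root T k)) (L (init_root T k)) = L (init_root T k)"
    and "\<gamma> \<in> constituent T N k \<Longrightarrow> L \<gamma> \<in> root_space \<phi> N \<gamma>"
    and "\<alpha> \<in> constituent' T N k \<Longrightarrow> L \<alpha> \<in> root_space \<phi> N \<alpha> \<and> L \<alpha> \<noteq> 0
      \<and> L (init_root T k - \<alpha>) \<in> root_space \<phi> N (init_root T k - \<alpha>) \<and> L (init_root T k - \<alpha>) \<noteq> 0
      \<and> bracket (H (init_root T k)) (L \<alpha>) = (1/2) *\<^sub>C L \<alpha>
      \<and> bracket (H (init_root T k)) (L (init_root T k - \<alpha>)) = (1/2) *\<^sub>C L (init_root T k - \<alpha>)
      \<and> bracket (L \<alpha>) (L (init_root T k - \<alpha>)) = L (init_root T k)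
      \<and> bracket (L (init_root T k)) (L \<alpha>) = 0
      \<and> bracket (L (init_root T k)) (L (init_root T k - \<alpha>)) = 0"
  using assms by (auto simp: normalized_generators_def Let_def constituent_def)

context classical_lie
begin

lemma bracket_nonzero:
  assumes "x \<in> root_space \<phi> N \<alpha>" "y \<in> root_space \<phi> N \<beta>" "admissible T N (\<alpha> + \<beta>)" "bracket x y \<noteq> 0"
  obtains u s where "- u \<in> sgn_basis T N" "s \<in> sgn_basis T N" "\<alpha> + \<beta> = u + s"
    "\<And>c. \<bar>(\<alpha> + \<beta>) c\<bar> \<le> 1"
  using root_space_nonzero[OF root_space_bracket[OF assms(1,2)] assms(3,4)] by metis

text \<open>The weight of the bracket would be nonzero at 2k+1, at 2k+2 and at some third coordinate
  of \<open>v\<close>, while a root has at most two nonzero coordinates.\<close>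

lemma bracket_zero_init_root:
  assumes "x \<in> root_space \<phi> N \<alpha>" "y \<in> root_space \<phi> N \<beta>" "admissible T N (\<alpha> + \<beta>)"
    and eq: "\<alpha> + \<beta> = init_root T k + v" and v: "v (2*k+1) = 0" "v (2*k+2) = 0" "v \<noteq> 0"
  shows "bracket x y = 0"
proof (rule ccontr)
  assume "bracket x y \<noteq> 0"
  then obtain u s where us: "- u \<in> sgn_basis T N" "s \<in> sgn_basis T N" "\<alpha> + \<beta> = u + s"
    using bracket_nonzero[OF assms(1-3)] by metis
  obtain c where c: "v c \<noteq> 0" using v(3) by (auto simp: fun_eq_iff)
  then have ne: "c \<noteq> 2*k+1" "c \<noteq> 2*k+2" using v(1,2) by metis+
  have "(u + s) (2*k+1) \<noteq> 0" "(u + s) (2*k+2) \<noteq> 0"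
    unfolding us(3)[symmetric] eq using v(1,2) init_root_nth(1,2)[of T k] by (simp_all split: if_splits)
  from sgn_basis_two_coordinates[OF us(1,2) this _ ne] have "(init_root T k + v) c = 0"
    unfolding us(3)[symmetric] eq by simp
  then show False using c ne init_root_nth(3)[of c k T] by simp
qed

text \<open>The relations missing from the normalization: \<alpha> + \<beta> has coefficient 2 at
  2k+1, the sum of two complementary roots has coefficient 2 or -2 at 2k+2, and the mixed sum is the
  initial root plus the nonzero vector \<alpha> - \<beta>.\<close>

lemma normalized_extended_jordanian_link:
  assumes k: "2*k+2 \<le> N" and norm: "normalized_generators \<phi> T N H L k"
  shows "extended_jordanian_link T N H L k"
  unfolding extended_jordanian_link_def
proof unfold_locales
  let ?l = "init_root T k"
  note n = normalized_generatorsD[OF norm]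
  note adm = init_root_admissible[OF k, of T] constituent'_admissible[OF k, of _ T]
  show "finite (constituent' T N k)" by (rule finite_constituent')
  show "bracket (H ?l) (L ?l) = L ?l" by (rule n(4))
  fix \<alpha> assume a: "\<alpha> \<in> constituent' T N k"
  show "bracket (H ?l) (L \<alpha>) = (1/2) *\<^sub>C L \<alpha>" "bracket (H ?l) (L (?l - \<alpha>)) = (1/2) *\<^sub>C L (?l - \<alpha>)"
    "bracket (L ?l) (L \<alpha>) = 0" "bracket (L ?l) (L (?l - \<alpha>)) = 0"
    using n(6)[OF a] by auto
  fix \<beta> assume b: "\<beta> \<in> constituent' T N k"
  note nth = constituent'_nth[OF k a] constituent'_nth[OF k b]
  show "bracket (L \<alpha>) (L (?l - \<beta>)) = (if \<alpha> = \<beta> then L ?l else 0)"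
  proof (cases "\<alpha> = \<beta>")
    case False
    have "bracket (L \<alpha>) (L (?l - \<beta>)) = 0"
      by (rule bracket_zero_init_root[of _ \<alpha> _ "?l - \<beta>" k "\<alpha> - \<beta>"])
        (use n(6)[OF a] n(6)[OF b] False nth admissible_add[OF adm(2)[OF a] admissible_diff[OF adm(1) adm(2)[OF b]]]
         in \<open>auto simp: algebra_simps\<close>)
    then show ?thesis using False by simp
  qed (use n(6)[OF a] in simp)
  show "bracket (L \<alpha>) (L \<beta>) = 0"
  proof (rule ccontr)
    assume "bracket (L \<alpha>) (L \<beta>) \<noteq> 0"
    then have "\<bar>(\<alpha> + \<beta>) (2*k+1)\<bar> \<le> 1"
      using bracket_nonzero[of "L \<alpha>" \<alpha> "L \<beta>" \<beta>] n(6)[OF a] n(6)[OF b] admissible_add[OF adm(2)[OF a] adm(2)[OF b]] by metis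
    then show False using nth by simp
  qed
  show "bracket (L (?l - \<alpha>)) (L (?l - \<beta>)) = 0"
  proof (rule ccontr)
    assume "bracket (L (?l - \<alpha>)) (L (?l - \<beta>)) \<noteq> 0"
    then have "\<bar>((?l - \<alpha>) + (?l - \<beta>)) (2*k+2)\<bar> \<le> 1"
      using bracket_nonzero[of "L (?l - \<alpha>)" "?l - \<alpha>" "L (?l - \<beta>)" "?l - \<beta>"] n(6)[OF a] n(6)[OF b]
        admissible_add[OF admissible_diff[OF adm(1) adm(2)[OF a]] admissible_diff[OF adm(1) adm(2)[OF b]]] by metis
    then show False using nth init_root_nth(2)[of T k] by (simp split: if_splits)
  qed
qed

text \<open>A root vector \<open>x\<close> of a later link acts on the constituent root vectors \<open>L \<alpha>\<close> and
  \<open>L (\<lambda>\<^sub>0 - \<alpha>)\<close> as on dual bases, since it annihilates \<open>[L \<alpha>, L (\<lambda>\<^sub>0 - \<beta>)]\<close>; hence it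
  annihilates the canonical element.\<close>

lemma canonical_element_invariant:
  assumes j: "2*j+2 \<le> N" and norm: "normalized_generators \<phi> T N H L j"
    and x: "x \<in> root_space \<phi> N \<gamma>" and adm\<gamma>: "admissible T N \<gamma>"
    and "\<gamma> \<noteq> 0" and zero: "\<And>c. c \<le> 2*j+2 \<Longrightarrow> \<gamma> c = 0"
  shows "(\<Sum>\<alpha>\<in>constituent' T N j. T2 (cincl (bracket x (L \<alpha>))) (cincl (L (init_root T j - \<alpha>)))
     + T2 (cincl (L \<alpha>)) (cincl (bracket x (L (init_root T j - \<alpha>))))) = 0"
proof -
  let ?l = "init_root T j" and ?P = "constituent' T N j"
  note n = normalized_generatorsD[OF norm]
  note adml = init_root_admissible[OF j, of T] and adm = constituent'_admissible[OF j, of _ T]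
  define f where "f \<alpha> = T2 (cincl (bracket x (L \<alpha>))) (cincl (L (?l - \<alpha>)))" for \<alpha>
  define g where "g \<alpha> = T2 (cincl (L \<alpha>)) (cincl (bracket x (L (?l - \<alpha>))))" for \<alpha>
  \<comment> \<open>A nonzero bracket would have as weight a root with coefficient 1 at 2j+1; what
    remains beside e_(2j+1) is a signed basis vector beyond 2j+2, and this would make \<alpha> +
    \<gamma> a constituent.\<close>
  have fz: "f \<alpha> = 0" if a: "\<alpha> \<in> ?P" and na: "\<alpha> + \<gamma> \<notin> ?P" for \<alpha>
  proof -
    have "bracket x (L \<alpha>) = 0"
    proof (rule ccontr)
      assume "bracket x (L \<alpha>) \<noteq> 0"
      then obtain u s where us: "- u \<in> sgn_basis T N" "s \<in> sgn_basis T N" "\<gamma> + \<alpha> = u + s"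
        using bracket_nonzero[OF x conjunct1[OF n(6)[OF a]] admissible_add[OF adm\<gamma> adm[OF a]]] by metis
      have "(u + s) (2*j+1) = 1"
        unfolding us(3)[symmetric] using zero[of "2*j+1"] constituent'_nth(1)[OF j a] by simp
      from sgn_basis_split_first[OF us(1,2) this] have "\<gamma> + \<alpha> - ebasis (2*j+1) \<in> sgn_basis T N"
        unfolding us(3)[symmetric] .
      moreover obtain s' where "\<alpha> = ebasis (2*j+1) + s'" "\<forall>c\<le>2*j+2. s' c = 0"
        using a constituent'_iff[OF j] by auto
      ultimately have "\<alpha> + \<gamma> \<in> ?P"
        using zero by (auto simp: constituent'_iff[OF j] algebra_simps intro!: bexI[of _ "\<gamma> + s'"])
      then show False using na by simp
    qed
    then show ?thesis by (simp add: f_def clinear_0[OF cincl_linear] T2_simps)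
  qed
  \<comment> \<open>The same with coordinate 2j+2, because the complementary root vanishes at
    2j+1.\<close>
  have gz: "g \<beta> = 0" if b: "\<beta> \<in> ?P" and nb: "\<beta> - \<gamma> \<notin> ?P" for \<beta>
  proof -
    have "bracket x (L (?l - \<beta>)) = 0"
    proof (rule ccontr)
      assume nz: "bracket x (L (?l - \<beta>)) \<noteq> 0"
      have r: "L (?l - \<beta>) \<in> root_space \<phi> N (?l - \<beta>)" using n(6)[OF b] by blast
      obtain u s where us: "- u \<in> sgn_basis T N" "s \<in> sgn_basis T N" "\<gamma> + (?l - \<beta>) = u + s"
        using bracket_nonzero[OF x r admissible_add[OF adm\<gamma> admissible_diff[OF adml adm[OF b]]] nz] by metis
      have "(u + s) (2*j+2) = (if T = SL then -1 else 1)"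
        unfolding us(3)[symmetric]
        using zero[of "2*j+2"] constituent'_nth(2)[OF j b] init_root_nth(2)[of T j] by simp
      from sgn_basis_split_second[OF us(1,2) this]
      have "second_sign T (ebasis (2*j+2)) - (\<gamma> + (?l - \<beta>)) \<in> sgn_basis T N"
        unfolding us(3)[symmetric] .
      moreover obtain s' where s': "\<beta> = ebasis (2*j+1) + s'" "\<forall>c\<le>2*j+2. s' c = 0"
        using b constituent'_iff[OF j] by auto
      moreover have "second_sign T (ebasis (2*j+2)) - (\<gamma> + (?l - \<beta>)) = s' - \<gamma>"
        unfolding s'(1) init_root_eq by simp
      ultimately have "\<beta> - \<gamma> \<in> ?P"
        using zero by (auto simp: constituent'_iff[OF j] algebra_simps intro!: bexI[of _ "s' - \<gamma>"])
      then show False using nb by simp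
    qed
    then show ?thesis by (simp add: g_def clinear_0[OF cincl_linear] T2_simps)
  qed
  \<comment> \<open>The term of \<alpha> in the first leg cancels that of \<alpha> + \<gamma> in the
    second: both are multiples, by c and d, of L (\<alpha> + \<gamma>) (x) L (\<lambda> - \<alpha>),
    where \<lambda> is the initial root. Applying x to the zero bracket of L \<alpha> with L
    (\<lambda> - \<alpha> - \<gamma>) gives c + d = 0.\<close>
  have fg: "f \<alpha> + g (\<alpha> + \<gamma>) = 0" if a: "\<alpha> \<in> ?P" and b: "\<alpha> + \<gamma> \<in> ?P" for \<alpha>
  proof -
    let ?b = "\<alpha> + \<gamma>"
    note na = n(6)[OF a] and nb = n(6)[OF b]
    have la: "L \<alpha> \<in> root_space \<phi> N \<alpha>" and lb: "L (?l - ?b) \<in> root_space \<phi> N (?l - ?b)"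
      using na nb by auto
    have ne: "\<alpha> \<noteq> 0" if "\<alpha> \<in> ?P" for \<alpha> using constituent'_nth(1)[OF j that] by auto
    have nel: "?l - \<alpha> \<noteq> 0"
      using constituent'_nth(2)[OF j a] init_root_nth(2)[of T j] by (auto dest!: fun_cong[of _ _ "2*j+2"] split: if_splits)
    have "bracket x (L \<alpha>) \<in> root_space \<phi> N ?b"
      using root_space_bracket[OF x la] by (simp add: add.commute)
    then obtain c where c: "bracket x (L \<alpha>) = c *\<^sub>C L ?b"
      using root_space_1_dim[of _ ?b "L ?b"] nb adm[OF b] ne[OF b] by blast
    have "bracket x (L (?l - ?b)) \<in> root_space \<phi> N (?l - \<alpha>)"
      using root_space_bracket[OF x lb] by (simp add: algebra_simps)
    then obtain d where d: "bracket x (L (?l - ?b)) = d *\<^sub>C L (?l - \<alpha>)"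
      using root_space_1_dim[of _ "?l - \<alpha>" "L (?l - \<alpha>)"] na admissible_diff[OF adml adm[OF a]] nel by blast
    have "bracket (L \<alpha>) (L (?l - ?b)) = 0"
      by (rule bracket_zero_init_root[OF la lb admissible_add[OF adm[OF a] admissible_diff[OF adml adm[OF b]]], of j "- \<gamma>"])
        (use zero \<open>\<gamma> \<noteq> 0\<close> in auto)
    then have "c *\<^sub>C L ?l + d *\<^sub>C L ?l = 0"
      using bracket_derivation[of x "L \<alpha>" "L (?l - ?b)"] na nb
      by (simp add: c d bracket_scaleC_left bracket_scaleC_right)
    then have "(c + d) *\<^sub>C L ?l = 0" by (simp add: scaleC_add_left)
    have cd: "c + d = 0"
    proof (rule ccontr)
      assume "c + d \<noteq> 0"
      then have "L ?l = inverse (c + d) *\<^sub>C (c + d) *\<^sub>C L ?l" by (simp add: scaleC_scaleC scaleC_one)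
      then show False using \<open>(c + d) *\<^sub>C L ?l = 0\<close> n(3) by simp
    qed
    have "f \<alpha> + g ?b = (c + d) *\<^sub>C T2 (cincl (L ?b)) (cincl (L (?l - \<alpha>)))"
      by (simp add: f_def g_def c d cincl_scaleC T2_simps scaleC_add_left)
    then show ?thesis by (simp add: cd)
  qed
  have fin: "finite ?P" by (rule finite_constituent')
  have "sum f ?P = sum f {\<alpha> \<in> ?P. \<alpha> + \<gamma> \<in> ?P}"
    by (rule sum.mono_neutral_right) (use fin fz in auto)
  moreover have "sum g ?P = sum g {\<beta> \<in> ?P. \<beta> - \<gamma> \<in> ?P}"
    by (rule sum.mono_neutral_right) (use fin gz in auto)
  moreover have "sum g {\<beta> \<in> ?P. \<beta> - \<gamma> \<in> ?P} = (\<Sum>\<alpha>\<in>{\<alpha> \<in> ?P. \<alpha> + \<gamma> \<in> ?P}. g (\<alpha> + \<gamma>))"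
    by (rule sum.reindex_bij_witness[of _ "\<lambda>\<alpha>. \<alpha> + \<gamma>" "\<lambda>\<beta>. \<beta> - \<gamma>"]) auto
  ultimately have "sum f ?P + sum g ?P = (\<Sum>\<alpha>\<in>{\<alpha> \<in> ?P. \<alpha> + \<gamma> \<in> ?P}. f \<alpha> + g (\<alpha> + \<gamma>))"
    by (simp add: sum.distrib)
  also have "\<dots> = 0" by (rule sum.neutral) (use fg in auto)
  finally show ?thesis by (simp add: sum.distrib f_def g_def)
qed

text \<open>The later H acts on L \<alpha> and on its partner by scalars whose sum is the value of
  the earlier initial root, which is 0 by orthogonality. A later root vector has a weight supported
  beyond 2j+2: orthogonal to that initial root, and no root when added to it.\<close>

lemma later_link_invariant:
  assumes "j < k" and k: "2*k+2 \<le> N"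
    and normj: "normalized_generators \<phi> T N H L j" and normk: "normalized_generators \<phi> T N H L k"
    and x: "x \<in> link_generators T N H L k"
  shows "bracket x (H (init_root T j)) = 0 \<and> bracket x (L (init_root T j)) = 0
    \<and> (\<Sum>\<alpha>\<in>constituent' T N j. T2 (cincl (bracket x (L \<alpha>))) (cincl (L (init_root T j - \<alpha>)))
       + T2 (cincl (L \<alpha>)) (cincl (bracket x (L (init_root T j - \<alpha>))))) = 0"
proof -
  let ?l = "init_root T j" and ?m = "init_root T k"
  have j: "2*j+2 \<le> N" using assms(1,2) by simp
  note nj = normalized_generatorsD[OF normj] and nk = normalized_generatorsD[OF normk]
  note admj = init_root_admissible[OF j, of T]
  have Hj: "H ?l \<in> cartan \<phi>" and Hk: "H ?m \<in> cartan \<phi>" using nj(1) nk(1) by (auto simp: dual_to_def)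
  have lj: "?l c = 0" if "c > 2*j+2" for c using that init_root_nth(3)[of c j T] by simp
  have disj: "wprod N ?l \<gamma> = 0" if "\<And>c. c \<le> 2*j+2 \<Longrightarrow> \<gamma> c = 0" for \<gamma>
    unfolding wprod_def by (rule sum.neutral) (metis lj that not_le mult_zero_left mult_zero_right)
  show ?thesis
  proof (cases "x = H ?m")
    case True
    have m0: "?m c = 0" if "c \<le> 2*j+2" for c using that \<open>j < k\<close> init_root_nth(3)[of c k T] by simp
    have "wprod N ?m ?l = 0"
      using disj[OF m0] by (simp add: wprod_def mult.commute)
    then have le: "weight_eval \<phi> N ?l (H ?m) = 0" by (rule dual_to_orthogonal[OF nk(1) admj])
    have "T2 (cincl (bracket x (L \<alpha>))) (cincl (L (?l - \<alpha>)))
       + T2 (cincl (L \<alpha>)) (cincl (bracket x (L (?l - \<alpha>)))) = 0" if a: "\<alpha> \<in> constituent' T N j" for \<alpha>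
    proof -
      have "bracket x (L \<alpha>) = weight_eval \<phi> N \<alpha> x *\<^sub>C L \<alpha>"
        "bracket x (L (?l - \<alpha>)) = weight_eval \<phi> N (?l - \<alpha>) x *\<^sub>C L (?l - \<alpha>)"
        using nj(6)[OF a] Hk by (auto simp: root_space_def True)
      moreover have "weight_eval \<phi> N \<alpha> x + weight_eval \<phi> N (?l - \<alpha>) x = 0"
        using weight_eval_add[of \<phi> N \<alpha> "?l - \<alpha>" x] le by (simp add: True)
      ultimately show ?thesis
        by (simp add: cincl_scaleC T2_simps scaleC_add_left[symmetric])
    qed
    then show ?thesis
      using cartan_commute[OF Hk Hj] nj(2) Hk le by (simp add: root_space_def True)
  next
    case False
    then obtain \<gamma> where \<gamma>: "\<gamma> \<in> constituent T N k \<union> {?m}" "x \<in> root_space \<phi> N \<gamma>"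
      using x nk(2,5) by (auto simp: link_generators_def)
    note w = link_weights[OF k \<gamma>(1)]
    have z: "\<gamma> c = 0" if "c \<le> 2*j+2" for c using w(3) that \<open>j < k\<close> by simp
    have "weight_eval \<phi> N \<gamma> (H ?l) = 0" by (rule dual_to_orthogonal[OF nj(1) w(1) disj[OF z]])
    then have "bracket (H ?l) x = 0" using \<gamma>(2) Hj by (simp add: root_space_def)
    then have "bracket x (H ?l) = 0" by (subst bracket_swap) simp
    moreover have "bracket x (L ?l) = 0"
      by (rule bracket_zero_init_root[OF \<gamma>(2) nj(2) admissible_add[OF w(1) admj], of j \<gamma>])
        (use z w(2) in \<open>auto simp: add.commute\<close>)
    ultimately show ?thesis
      using canonical_element_invariant[OF j normj \<gamma>(2) w(1,2) z] by simp
  qed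
qed

end

theorem mainTheorem3:
  fixes \<phi> :: "'g::lie_algebra \<Rightarrow> complex mat"
    and T :: series
    and N p :: nat
    and H L :: "weight \<Rightarrow> 'g"
    and ls :: "nat \<Rightarrow> weight list"
  assumes "simple_lie_algebra TYPE('g)"
    and "lie_iso \<phi> (classical_algebra T N)"
    and "2 * p + 2 \<le> N"
    and "\<And>k. k \<le> p \<Longrightarrow> normalized_generators \<phi> T N H L k"
    and "\<And>k. k \<le> p \<Longrightarrow> distinct (ls k) \<and> set (ls k) = constituent' T N k"
  shows "(\<forall>k\<le>p. \<forall>\<alpha>\<in>constituent' T N k. \<forall>\<beta>\<in>constituent' T N k.
            extension_factor L (init_root T k) \<alpha> * extension_factor L (init_root T k) \<beta>
            = extension_factor L (init_root T k) \<beta> * extension_factor L (init_root T k) \<alpha>)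
       \<and> (\<forall>k\<le>p. twisting_element (twist_chain T H L ls k))"
proof -
  interpret classical_lie \<phi> T N by unfold_locales (rule assms(2))
  \<comment> \<open>Both coordinates of each initial root lie in the range 1..N.\<close>
  have le: "2*k+2 \<le> N" if "k \<le> p" for k using that assms(3) by simp
  have link: "extended_jordanian_link T N H L k" if "k \<le> p" for k
    by (rule normalized_extended_jordanian_link[OF le[OF that] assms(4)[OF that]])
  have "twisting_element (twist_chain T H L ls k)" if "k \<le> p" for k
    by (rule twisting_element_chain[where N=N and p=p], erule link, erule assms(5),
      rule later_link_invariant, assumption, erule le,
      rule assms(4), rule order.trans[OF less_imp_le], assumption, assumption, erule assms(4),
      assumption, rule that)
  moreover have "extension_factor L (init_root T k) \<alpha> * extension_factor L (init_root T k) \<beta>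
      = extension_factor L (init_root T k) \<beta> * extension_factor L (init_root T k) \<alpha>"
    if "k \<le> p" "\<alpha> \<in> constituent' T N k" "\<beta> \<in> constituent' T N k" for k \<alpha> \<beta>
    unfolding extension_factor_eq[OF link[OF that(1)]]
    by (rule extended_jordanian.extension_factors_commute
      [OF link[OF that(1), unfolded extended_jordanian_link_def] that(2,3)])
  ultimately show ?thesis by blast
qed

end
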